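(* There is an absolute constant $c>0$ such that for all integers $n\ge 1$ and $k\ge 1$ there exists an $\alpha$-stretch correlated sampling algorithm for $\Delta_{n,k}$ with $\alpha = O(\log k)$ (the implied constant being independent of $n$ and $k$).
   Context: For integers $n,k\ge 1$ let $\Delta_{n,k}=\{\mathbf{x}\in[0,1]^n : \|\mathbf{x}\|_1\le k\}$. A correlated sampling algorithm for $\Delta_{n,k}$ is a probability distribution $\mathcal{D}$ over deterministic maps $\mathcal{A}:\Delta_{n,k}\to 2^{[n]}$ (one draws $\mathcal{A}\sim\mathcal{D}$ once and applies the same $\mathcal{A}$ to all inputs). It is an $\alpha$-stretch correlated sampling algorithm for $\Delta_{n,k}$ if for all $\mathbf{x},\mathbf{y}\in\Delta_{n,k}$: (P1) $|\mathcal{A}(\mathbf{x})|\in\{\lfloor\|\mathbf{x}\|_1\rfloor,\lceil\|\mathbf{x}\|_1\rceil\}$ for every $\mathcal{A}$ in the support of $\mathcal{D}$; (P2) $\Pr_{\mathcal{A}\sim\mathcal{D}}[i\in\mathcal{A}(\mathbf{x})]=x_i$ for all $i\in[n]$; (P3) $\mathbb{E}_{\mathcal{A}\sim\mathcal{D}}[|\mathcal{A}(\mathbf{x})\oplus\mathcal{A}(\mathbf{y})|]\le\alpha\|\mathbf{x}-\mathbf{y}\|_1$, where $\oplus$ is symmetric difference. Logarithms are base 2.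
   Formalization: The bound O(log k) is read as O(max(1, log k)): at k = 1, log k = 0 and stretch 0 is impossible (compare the zero vector with a unit vector), so a constant stretch is claimed there; for k ≥ 2 the bound is exactly c·log k. *)

theory Defs
  imports "HOL-Probability.Probability"
begin

text \<open>Vectors in R^n are functions on the index set {1..n} (with the value
  undefined elsewhere), because n is quantified inside the theorem.\<close>

definition l1_norm :: "nat \<Rightarrow> (nat \<Rightarrow> real) \<Rightarrow> real" where
  "l1_norm n x = (\<Sum>i\<in>{1..n}. \<bar>x i\<bar>)"

definition Delta :: "nat \<Rightarrow> nat \<Rightarrow> (nat \<Rightarrow> real) set" where
  "Delta n k = {x \<in> {1..n} \<rightarrow>\<^sub>E {0..1}. l1_norm n x \<le> real k}"

text \<open>A distribution over deterministic maps is a probability measure whose underlying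
  space is a set of such maps. Its sigma-algebra is not fixed, but each evaluation map must
  be measurable, so that all probabilities and expectations below are meaningful.\<close>

definition correlated_sampling ::
  "nat \<Rightarrow> nat \<Rightarrow> ((nat \<Rightarrow> real) \<Rightarrow> nat set) measure \<Rightarrow> bool" where
  "correlated_sampling n k D \<longleftrightarrow>
     prob_space D \<and>
     space D \<subseteq> (Delta n k \<rightarrow>\<^sub>E Pow {1..n}) \<and>
     (\<forall>x\<in>Delta n k. (\<lambda>A. A x) \<in> D \<rightarrow>\<^sub>M count_space (Pow {1..n}))"

text \<open>The role of the support of D in the cardinality condition is played by the whole of
  space D: the condition holds surely, simultaneously for all inputs, and not merely almost
  surely for each input separately.\<close>

definition stretch_correlated_sampling ::
  "real \<Rightarrow> nat \<Rightarrow> nat \<Rightarrow> ((nat \<Rightarrow> real) \<Rightarrow> nat set) measure \<Rightarrow> bool" where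
  "stretch_correlated_sampling \<alpha> n k D \<longleftrightarrow>
     correlated_sampling n k D \<and>
     (\<forall>x\<in>Delta n k. \<forall>y\<in>Delta n k.
        (\<forall>A\<in>space D. int (card (A x)) \<in> {\<lfloor>l1_norm n x\<rfloor>, \<lceil>l1_norm n x\<rceil>}) \<and>
        (\<forall>i\<in>{1..n}. measure D {A \<in> space D. i \<in> A x} = x i) \<and>
        (\<integral>A. real (card (sym_diff (A x) (A y))) \<partial>D) \<le> \<alpha> * l1_norm n (\<lambda>i. x i - y i))"

text \<open>The growth rate log k with base 2, replaced by 1 at k = 1: there log k = 0, and no
  algorithm has stretch 0 (the empty set and a singleton are forced at 0 and at a unit
  vector). For k at least 2 this is exactly log k.\<close>

definition log_rate :: "nat \<Rightarrow> real" where
  "log_rate k = max 1 (log 2 (real k))"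

end

theory Submission
  imports Defs
begin

text \<open>Hash the coordinates into about \<open>k\<^sup>2\<close> buckets. A set is drawn by going down a binary tree
  over the buckets: each node receives an integer count, the floor or the ceiling of its mass, and
  one uniform coin per node splits it between the two children. A small change of
  the input makes any given node switch its split with probability proportional to that change, and a
  switch moves a single unit between two buckets, so the tree contributes its depth
  \<open>O(log k)\<close> times the size of a bucket. Inside a bucket of mass \<open>m\<close> the set is drawn
  by an exponential race, which couples all distributions at once, from the ordered pivotal
  distribution; its total variation is Lipschitz with a constant linear in \<open>m\<close> and independent
  of \<open>n\<close>. The square of the largest bucket mass has bounded expectation
  over the hash. All estimates are made for pairs of inputs so close that no partial sum
  crosses an integer, and are then chained along a segment.\<close>

text \<open>A tree over all coordinates would have depth about log n, and the bound for a single
  race is quadratic in the mass, hence in k. The hash combines the two: a tree of depth O(log k)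
  isolates pieces of bounded mass, and a race treats such a piece however many coordinates it holds.
  No fixed partition does this, since an input may concentrate on one bucket and the map is drawn
  before the input is known; so the hash is random and only an average over it is bounded. About k^2
  buckets is the birthday threshold: the sum of x_i x_j over colliding pairs then has expectation at
  most 1. A second moment of the bucket masses is needed because replacing the set in a bucket costs
  its size, while the probability of a replacement has a Lipschitz constant linear in the mass.
  Conditional probabilities given a count are not Lipschitz where that count has small weight. Hence
  costs are weighted by the law of the count, which at a node of mass m is always that of
  \<open>\<lfloor>m + U\<rfloor>\<close>.\<close>

section \<open>Splitting an integer count between two masses\<close>

text \<open>The probability that \<open>\<lfloor>m + U\<rfloor> = j\<close> for a uniform \<open>U\<close> in \<open>[0, 1)\<close>; accordingly
  \<open>interp F m\<close> below is the expectation of \<open>F \<lfloor>m + U\<rfloor>\<close>. The admissible counts of a set of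
  mass \<open>m\<close> are the \<open>j\<close> of positive weight, that is, those with \<open>\<bar>m - j\<bar> < 1\<close>.\<close>

definition tent :: "real \<Rightarrow> int \<Rightarrow> real" where
  "tent m j = max 0 (1 - \<bar>m - of_int j\<bar>)"

definition interp :: "(int \<Rightarrow> real) \<Rightarrow> real \<Rightarrow> real" where
  "interp F m = (of_int \<lfloor>m\<rfloor> + 1 - m) * F \<lfloor>m\<rfloor> + (m - of_int \<lfloor>m\<rfloor>) * F (\<lfloor>m\<rfloor> + 1)"

text \<open>The length of the set of \<open>u \<in> [0, 1)\<close> with \<open>\<lfloor>l + u\<rfloor> = a\<close> and \<open>\<lfloor>l + r + u\<rfloor> = a + b\<close>
  (systematic sampling with two masses).\<close>

definition pair_prob :: "real \<Rightarrow> real \<Rightarrow> int \<Rightarrow> int \<Rightarrow> real" where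
  "pair_prob l r a b = max 0 (min (min 1 (of_int a + 1 - l)) (of_int (a + b) + 1 - (l + r)) -
                        max (max 0 (of_int a - l)) (of_int (a + b) - (l + r)))"

text \<open>The part of the count \<open>j\<close> given to the mass \<open>l\<close>, decided by the coin \<open>u\<close> according to the
  conditional law of \<open>a\<close> under \<open>pair_prob l r a b\<close> given \<open>a + b = j\<close>. The test is multiplied out because
  the weight of \<open>j\<close> may vanish.\<close>

definition split_level :: "real \<Rightarrow> real \<Rightarrow> int \<Rightarrow> real \<Rightarrow> int" where
  "split_level l r j u = (if u * tent (l + r) j < pair_prob l r \<lfloor>l\<rfloor> (j - \<lfloor>l\<rfloor>) then \<lfloor>l\<rfloor> else \<lfloor>l\<rfloor> + 1)"

lemma cell_cases:
  assumes "of_int k \<le> m" "m \<le> of_int k + 1" and "\<bar>m - of_int j\<bar> < (1::real)"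
  shows "j = k \<or> j = k + 1"
proof -
  have "of_int j < (of_int (k + 2) :: real)" "of_int (k - 1) < (of_int j :: real)"
    using assms by auto
  then show ?thesis by linarith
qed

text \<open>The closed right end is included: there the floor has moved to \<open>k + 1\<close>, but
  both formulas give \<open>F (k + 1)\<close>. Two masses in one closed cell can thus be compared by
  a single affine formula.\<close>

lemma interp_cell:
  assumes "of_int k \<le> m" "m \<le> of_int k + 1"
  shows "interp F m = (of_int k + 1 - m) * F k + (m - of_int k) * F (k + 1)"
proof (cases "m = of_int k + 1")
  case True
  then have "\<lfloor>m\<rfloor> = k + 1" by simp
  with True show ?thesis by (simp add: interp_def)
next
  case False
  with assms have "\<lfloor>m\<rfloor> = k" by linarith
  then show ?thesis by (simp add: interp_def)
qed

lemma ex_cell: "\<exists>k::int. of_int k \<le> (m::real) \<and> m \<le> of_int k + 1"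
  by (rule exI[of _ "\<lfloor>m\<rfloor>"]) linarith

lemma tent_cell:
  assumes "of_int k \<le> m" "m \<le> of_int k + 1"
  shows "tent m k = of_int k + 1 - m" "tent m (k + 1) = m - of_int k"
  using assms by (auto simp: tent_def)

lemma interp_mono:
  assumes "\<And>j. \<bar>m - of_int j\<bar> < 1 \<Longrightarrow> F j \<le> G j"
  shows "interp F m \<le> interp G m"
proof -
  have "(of_int \<lfloor>m\<rfloor> + 1 - m) * F \<lfloor>m\<rfloor> \<le> (of_int \<lfloor>m\<rfloor> + 1 - m) * G \<lfloor>m\<rfloor>"
    by (rule mult_left_mono[OF assms]) linarith+
  moreover have "(m - of_int \<lfloor>m\<rfloor>) * F (\<lfloor>m\<rfloor> + 1) \<le> (m - of_int \<lfloor>m\<rfloor>) * G (\<lfloor>m\<rfloor> + 1)"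
  proof (cases "m = of_int \<lfloor>m\<rfloor>")
    case False
    then show ?thesis by (intro mult_left_mono assms) linarith+
  qed simp
  ultimately show ?thesis unfolding interp_def by (rule add_mono)
qed

lemma interp_cong:
  assumes "\<And>j. \<bar>m - of_int j\<bar> < 1 \<Longrightarrow> F j = G j"
  shows "interp F m = interp G m"
  using interp_mono[of m F G] interp_mono[of m G F] assms by fastforce

lemma interp_add: "interp (\<lambda>j. F j + G j) m = interp F m + interp G m"
  by (simp add: interp_def algebra_simps)

lemma interp_mult: "interp (\<lambda>j. c * F j) m = c * interp F m"
  by (simp add: interp_def algebra_simps)

lemma tent_pos_iff: "0 < tent m j \<longleftrightarrow> \<bar>m - of_int j\<bar> < 1"
  by (auto simp: tent_def)

lemma pair_prob_pos_valid:
  assumes "0 < pair_prob l r a b"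
  shows "\<bar>l - of_int a\<bar> < 1" "\<bar>r - of_int b\<bar> < 1"
  using assms by (auto simp: pair_prob_def)

lemma pair_prob_nonneg: "0 \<le> pair_prob l r a b" by (simp add: pair_prob_def)

text \<open>The fractional parts of the two masses produce no carry. The total \<open>c + d\<close>
  then splits only as \<open>(c, d)\<close>, and \<open>c + d + 1\<close> is the one total that
  leaves a choice.\<close>

lemma pair_prob_low:
  assumes "of_int c \<le> l" "l \<le> of_int c + 1" "of_int d \<le> r" "r \<le> of_int d + 1"
    "l + r \<le> of_int (c + d) + 1"
  shows "pair_prob l r c d = of_int (c + d) + 1 - (l + r)" "pair_prob l r c (d + 1) = r - of_int d"
    "pair_prob l r (c + 1) d = l - of_int c" "pair_prob l r (c + 1) (d + 1) = 0"
    "pair_prob l r (c + 1) (d - 1) = 0" "pair_prob l r (c - 1) (d + 1) = 0"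
  using assms by (auto simp: pair_prob_def max_def min_def)

text \<open>With a carry \<open>(c, d)\<close> is impossible and \<open>c + d + 2\<close> splits
  only as \<open>(c + 1, d + 1)\<close>; a choice again remains only at
  \<open>c + d + 1\<close>.\<close>

lemma pair_prob_high:
  assumes "of_int c \<le> l" "l \<le> of_int c + 1" "of_int d \<le> r" "r \<le> of_int d + 1"
    "of_int (c + d) + 1 \<le> l + r"
  shows "pair_prob l r c d = 0" "pair_prob l r c (d + 1) = of_int c + 1 - l"
    "pair_prob l r (c + 1) d = of_int d + 1 - r" "pair_prob l r (c + 1) (d + 1) = l + r - of_int (c + d) - 1"
    "pair_prob l r (c + 2) d = 0" "pair_prob l r c (d + 2) = 0"
  using assms by (auto simp: pair_prob_def max_def min_def)

text \<open>Any closed cell containing \<open>l\<close> may replace the floor. At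
  \<open>l = c + 1\<close> the test against \<open>c\<close> fails for every coin and yields
  \<open>c + 1\<close>; the floor yields the same value because its own test always succeeds
  there.\<close>

lemma split_level_cell:
  assumes "of_int c \<le> l" "l \<le> of_int c + 1" and "\<bar>l + r - of_int j\<bar> < 1" and "0 \<le> u" "u < 1"
  shows "split_level l r j u = (if u * tent (l + r) j < pair_prob l r c (j - c) then c else c + 1)"
proof (cases "l = of_int c + 1")
  case True
  have w: "0 < tent (l + r) j" using assms tent_pos_iff by blast
  have fl: "\<lfloor>l\<rfloor> = c + 1" using True by simp
  have "pair_prob l r c (j - c) = 0" using True by (auto simp: pair_prob_def)
  moreover have "pair_prob l r (c + 1) (j - (c + 1)) = tent (l + r) j"
    using True by (auto simp: pair_prob_def tent_def)
  moreover have "u * tent (l + r) j < 1 * tent (l + r) j" using w assms by (intro mult_strict_right_mono)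
  moreover have "0 \<le> u * tent (l + r) j" using w assms by simp
  ultimately show ?thesis unfolding split_level_def fl by simp
next
  case False
  with assms have "\<lfloor>l\<rfloor> = c" by linarith
  then show ?thesis by (simp add: split_level_def)
qed

text \<open>For the uniform \<open>U\<close> behind \<open>pair_prob\<close>,
  \<open>\<lfloor>l + U\<rfloor>\<close> is \<open>c\<close> or \<open>c + 1\<close>, so the two
  lengths exhaust the event that the total count is \<open>j\<close>.\<close>

lemma pair_prob_sum_tent:
  assumes "of_int c \<le> l" "l \<le> of_int c + 1"
  shows "pair_prob l r c (j - c) + pair_prob l r (c + 1) (j - (c + 1)) = tent (l + r) j"
  using assms by (auto simp: pair_prob_def tent_def max_def min_def)

lemma split_level_valid:
  assumes "\<bar>l + r - of_int j\<bar> < 1" "0 \<le> u" "u < 1"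
  shows "\<bar>l - of_int (split_level l r j u)\<bar> < 1" "\<bar>r - of_int (j - split_level l r j u)\<bar> < 1"
proof -
  let ?c = "\<lfloor>l\<rfloor>"
  have w: "0 < tent (l + r) j" using assms tent_pos_iff by blast
  have s: "pair_prob l r ?c (j - ?c) + pair_prob l r (?c + 1) (j - (?c + 1)) = tent (l + r) j"
    by (rule pair_prob_sum_tent) linarith+
  have "u * tent (l + r) j < 1 * tent (l + r) j" using w assms by (intro mult_strict_right_mono)
  moreover have "0 \<le> u * tent (l + r) j" using w assms by simp
  \<comment> \<open>Whichever branch the coin selects has positive length, and a positive length
    makes both parts admissible.\<close>
  ultimately have "0 < pair_prob l r (split_level l r j u) (j - split_level l r j u)"
    using s by (auto simp: split_level_def)
  from pair_prob_pos_valid[OF this]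
  show "\<bar>l - of_int (split_level l r j u)\<bar> < 1" "\<bar>r - of_int (j - split_level l r j u)\<bar> < 1" .
qed

section \<open>The uniform coin and averages of a split over it\<close>

definition unif :: "real measure" where
  "unif = restrict_space lborel {0..<1}"

lemma space_unif: "space unif = {0..<1}"
  by (simp add: unif_def space_restrict_space)

lemma sets_unif_borel: "A \<in> sets borel \<Longrightarrow> {0..<1} \<inter> A \<in> sets unif"
  by (auto simp: unif_def sets_restrict_space)

lemma prob_space_unif: "prob_space unif"
  by (rule prob_spaceI) (simp add: unif_def emeasure_restrict_space space_restrict_space)

lemma measurable_unif: "f \<in> borel_measurable borel \<Longrightarrow> f \<in> borel_measurable unif"
  unfolding unif_def by (intro measurable_restrict_space1) simp

lemma measure_unif_less:
  assumes "0 \<le> p" "p \<le> 1"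
  shows "measure unif {u \<in> {0..<1}. u < p} = p"
proof -
  have "{u \<in> {0..<1}. u < p} = {0..<p}" using assms by auto
  then show ?thesis using assms
    by (simp add: unif_def measure_restrict_space)
qed

lemma integral_unif_coin:
  assumes "0 \<le> p" "p \<le> (1::real)"
  shows "(\<integral>u. (if u < p then A else B) \<partial>unif) = p * A + (1 - p) * (B::real)"
proof -
  interpret prob_space unif by (rule prob_space_unif)
  let ?E = "{u \<in> {0..<1}. u < p}"
  have E: "?E \<in> sets unif"
    using sets_unif_borel[of "{..<p}"] by (auto simp: Int_def)
  have "(\<integral>u. (if u < p then A else B) \<partial>unif) = (\<integral>u. B + (A - B) * indicator ?E u \<partial>unif)"
    by (rule Bochner_Integration.integral_cong) (auto simp: space_unif indicator_def)
  also have "\<dots> = (\<integral>u. B \<partial>unif) + (\<integral>u. (A - B) * indicator ?E u \<partial>unif)"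
    using E by (intro Bochner_Integration.integral_add integrable_const integrable_mult_right integrable_real_indicator)
      (auto simp: emeasure_eq_measure)
  also have "\<dots> = B + (A - B) * measure unif ?E"
    using E by (simp add: prob_space Int_absorb2 sets.sets_into_space del: Collect_conj_eq)
  also have "measure unif ?E = p" using measure_unif_less[OF assms] .
  finally show ?thesis by (simp add: algebra_simps)
qed

lemma integral_unif_coin_neq:
  assumes "0 \<le> p" "p \<le> 1" "0 \<le> p'" "p' \<le> (1::real)"
  shows "(\<integral>u. of_bool ((u < p) \<noteq> (u < p')) \<partial>unif) = \<bar>p - p'\<bar>"
proof -
  interpret prob_space unif by (rule prob_space_unif)
  have *: "(\<integral>u. of_bool ((u < p) \<noteq> (u < p')) \<partial>unif) = p' - p"
    if "0 \<le> p" "p \<le> p'" "p' \<le> 1" for p p' :: real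
  proof -
    have "(\<integral>u. of_bool ((u < p) \<noteq> (u < p')) \<partial>unif) =
      (\<integral>u. (if u < p' then 1 else 0) - (if u < p then 1 else (0::real)) \<partial>unif)"
      using that by (intro Bochner_Integration.integral_cong) auto
    also have "\<dots> = (\<integral>u. (if u < p' then 1 else (0::real)) \<partial>unif) - (\<integral>u. (if u < p then 1 else (0::real)) \<partial>unif)"
      by (intro Bochner_Integration.integral_diff integrable_const_bound[where B=1] AE_I2 measurable_unif) auto
    also have "\<dots> = p' - p" using that by (simp add: integral_unif_coin)
    finally show ?thesis .
  qed
  show ?thesis
  proof (cases "p \<le> p'")
    case True
    then show ?thesis using *[of p p'] assms by simp
  next
    case False
    then have "(\<integral>u. of_bool ((u < p') \<noteq> (u < p)) \<partial>unif) = p - p'" using *[of p' p] assms by simp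
    moreover have "(\<lambda>u. of_bool ((u < p') \<noteq> (u < p)) :: real) = (\<lambda>u. of_bool ((u < p) \<noteq> (u < p')))"
      by auto
    ultimately show ?thesis using False by simp
  qed
qed

lemma split_level_coin:
  assumes "of_int c \<le> l" "l \<le> of_int c + 1" and "\<bar>l + r - of_int j\<bar> < 1" and "u \<in> space unif"
  shows "split_level l r j u = (if u < pair_prob l r c (j - c) / tent (l + r) j then c else c + 1)"
proof -
  have "0 < tent (l + r) j" using assms tent_pos_iff by blast
  then show ?thesis using split_level_cell[OF assms(1-3)] assms(4) by (simp add: space_unif pos_less_divide_eq)
qed

lemma coin_bounds:
  assumes "of_int c \<le> l" "l \<le> of_int c + 1"
  shows "0 \<le> pair_prob l r c (j - c) / tent (l + r) j" "pair_prob l r c (j - c) / tent (l + r) j \<le> 1"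
proof -
  have "pair_prob l r c (j - c) \<le> tent (l + r) j"
    using pair_prob_sum_tent[OF assms, of r j] pair_prob_nonneg[of l r "c + 1" "j - (c + 1)"] by linarith
  moreover have "0 \<le> tent (l + r) j" by (simp add: tent_def)
  ultimately show "pair_prob l r c (j - c) / tent (l + r) j \<le> 1" "0 \<le> pair_prob l r c (j - c) / tent (l + r) j"
    by (auto simp: divide_le_eq_1 pair_prob_nonneg)
qed

lemma split_level_integral:
  assumes "of_int c \<le> l" "l \<le> of_int c + 1" and "\<bar>l + r - of_int j\<bar> < 1"
  shows "tent (l + r) j * (\<integral>u. F (split_level l r j u) (j - split_level l r j u) \<partial>unif) =
    pair_prob l r c (j - c) * F c (j - c) + pair_prob l r (c + 1) (j - (c + 1)) * F (c + 1) (j - (c + 1))"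
proof -
  let ?p = "pair_prob l r c (j - c) / tent (l + r) j"
  have w: "0 < tent (l + r) j" using assms tent_pos_iff by blast
  have "(\<integral>u. F (split_level l r j u) (j - split_level l r j u) \<partial>unif) =
    (\<integral>u. (if u < ?p then F c (j - c) else F (c + 1) (j - (c + 1))) \<partial>unif)"
    using split_level_coin[OF assms] by (intro Bochner_Integration.integral_cong) auto
  also have "\<dots> = ?p * F c (j - c) + (1 - ?p) * F (c + 1) (j - (c + 1))"
    using integral_unif_coin[OF coin_bounds[OF assms(1,2)]] .
  also have "tent (l + r) j * \<dots> = pair_prob l r c (j - c) * F c (j - c) + (tent (l + r) j - pair_prob l r c (j - c)) * F (c + 1) (j - (c + 1))"
    using w by (simp add: field_simps)
  also have "tent (l + r) j - pair_prob l r c (j - c) = pair_prob l r (c + 1) (j - (c + 1))"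
    using pair_prob_sum_tent[OF assms(1,2), of r j] by simp
  finally show ?thesis .
qed

text \<open>At an inadmissible total both sides vanish, the pair weights being nonnegative with sum
  \<open>tent\<close>. This allows both ends of a cell to be substituted into \<open>interp\<close>
  without case distinctions.\<close>

lemma split_level_integral':
  assumes "of_int c \<le> l" "l \<le> of_int c + 1" 
  shows "tent (l + r) j * (\<integral>u. F (split_level l r j u) (j - split_level l r j u) \<partial>unif) =
    pair_prob l r c (j - c) * F c (j - c) + pair_prob l r (c + 1) (j - (c + 1)) * F (c + 1) (j - (c + 1))"
proof (cases "\<bar>l + r - of_int j\<bar> < 1")
  case True
  then show ?thesis by (rule split_level_integral[OF assms])
next
  case False
  then have "tent (l + r) j = 0" using tent_pos_iff[of "l + r" j] by (simp add: tent_def)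
  moreover from this have "pair_prob l r c (j - c) = 0" "pair_prob l r (c + 1) (j - (c + 1)) = 0"
    using pair_prob_sum_tent[OF assms, of r j] pair_prob_nonneg[of l r "c + 1" "j - (c + 1)"] pair_prob_nonneg[of l r c "j - c"]
    by linarith+
  ultimately show ?thesis by simp
qed

text \<open>Averaging the conditional law of the split over the law of the total restores the joint
  law of systematic sampling. The carry decides which two totals occur; keeping the corner of weight
  0 gives both cases one formula.\<close>

lemma interp_split_level:
  assumes "of_int c \<le> l" "l \<le> of_int c + 1" "of_int d \<le> r" "r \<le> of_int d + 1"
  shows "interp (\<lambda>j. \<integral>u. F (split_level l r j u) (j - split_level l r j u) \<partial>unif) (l + r) =
    pair_prob l r c d * F c d + pair_prob l r (c + 1) d * F (c + 1) d + pair_prob l r c (d + 1) * F c (d + 1) +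
    pair_prob l r (c + 1) (d + 1) * F (c + 1) (d + 1)"
proof (cases "l + r \<le> of_int (c + d) + 1")
  case True
  have k: "of_int (c + d) \<le> l + r" "l + r \<le> of_int (c + d) + 1" using assms True by auto
  show ?thesis
    unfolding interp_cell[OF k] tent_cell[OF k, symmetric] split_level_integral'[OF assms(1,2)]
    using pair_prob_low[OF assms True] by (simp add: algebra_simps)
next
  case False
  then have k: "of_int (c + d + 1) \<le> l + r" "l + r \<le> of_int (c + d + 1) + 1" using assms by auto
  have e: "c + d + 1 - c = d + 1" "c + d + 1 - (c + 1) = d" "c + d + 1 + 1 - c = d + 2" "c + d + 1 + 1 - (c + 1) = d + 1"
    by auto
  show ?thesis
    unfolding interp_cell[OF k] tent_cell[OF k, symmetric] split_level_integral'[OF assms(1,2)] e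
    using pair_prob_high[OF assms] False by (simp add: algebra_simps)
qed

lemma pair_prob_marginal:
  assumes "of_int c \<le> l" "l \<le> of_int c + 1" "of_int d \<le> r" "r \<le> of_int d + 1"
  shows "pair_prob l r c d + pair_prob l r c (d + 1) = of_int c + 1 - l"
    "pair_prob l r (c + 1) d + pair_prob l r (c + 1) (d + 1) = l - of_int c"
    "pair_prob l r c d + pair_prob l r (c + 1) d = of_int d + 1 - r"
    "pair_prob l r c (d + 1) + pair_prob l r (c + 1) (d + 1) = r - of_int d"
  using assms by (auto simp: pair_prob_def max_def min_def)

text \<open>The count of a child has the same form of law as that of its parent, with the child's
  own mass. This invariance carries marginals and averaged costs through the tree.\<close>

lemma interp_split_level_left: "interp (\<lambda>j. \<integral>u. F (split_level l r j u) \<partial>unif) (l + r) = interp F l"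
proof -
  obtain c where c: "of_int c \<le> l" "l \<le> of_int c + 1" using ex_cell by blast
  obtain d where d: "of_int d \<le> r" "r \<le> of_int d + 1" using ex_cell by blast
  have "interp (\<lambda>j. \<integral>u. F (split_level l r j u) \<partial>unif) (l + r) =
     (pair_prob l r c d + pair_prob l r c (d + 1)) * F c + (pair_prob l r (c + 1) d + pair_prob l r (c + 1) (d + 1)) * F (c + 1)"
    using interp_split_level[OF c d, of "\<lambda>a b. F a"] by (simp add: algebra_simps)
  then show ?thesis unfolding pair_prob_marginal[OF c d] interp_cell[OF c] .
qed

lemma interp_split_level_right: "interp (\<lambda>j. \<integral>u. F (j - split_level l r j u) \<partial>unif) (l + r) = interp F r"
proof -
  obtain c where c: "of_int c \<le> l" "l \<le> of_int c + 1" using ex_cell by blast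
  obtain d where d: "of_int d \<le> r" "r \<le> of_int d + 1" using ex_cell by blast
  have "interp (\<lambda>j. \<integral>u. F (j - split_level l r j u) \<partial>unif) (l + r) =
     (pair_prob l r c d + pair_prob l r (c + 1) d) * F d + (pair_prob l r c (d + 1) + pair_prob l r (c + 1) (d + 1)) * F (d + 1)"
    using interp_split_level[OF c d, of "\<lambda>a b. F b"] by (simp add: algebra_simps)
  then show ?thesis unfolding pair_prob_marginal[OF c d] interp_cell[OF d] .
qed

text \<open>The value is 0 when \<open>j\<close> is inadmissible for the second input: the two
  inputs cannot then meet at equal counts \<open>j\<close>, so there is no switch to charge.\<close>

definition swap_prob :: "real \<Rightarrow> real \<Rightarrow> real \<Rightarrow> real \<Rightarrow> int \<Rightarrow> real" where
  "swap_prob l r l' r' j =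
     (if \<bar>l' + r' - of_int j\<bar> < 1 then \<integral>u. of_bool (split_level l r j u \<noteq> split_level l' r' j u) \<partial>unif else 0)"

text \<open>The quotients are conditional probabilities, with no Lipschitz bound when the weights
  are small; multiplying by one of the weights repairs this.\<close>

lemma ratio_diff:
  fixes w :: real
  assumes "0 < w" "0 < w'" "0 \<le> q'" "q' \<le> w'"
  shows "w * \<bar>q / w - q' / w'\<bar> \<le> \<bar>q - q'\<bar> + \<bar>w - w'\<bar>"
proof -
  have "w * \<bar>q / w - q' / w'\<bar> = \<bar>w * (q / w - q' / w')\<bar>" using assms by (simp add: abs_mult)
  also have "w * (q / w - q' / w') = (q - q') + (q' / w') * (w' - w)"
    using assms by (simp add: field_simps)
  also have "\<bar>\<dots>\<bar> \<le> \<bar>q - q'\<bar> + \<bar>(q' / w') * (w' - w)\<bar>" by (rule abs_triangle_ineq)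
  also have "\<bar>(q' / w') * (w' - w)\<bar> \<le> 1 * \<bar>w' - w\<bar>"
    unfolding abs_mult using assms by (intro mult_right_mono) auto
  finally show ?thesis by simp
qed

lemma tent_swap_prob:
  assumes c: "of_int c \<le> l" "l \<le> of_int c + 1" "of_int c \<le> l'" "l' \<le> of_int c + 1"
    and j: "\<bar>l + r - of_int j\<bar> < 1"
  shows "tent (l + r) j * swap_prob l r l' r' j \<le>
    \<bar>pair_prob l r c (j - c) - pair_prob l' r' c (j - c)\<bar> + \<bar>tent (l + r) j - tent (l' + r') j\<bar>"
proof (cases "\<bar>l' + r' - of_int j\<bar> < 1")
  case True
  let ?p = "pair_prob l r c (j - c) / tent (l + r) j" and ?p' = "pair_prob l' r' c (j - c) / tent (l' + r') j"
  have w: "0 < tent (l + r) j" "0 < tent (l' + r') j" using j True tent_pos_iff by blast+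
  have "swap_prob l r l' r' j = (\<integral>u. of_bool ((u < ?p) \<noteq> (u < ?p')) \<partial>unif)"
    unfolding swap_prob_def using True split_level_coin[OF c(1,2) j] split_level_coin[OF c(3,4) True]
    by (auto intro!: Bochner_Integration.integral_cong)
  also have "\<dots> = \<bar>?p - ?p'\<bar>"
    by (intro integral_unif_coin_neq coin_bounds c)
  finally have s: "swap_prob l r l' r' j = \<bar>?p - ?p'\<bar>" .
  have "pair_prob l' r' c (j - c) \<le> tent (l' + r') j"
    using coin_bounds(2)[OF c(3,4), of r' j] w by simp
  then show ?thesis unfolding s using ratio_diff[OF w pair_prob_nonneg] by blast
qed (simp add: swap_prob_def)

lemma pair_prob_det:
  assumes "of_int c \<le> l" "l \<le> of_int c + 1" "pair_prob l r c (j - c) = tent (l + r) j"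
    "u \<in> space unif" "\<bar>l + r - of_int j\<bar> < 1"
  shows "split_level l r j u = c"
proof -
  have "0 < tent (l + r) j" using assms tent_pos_iff by blast
  then show ?thesis using split_level_coin[OF assms(1,2,5,4)] assms(3,4) by (simp add: space_unif)
qed

lemma pair_prob_det':
  assumes "of_int c \<le> l" "l \<le> of_int c + 1" "pair_prob l r c (j - c) = 0"
    "u \<in> space unif" "\<bar>l + r - of_int j\<bar> < 1"
  shows "split_level l r j u = c + 1"
  using split_level_coin[OF assms(1,2,5,4)] assms(3,4) by (simp add: space_unif)

text \<open>The border \<open>c + d + 1\<close> between the cases without and with a carry is an
  integer, so two sums in one unit cell cannot lie strictly on different sides of it.\<close>

lemma same_sum_cell:
  fixes l r l' r' :: real
  assumes "of_int c \<le> l" "l \<le> of_int c + 1" "of_int c \<le> l'" "l' \<le> of_int c + 1"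
    "of_int d \<le> r" "r \<le> of_int d + 1" "of_int d \<le> r'" "r' \<le> of_int d + 1"
    "of_int e \<le> l + r" "l + r \<le> of_int e + 1" "of_int e \<le> l' + r'" "l' + r' \<le> of_int e + 1"
  shows "(l + r \<le> of_int (c + d) + 1 \<and> l' + r' \<le> of_int (c + d) + 1) \<or>
    (of_int (c + d) + 1 \<le> l + r \<and> of_int (c + d) + 1 \<le> l' + r')"
proof (cases "e \<le> c + d")
  case True
  then have "of_int e \<le> (of_int (c + d) :: real)" by simp
  then show ?thesis using assms by linarith
next
  case False
  then have "of_int (c + d) + 1 \<le> (of_int e :: real)" by linarith
  then show ?thesis using assms by linarith
qed

text \<open>The common cells put both inputs into the same carry case, and there every total but
  \<open>c + d + 1\<close> is split in a forced way, so only that total can produce a switch. The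
  cost is the change of one pair weight plus the change of the weight of the total, each at most the
  change of the two masses; hence the factor 2.\<close>

lemma interp_swap_prob:
  assumes c: "of_int c \<le> l" "l \<le> of_int c + 1" "of_int c \<le> l'" "l' \<le> of_int c + 1"
    and d: "of_int d \<le> r" "r \<le> of_int d + 1" "of_int d \<le> r'" "r' \<le> of_int d + 1"
    and e: "of_int e \<le> l + r" "l + r \<le> of_int e + 1" "of_int e \<le> l' + r'" "l' + r' \<le> of_int e + 1"
  shows "interp (swap_prob l r l' r') (l + r) \<le> 2 * (\<bar>l - l'\<bar> + \<bar>r - r'\<bar>)"
proof -
  consider (lo) "l + r \<le> of_int (c + d) + 1" "l' + r' \<le> of_int (c + d) + 1" |
    (hi) "of_int (c + d) + 1 \<le> l + r" "of_int (c + d) + 1 \<le> l' + r'"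
    using same_sum_cell[OF c d e] by blast
  then show ?thesis
  proof cases
    case lo
    have k: "of_int (c + d) \<le> l + r" "l + r \<le> of_int (c + d) + 1"
      "of_int (c + d) \<le> l' + r'" "l' + r' \<le> of_int (c + d) + 1" using c d lo by auto
    note R = pair_prob_low[OF c(1,2) d(1,2) lo(1)] and R' = pair_prob_low[OF c(3,4) d(3,4) lo(2)]
    have "tent (l + r) (c + d) * swap_prob l r l' r' (c + d) \<le> 0"
    proof (cases "\<bar>l + r - of_int (c + d)\<bar> < 1")
      case True
      have "swap_prob l r l' r' (c + d) = 0"
      proof (cases "\<bar>l' + r' - of_int (c + d)\<bar> < 1")
        case t: True
        have "of_bool (split_level l r (c + d) u \<noteq> split_level l' r' (c + d) u) = (0::real)" if "u \<in> space unif" for u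
          using pair_prob_det[OF c(1,2) _ that True] pair_prob_det[OF c(3,4) _ that t] R(1) R'(1)
            tent_cell(1)[OF k(1,2)] tent_cell(1)[OF k(3,4)] by simp
        then have "(\<integral>u. of_bool (split_level l r (c + d) u \<noteq> split_level l' r' (c + d) u) \<partial>unif) = (\<integral>u. (0::real) \<partial>unif)"
          by (intro Bochner_Integration.integral_cong) auto
        then show ?thesis by (simp add: swap_prob_def)
      qed (simp add: swap_prob_def)
      then show ?thesis by simp
    qed (use tent_pos_iff[of "l + r" "c + d"] in \<open>auto simp: tent_def\<close>)
    moreover have "tent (l + r) (c + d + 1) * swap_prob l r l' r' (c + d + 1) \<le> 2 * (\<bar>l - l'\<bar> + \<bar>r - r'\<bar>)"
    proof (cases "\<bar>l + r - of_int (c + d + 1)\<bar> < 1")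
      case True
      have "c + d + 1 - c = d + 1" by simp
      then have "tent (l + r) (c + d + 1) * swap_prob l r l' r' (c + d + 1) \<le>
          \<bar>pair_prob l r c (d + 1) - pair_prob l' r' c (d + 1)\<bar> + \<bar>tent (l + r) (c + d + 1) - tent (l' + r') (c + d + 1)\<bar>"
        using tent_swap_prob[OF c True, of r'] by simp
      also have "\<dots> \<le> 2 * (\<bar>l - l'\<bar> + \<bar>r - r'\<bar>)"
        unfolding R(2) R'(2) tent_cell(2)[OF k(1,2)] tent_cell(2)[OF k(3,4)] by (smt (verit))
      finally show ?thesis .
    qed (use tent_pos_iff[of "l + r" "c + d + 1"] in \<open>auto simp: tent_def\<close>)
    ultimately show ?thesis unfolding interp_cell[OF k(1,2)] tent_cell[OF k(1,2), symmetric] by linarith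
  next
    case hi
    have k: "of_int (c + d + 1) \<le> l + r" "l + r \<le> of_int (c + d + 1) + 1"
      "of_int (c + d + 1) \<le> l' + r'" "l' + r' \<le> of_int (c + d + 1) + 1" using c d hi by auto
    note R = pair_prob_high[OF c(1,2) d(1,2) hi(1)] and R' = pair_prob_high[OF c(3,4) d(3,4) hi(2)]
    have "tent (l + r) (c + d + 1 + 1) * swap_prob l r l' r' (c + d + 1 + 1) \<le> 0"
    proof (cases "\<bar>l + r - of_int (c + d + 1 + 1)\<bar> < 1")
      case True
      have x: "c + d + 1 + 1 - c = d + 2" by simp
      have z: "pair_prob l r c (c + d + 1 + 1 - c) = 0" "pair_prob l' r' c (c + d + 1 + 1 - c) = 0"
        by (simp_all only: x R(6) R'(6))
      have "swap_prob l r l' r' (c + d + 1 + 1) = 0"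
      proof (cases "\<bar>l' + r' - of_int (c + d + 1 + 1)\<bar> < 1")
        case t: True
        have "of_bool (split_level l r (c + d + 1 + 1) u \<noteq> split_level l' r' (c + d + 1 + 1) u) = (0::real)" if "u \<in> space unif" for u
          using pair_prob_det'[OF c(1,2) z(1) that True] pair_prob_det'[OF c(3,4) z(2) that t] by simp
        then have "(\<integral>u. of_bool (split_level l r (c + d + 1 + 1) u \<noteq> split_level l' r' (c + d + 1 + 1) u) \<partial>unif) = (\<integral>u. (0::real) \<partial>unif)"
          by (intro Bochner_Integration.integral_cong) auto
        then show ?thesis by (simp add: swap_prob_def)
      qed (simp add: swap_prob_def)
      then show ?thesis by simp
    qed (use tent_pos_iff[of "l + r" "c + d + 1 + 1"] in \<open>auto simp: tent_def\<close>)
    moreover have "tent (l + r) (c + d + 1) * swap_prob l r l' r' (c + d + 1) \<le> 2 * (\<bar>l - l'\<bar> + \<bar>r - r'\<bar>)"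
    proof (cases "\<bar>l + r - of_int (c + d + 1)\<bar> < 1")
      case True
      have "c + d + 1 - c = d + 1" by simp
      then have "tent (l + r) (c + d + 1) * swap_prob l r l' r' (c + d + 1) \<le>
          \<bar>pair_prob l r c (d + 1) - pair_prob l' r' c (d + 1)\<bar> + \<bar>tent (l + r) (c + d + 1) - tent (l' + r') (c + d + 1)\<bar>"
        using tent_swap_prob[OF c True, of r'] by simp
      also have "\<dots> \<le> 2 * (\<bar>l - l'\<bar> + \<bar>r - r'\<bar>)"
        unfolding R(2) R'(2) tent_cell(1)[OF k(1,2)] tent_cell(1)[OF k(3,4)] by (smt (verit))
      finally show ?thesis .
    qed (use tent_pos_iff[of "l + r" "c + d + 1"] in \<open>auto simp: tent_def\<close>)
    ultimately show ?thesis unfolding interp_cell[OF k(1,2)] tent_cell[OF k(1,2), symmetric] by linarith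
  qed
qed

text \<open>If the counts already differ, then exactly one child inherits the difference; so discrepancies are
  created only by switches at equal counts.\<close>

lemma split_level_diff:
  assumes c: "of_int c \<le> l" "l \<le> of_int c + 1" "of_int c \<le> l'" "l' \<le> of_int c + 1"
    and d: "of_int d \<le> r" "r \<le> of_int d + 1" "of_int d \<le> r'" "r' \<le> of_int d + 1"
    and e: "of_int e \<le> l + r" "l + r \<le> of_int e + 1" "of_int e \<le> l' + r'" "l' + r' \<le> of_int e + 1"
    and j: "\<bar>l + r - of_int j\<bar> < 1" "\<bar>l' + r' - of_int j'\<bar> < 1" and u: "u \<in> space unif"
  shows "of_bool (split_level l r j u \<noteq> split_level l' r' j' u) + of_bool (j - split_level l r j u \<noteq> j' - split_level l' r' j' u) \<le>
    of_bool (j \<noteq> j') + 2 * (of_bool (j = j' \<and> split_level l r j u \<noteq> split_level l' r' j u) :: real)"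
proof (cases "j = j'")
  case False
  have s: "split_level l r j u = c \<or> split_level l r j u = c + 1" "split_level l' r' j' u = c \<or> split_level l' r' j' u = c + 1"
    using split_level_coin[OF c(1,2) j(1) u] split_level_coin[OF c(3,4) j(2) u] by auto
  consider (lo) "l + r \<le> of_int (c + d) + 1" "l' + r' \<le> of_int (c + d) + 1" |
    (hi) "of_int (c + d) + 1 \<le> l + r" "of_int (c + d) + 1 \<le> l' + r'"
    using same_sum_cell[OF c d e] by blast
  then have "split_level l r j u = split_level l' r' j' u \<or> j - split_level l r j u = j' - split_level l' r' j' u"
  proof cases
    case lo
    have k: "of_int (c + d) \<le> l + r" "l + r \<le> of_int (c + d) + 1"
      "of_int (c + d) \<le> l' + r'" "l' + r' \<le> of_int (c + d) + 1" using c d lo by auto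
    note R = pair_prob_low[OF c(1,2) d(1,2) lo(1)] and R' = pair_prob_low[OF c(3,4) d(3,4) lo(2)]
    \<comment> \<open>Of two different admissible totals one is \<open>c + d\<close>, which is
      forced to \<open>(c, d)\<close>. The other is split as \<open>(c, d + 1)\<close> or
      \<open>(c + 1, d)\<close>, and either agrees with \<open>(c, d)\<close> in one part.\<close>
    have "split_level l r j u = c" if "j = c + d"
      using pair_prob_det[OF c(1,2) _ u j(1)] that R(1) tent_cell(1)[OF k(1,2)] by simp
    moreover have "split_level l' r' j' u = c" if "j' = c + d"
      using pair_prob_det[OF c(3,4) _ u j(2)] that R'(1) tent_cell(1)[OF k(3,4)] by simp
    ultimately show ?thesis
      using s False cell_cases[OF k(1,2) j(1)] cell_cases[OF k(3,4) j(2)] by auto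
  next
    case hi
    have k: "of_int (c + d + 1) \<le> l + r" "l + r \<le> of_int (c + d + 1) + 1"
      "of_int (c + d + 1) \<le> l' + r'" "l' + r' \<le> of_int (c + d + 1) + 1" using c d hi by auto
    note R = pair_prob_high[OF c(1,2) d(1,2) hi(1)] and R' = pair_prob_high[OF c(3,4) d(3,4) hi(2)]
    have x: "c + d + 1 + 1 - c = d + 2" by simp
    have "split_level l r j u = c + 1" if "j = c + d + 1 + 1"
      by (rule pair_prob_det'[OF c(1,2) _ u j(1)]) (simp only: that x R(6))
    moreover have "split_level l' r' j' u = c + 1" if "j' = c + d + 1 + 1"
      by (rule pair_prob_det'[OF c(3,4) _ u j(2)]) (simp only: that x R'(6))
    ultimately show ?thesis
      using s False cell_cases[OF k(1,2) j(1)] cell_cases[OF k(3,4) j(2)] by auto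
  qed
  then show ?thesis using False by auto
qed simp

section \<open>Simultaneous coupling of distributions by an exponential race\<close>

definition expo :: "real measure" where
  "expo = density lborel (exponential_density 1)"

lemma prob_space_expo: "prob_space expo"
  unfolding expo_def by (rule prob_space_exponential_density) simp

lemma sets_expo [measurable_cong, simp]: "sets expo = sets borel"
  by (simp add: expo_def)

lemma space_expo [simp]: "space expo = UNIV"
  by (simp add: expo_def)

lemma measure_expo_abs_gt:
  assumes "0 \<le> c"
  shows "exp (- c) \<le> measure expo {z. c < \<bar>z\<bar>}"
proof -
  interpret prob_space expo by (rule prob_space_expo)
  have "distributed expo lborel (\<lambda>x. x) (exponential_density 1)"
    unfolding distributed_def
    by (auto simp: distr_id2 expo_def)
  from exponential_distributedD_gt[OF this assms]
  have "exp (- c) = measure expo {z. c < z}" by simp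
  also have "\<dots> \<le> measure expo {z. c < \<bar>z\<bar>}"
    by (intro finite_measure_mono) auto
  finally show ?thesis .
qed

text \<open>Up to the factor \<open>1 / (1 + \<beta>)\<close> the integrand is the exponential
  density of rate \<open>1 + \<beta>\<close>.\<close>

lemma nn_integral_expo_exp:
  assumes "0 \<le> \<beta>"
  shows "(\<integral>\<^sup>+y. ennreal (exp (- (\<bar>y\<bar> * \<beta>))) \<partial>expo) = ennreal (1 / (1 + \<beta>))"
proof -
  interpret P: prob_space "density lborel (exponential_density (1 + \<beta>))"
    by (rule prob_space_exponential_density) (use assms in simp)
  have "(\<integral>\<^sup>+y. ennreal (exp (- (\<bar>y\<bar> * \<beta>))) \<partial>expo) =
    (\<integral>\<^sup>+y. ennreal (exponential_density 1 y) * ennreal (exp (- (\<bar>y\<bar> * \<beta>))) \<partial>lborel)"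
    unfolding expo_def by (rule nn_integral_density) auto
  also have "\<dots> = (\<integral>\<^sup>+y. ennreal (1 / (1 + \<beta>)) * (ennreal (exponential_density (1 + \<beta>) y) * 1) \<partial>lborel)"
  proof (intro nn_integral_cong)
    fix y
    have "1 / (1 + \<beta>) * exponential_density (1 + \<beta>) y = exponential_density 1 y * exp (- (\<bar>y\<bar> * \<beta>))"
      using assms by (simp add: exponential_density_def exp_add[symmetric]) (simp add: algebra_simps)
    then show "ennreal (exponential_density 1 y) * ennreal (exp (- (\<bar>y\<bar> * \<beta>))) =
        ennreal (1 / (1 + \<beta>)) * (ennreal (exponential_density (1 + \<beta>) y) * 1)"
      using assms by (simp add: ennreal_mult[symmetric] exponential_density_nonneg)
  qed
  also have "\<dots> = ennreal (1 / (1 + \<beta>)) * (\<integral>\<^sup>+y. ennreal (exponential_density (1 + \<beta>) y) * 1 \<partial>lborel)"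
    by (rule nn_integral_cmult) simp
  also have "(\<integral>\<^sup>+y. ennreal (exponential_density (1 + \<beta>) y) * 1 \<partial>lborel) =
      (\<integral>\<^sup>+y. 1 \<partial>density lborel (exponential_density (1 + \<beta>)))"
    by (rule nn_integral_density[symmetric]) auto
  also have "\<dots> = 1" using P.emeasure_space_1 by simp
  finally show ?thesis by simp
qed

lemma sets_race:
  assumes "finite S" "s \<in> S"
  shows "{\<omega> \<in> space (PiM S (\<lambda>_. expo)). \<forall>r\<in>S - {s}. \<bar>\<omega> s\<bar> * b r < \<bar>\<omega> r\<bar> * a} \<in> sets (PiM S (\<lambda>_. expo))"
proof (rule sets.sets_Collect_finite_All)
  fix r assume "r \<in> S - {s}"
  then have [measurable]: "(\<lambda>\<omega>. \<omega> r) \<in> borel_measurable (PiM S (\<lambda>_. expo))"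
    "(\<lambda>\<omega>. \<omega> s) \<in> borel_measurable (PiM S (\<lambda>_. expo))"
    using measurable_component_singleton[of r S "\<lambda>_. expo"] measurable_component_singleton[of s S "\<lambda>_. expo"] assms(2)
    by (simp_all cong: measurable_cong_sets)
  show "{\<omega> \<in> space (PiM S (\<lambda>_. expo)). \<bar>\<omega> s\<bar> * b r < \<bar>\<omega> r\<bar> * a} \<in> sets (PiM S (\<lambda>_. expo))"
    by measurable
qed (use assms in simp)

text \<open>Given the clock of \<open>s\<close>, the other clocks must exceed given thresholds
  independently; the product of the tails is a single exponential, whose average is the left side.
  The weight \<open>a\<close> of \<open>s\<close> is kept apart from the weights \<open>b\<close> of
  its rivals because comparing two races requires a mixed one.\<close>

lemma prob_race:
  assumes S: "finite S" "s \<in> S" and a: "0 < a" and b: "\<And>r. r \<in> S - {s} \<Longrightarrow> 0 \<le> b r"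
  shows "a / (a + sum b (S - {s})) \<le>
    measure (PiM S (\<lambda>_. expo)) {\<omega> \<in> space (PiM S (\<lambda>_. expo)). \<forall>r\<in>S - {s}. \<bar>\<omega> s\<bar> * b r < \<bar>\<omega> r\<bar> * a}"
proof -
  interpret E: prob_space expo by (rule prob_space_expo)
  interpret product_prob_space "\<lambda>_. expo" by standard
  define I where "I = S - {s}"
  have I: "finite I" "s \<notin> I" "S = insert s I" using S by (auto simp: I_def)
  interpret PS: prob_space "PiM S (\<lambda>_. expo)" by (intro prob_space_PiM prob_space_expo)
  let ?A = "{\<omega> \<in> space (PiM S (\<lambda>_. expo)). \<forall>r\<in>I. \<bar>\<omega> s\<bar> * b r < \<bar>\<omega> r\<bar> * a}"
  have A[measurable]: "?A \<in> sets (PiM S (\<lambda>_. expo))"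
    using sets_race[OF S, of b a] by (simp add: I_def)
  have "ennreal (a / (a + sum b I)) = ennreal (1 / (1 + sum b I / a))"
    using a by (simp add: field_simps)
  also have "\<dots> = (\<integral>\<^sup>+y. ennreal (exp (- (\<bar>y\<bar> * (sum b I / a)))) \<partial>expo)"
    using a b by (intro nn_integral_expo_exp[symmetric] divide_nonneg_pos sum_nonneg) (auto simp: I_def)
  also have "\<dots> \<le> (\<integral>\<^sup>+y. (\<integral>\<^sup>+x. indicator ?A (x(s := y)) \<partial>PiM I (\<lambda>_. expo)) \<partial>expo)"
  proof (intro nn_integral_mono)
    fix y :: real
    let ?B = "\<lambda>r. {z. \<bar>y\<bar> * b r / a < \<bar>z\<bar>}"
    have "ennreal (exp (- (\<bar>y\<bar> * (sum b I / a)))) = ennreal (\<Prod>r\<in>I. exp (- (\<bar>y\<bar> * b r / a)))"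
      by (simp add: exp_sum[OF I(1), symmetric] sum_negf sum_distrib_left sum_divide_distrib)
    also have "\<dots> \<le> ennreal (\<Prod>r\<in>I. measure expo (?B r))"
      using a b by (intro ennreal_leI prod_mono conjI measure_expo_abs_gt divide_nonneg_pos mult_nonneg_nonneg) (auto simp: I_def)
    also have "\<dots> = (\<Prod>r\<in>I. emeasure expo (?B r))"
      by (simp add: prod_ennreal E.emeasure_eq_measure)
    also have "\<dots> = emeasure (PiM I (\<lambda>_. expo)) (Pi\<^sub>E I ?B)"
      by (rule emeasure_PiM[symmetric]) (use I in auto)
    also have "\<dots> = (\<integral>\<^sup>+x. indicator (Pi\<^sub>E I ?B) x \<partial>PiM I (\<lambda>_. expo))"
      by (rule nn_integral_indicator[symmetric]) (use I in \<open>auto intro!: sets_PiM_I_finite\<close>)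
    also have "\<dots> = (\<integral>\<^sup>+x. indicator ?A (x(s := y)) \<partial>PiM I (\<lambda>_. expo))"
    proof (intro nn_integral_cong)
      fix x assume x: "x \<in> space (PiM I (\<lambda>_. expo))"
      have "x(s := y) \<in> space (PiM S (\<lambda>_. expo))"
        using x I(2) unfolding I(3) by (auto simp: space_PiM PiE_def extensional_def)
      moreover have "(x(s := y)) r = x r" if "r \<in> I" for r using that I by auto
      ultimately have "x(s := y) \<in> ?A \<longleftrightarrow> x \<in> Pi\<^sub>E I ?B"
        using x a by (auto simp: space_PiM PiE_iff field_simps)
      then show "indicator (Pi\<^sub>E I ?B) x = (indicator ?A (x(s := y)) :: ennreal)"
        by (simp add: indicator_def)
    qed
    finally show "ennreal (exp (- (\<bar>y\<bar> * (sum b I / a)))) \<le> (\<integral>\<^sup>+x. indicator ?A (x(s := y)) \<partial>PiM I (\<lambda>_. expo))" .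
  qed
  also have "\<dots> = (\<integral>\<^sup>+x. indicator ?A x \<partial>PiM S (\<lambda>_. expo))"
    unfolding I(3)
    by (rule product_nn_integral_insert_rev[OF I(1,2), symmetric]) (use A I(3) in simp)
  also have "\<dots> = ennreal (measure (PiM S (\<lambda>_. expo)) ?A)"
    using A by (simp add: PS.emeasure_eq_measure)
  finally show ?thesis
    by (simp add: I_def)
qed

text \<open>The outcome with the earliest arrival \<open>\<omega> s / p s\<close>, multiplied out because \<open>p s\<close> may vanish. The
  clocks are nonnegative only almost surely, hence the absolute values.\<close>

definition wins :: "'a set \<Rightarrow> ('a \<Rightarrow> real) \<Rightarrow> ('a \<Rightarrow> real) \<Rightarrow> 'a \<Rightarrow> bool" where
  "wins S \<omega> p s \<longleftrightarrow> s \<in> S \<and> (\<forall>r\<in>S - {s}. \<bar>\<omega> s\<bar> * p r < \<bar>\<omega> r\<bar> * p s)"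

definition pick :: "'a set \<Rightarrow> ('a \<Rightarrow> real) \<Rightarrow> ('a \<Rightarrow> real) \<Rightarrow> 'a" where
  "pick S \<omega> p = (if \<exists>s. wins S \<omega> p s then THE s. wins S \<omega> p s else SOME s. s \<in> S)"

lemma wins_unique: "wins S \<omega> p s \<Longrightarrow> wins S \<omega> p t \<Longrightarrow> s = t"
  unfolding wins_def by (metis DiffI less_asym singletonD)

lemma pick_eq: "wins S \<omega> p s \<Longrightarrow> pick S \<omega> p = s"
  unfolding pick_def using wins_unique[of S \<omega> p] by (auto intro!: the_equality)

lemma pick_in: "S \<noteq> {} \<Longrightarrow> pick S \<omega> p \<in> S"
proof (cases "\<exists>s. wins S \<omega> p s")
  case True
  then show ?thesis using pick_eq by (metis wins_def)
qed (simp add: pick_def some_in_eq)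

lemma measurable_pick:
  assumes "finite S" "S \<noteq> {}"
  shows "(\<lambda>\<omega>. pick S \<omega> p) \<in> PiM S (\<lambda>_. expo) \<rightarrow>\<^sub>M count_space S"
proof -
  let ?M = "PiM S (\<lambda>_. expo)"
  have W: "{\<omega> \<in> space ?M. wins S \<omega> p s} \<in> sets ?M" if "s \<in> S" for s
    using sets_race[OF assms(1) that, of p "p s"] that unfolding wins_def by simp
  have N: "{\<omega> \<in> space ?M. \<not> (\<exists>s. wins S \<omega> p s)} \<in> sets ?M"
  proof -
    have "{\<omega> \<in> space ?M. \<not> (\<exists>s. wins S \<omega> p s)} = space ?M - (\<Union>s\<in>S. {\<omega> \<in> space ?M. wins S \<omega> p s})"
      by (auto simp: wins_def)
    also have "\<dots> \<in> sets ?M"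
      by (intro sets.Diff sets.top sets.finite_UN W assms)
    finally show ?thesis .
  qed
  have "(\<lambda>\<omega>. pick S \<omega> p) -` {s} \<inter> space ?M \<in> sets ?M" if s: "s \<in> S" for s
  proof -
    have "(\<lambda>\<omega>. pick S \<omega> p) -` {s} \<inter> space ?M = {\<omega> \<in> space ?M. wins S \<omega> p s} \<union>
      (if s = (SOME s. s \<in> S) then {\<omega> \<in> space ?M. \<not> (\<exists>s. wins S \<omega> p s)} else {})"
    proof (intro set_eqI)
      fix \<omega>
      show "\<omega> \<in> (\<lambda>\<omega>. pick S \<omega> p) -` {s} \<inter> space ?M \<longleftrightarrow> \<omega> \<in> {\<omega> \<in> space ?M. wins S \<omega> p s} \<union>
        (if s = (SOME s. s \<in> S) then {\<omega> \<in> space ?M. \<not> (\<exists>s. wins S \<omega> p s)} else {})"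
      proof (cases "\<exists>t. wins S \<omega> p t")
        case True
        then obtain t where t: "wins S \<omega> p t" by blast
        have "wins S \<omega> p s \<longleftrightarrow> s = t" using t wins_unique[OF t, of s] by blast
        moreover have "pick S \<omega> p = s \<longleftrightarrow> s = t" using pick_eq[OF t] by blast
        ultimately show ?thesis using True by auto
      next
        case False
        then show ?thesis by (auto simp: pick_def)
      qed
    qed
    then show ?thesis using W[OF s] N by auto
  qed
  then show ?thesis using assms(1) pick_in[OF assms(2)] by (auto simp: measurable_count_space_eq2)
qed

lemma prob_pick_ge:
  assumes S: "finite S" "s \<in> S" and p: "\<And>r. r \<in> S \<Longrightarrow> 0 \<le> p r" "sum p S = 1"
  shows "p s \<le> measure (PiM S (\<lambda>_. expo)) {\<omega> \<in> space (PiM S (\<lambda>_. expo)). pick S \<omega> p = s}"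
proof (cases "p s = 0")
  case False
  interpret PS: prob_space "PiM S (\<lambda>_. expo)" by (intro prob_space_PiM prob_space_expo)
  have pos: "0 < p s" using False p(1)[OF S(2)] by simp
  have "p s + sum p (S - {s}) = 1" using p(2) sum.remove[OF S, of p] by simp
  then have "p s = p s / (p s + sum p (S - {s}))" by simp
  also have "\<dots> \<le> measure (PiM S (\<lambda>_. expo)) {\<omega> \<in> space (PiM S (\<lambda>_. expo)). \<forall>r\<in>S - {s}. \<bar>\<omega> s\<bar> * p r < \<bar>\<omega> r\<bar> * p s}"
    by (rule prob_race[OF S pos]) (use p in auto)
  also have "\<dots> \<le> measure (PiM S (\<lambda>_. expo)) {\<omega> \<in> space (PiM S (\<lambda>_. expo)). pick S \<omega> p = s}"
  proof (rule PS.finite_measure_mono)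
    show "{\<omega> \<in> space (PiM S (\<lambda>_. expo)). pick S \<omega> p = s} \<in> sets (PiM S (\<lambda>_. expo))"
      using measurable_sets[OF measurable_pick[OF S(1)], of "{s}" p] S by (auto simp: vimage_def Int_def conj_commute)
  qed (use S in \<open>auto intro!: pick_eq simp: wins_def\<close>)
  finally show ?thesis .
qed simp

text \<open>The lower bounds already add up to 1 while the events are disjoint, so none of them can
  be strict. Ties and negative clocks are thereby covered without a separate argument.\<close>

lemma prob_pick:
  assumes S: "finite S" "s \<in> S" and p: "\<And>r. r \<in> S \<Longrightarrow> 0 \<le> p r" "sum p S = 1"
  shows "measure (PiM S (\<lambda>_. expo)) {\<omega> \<in> space (PiM S (\<lambda>_. expo)). pick S \<omega> p = s} = p s"
proof -
  let ?M = "PiM S (\<lambda>_. expo)"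
  interpret PS: prob_space ?M by (intro prob_space_PiM prob_space_expo)
  let ?P = "\<lambda>s. measure ?M {\<omega> \<in> space ?M. pick S \<omega> p = s}"
  have ms: "{\<omega> \<in> space ?M. pick S \<omega> p = t} \<in> sets ?M" if "t \<in> S" for t
    using measurable_sets[OF measurable_pick[OF S(1)], of "{t}" p] that by (auto simp: vimage_def Int_def conj_commute)
  have "sum ?P S = measure ?M (\<Union>t\<in>S. {\<omega> \<in> space ?M. pick S \<omega> p = t})"
    by (rule PS.finite_measure_finite_Union[symmetric]) (use S ms in \<open>auto simp: disjoint_family_on_def\<close>)
  also have "\<dots> \<le> 1" by simp
  finally have "sum ?P S \<le> sum p S" using p by simp
  moreover have "\<And>t. t \<in> S \<Longrightarrow> p t \<le> ?P t" using prob_pick_ge[OF S(1) _ p] .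
  ultimately have "p s = ?P s" using sum_mono_inv[of p S ?P s] S
    by (metis (mono_tags, lifting) order_antisym sum_mono)
  then show ?thesis by simp
qed

text \<open>Let \<open>s\<close> run with the smaller of its two weights against rivals with the
  larger of theirs: a winner of this race wins both original ones. With \<open>h\<close> the sum of
  the maxima, these disjoint events have total probability at least \<open>(2 - h) / h\<close>. The
  remainder \<open>2 * (h - 1) / h\<close> is at most \<open>2 * (h - 1)\<close>, which is the L1
  distance.\<close>

lemma prob_pick_neq:
  assumes S: "finite S" "S \<noteq> {}" and p: "\<And>r. r \<in> S \<Longrightarrow> 0 \<le> p r" "sum p S = 1"
    and q: "\<And>r. r \<in> S \<Longrightarrow> 0 \<le> q r" "sum q S = 1"
  shows "measure (PiM S (\<lambda>_. expo)) {\<omega> \<in> space (PiM S (\<lambda>_. expo)). pick S \<omega> p \<noteq> pick S \<omega> q}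
    \<le> (\<Sum>s\<in>S. \<bar>p s - q s\<bar>)"
proof -
  let ?M = "PiM S (\<lambda>_. expo)"
  interpret PS: prob_space ?M by (intro prob_space_PiM prob_space_expo)
  define hi lo where "hi r = max (p r) (q r)" and "lo r = min (p r) (q r)" for r
  let ?C = "\<lambda>s. {\<omega> \<in> space ?M. \<forall>r\<in>S - {s}. \<bar>\<omega> s\<bar> * hi r < \<bar>\<omega> r\<bar> * lo s}"
  let ?D = "{\<omega> \<in> space ?M. pick S \<omega> p \<noteq> pick S \<omega> q}"
  define T where "T = {s \<in> S. 0 < lo s}"
  have Cm: "?C s \<in> sets ?M" if "s \<in> S" for s by (rule sets_race[OF S(1) that])
  have C: "pick S \<omega> p = s \<and> pick S \<omega> q = s" if "s \<in> S" "\<omega> \<in> ?C s" for s \<omega>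
  proof -
    have "\<bar>\<omega> s\<bar> * p r \<le> \<bar>\<omega> s\<bar> * hi r" "\<bar>\<omega> s\<bar> * q r \<le> \<bar>\<omega> s\<bar> * hi r"
      "\<bar>\<omega> r\<bar> * lo s \<le> \<bar>\<omega> r\<bar> * p s" "\<bar>\<omega> r\<bar> * lo s \<le> \<bar>\<omega> r\<bar> * q s" for r
      by (auto simp: hi_def lo_def intro!: mult_left_mono)
    then have "wins S \<omega> p s" "wins S \<omega> q s"
      using that unfolding wins_def by (blast intro: order_le_less_trans order_less_le_trans)+
    then show ?thesis using pick_eq by metis
  qed
  have Dm: "?D \<in> sets ?M"
  proof -
    have *: "{\<omega> \<in> space ?M. pick S \<omega> f = t} \<in> sets ?M" if "t \<in> S" for t f
      using measurable_sets[OF measurable_pick[OF S], of "{t}" f] that by (auto simp: vimage_def Int_def conj_commute)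
    have "?D = space ?M - (\<Union>s\<in>S. {\<omega> \<in> space ?M. pick S \<omega> p = s} \<inter> {\<omega> \<in> space ?M. pick S \<omega> q = s})"
      using pick_in[OF S(2)] by auto
    also have "\<dots> \<in> sets ?M"
      by (intro sets.Diff sets.top sets.finite_UN sets.Int * S)
    finally show ?thesis .
  qed
  define h where "h = sum hi S"
  have "sum hi S + sum lo S = sum p S + sum q S" unfolding sum.distrib[symmetric]
    by (rule sum.cong) (auto simp: hi_def lo_def)
  then have lo: "sum lo S = 2 - h" using p q h_def by simp
  have "h - sum lo S = (\<Sum>s\<in>S. \<bar>p s - q s\<bar>)"
    unfolding h_def sum_subtractf[symmetric] by (rule sum.cong) (auto simp: hi_def lo_def)
  then have d: "(\<Sum>s\<in>S. \<bar>p s - q s\<bar>) = 2 * (h - 1)" using lo by simp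
  have h1: "1 \<le> h" unfolding h_def p(2)[symmetric] by (rule sum_mono) (simp add: hi_def)
  have hi0: "0 \<le> hi r" "0 \<le> lo r" if "r \<in> S" for r using p(1)[OF that] q(1)[OF that] by (auto simp: hi_def lo_def)
  have "(2 - h) / h = (\<Sum>s\<in>T. lo s / h)"
  proof -
    have "sum lo T = sum lo S" using S hi0 by (intro sum.mono_neutral_left) (force simp: T_def)+
    then show ?thesis using lo by (simp add: sum_divide_distrib[symmetric])
  qed
  also have "\<dots> \<le> (\<Sum>s\<in>T. measure ?M (?C s))"
  proof (rule sum_mono)
    fix s assume s: "s \<in> T"
    then have sS: "s \<in> S" "0 < lo s" by (auto simp: T_def)
    have "h = hi s + sum hi (S - {s})" unfolding h_def using S sS by (intro sum.remove) auto
    then have "lo s + sum hi (S - {s}) \<le> h" by (simp add: hi_def lo_def)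
    moreover have "0 \<le> sum hi (S - {s})" using hi0 by (intro sum_nonneg) auto
    ultimately have "lo s / h \<le> lo s / (lo s + sum hi (S - {s}))"
      using sS h1 by (intro divide_left_mono mult_pos_pos) auto
    also have "\<dots> \<le> measure ?M (?C s)" by (rule prob_race[OF S(1) sS]) (use hi0 in auto)
    finally show "lo s / h \<le> measure ?M (?C s)" .
  qed
  also have "\<dots> = measure ?M (\<Union>s\<in>T. ?C s)"
  proof (rule PS.finite_measure_finite_Union[symmetric])
    show "finite T" using S by (simp add: T_def)
    show "?C ` T \<subseteq> sets ?M" using Cm by (auto simp: T_def)
    show "disjoint_family_on ?C T"
      unfolding disjoint_family_on_def using C by (auto simp: T_def) blast
  qed
  also have "\<dots> \<le> measure ?M (space ?M - ?D)"
    using Dm C by (intro PS.finite_measure_mono) (auto simp: T_def)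
  also have "\<dots> = 1 - measure ?M ?D" using Dm by (rule PS.prob_compl)
  finally have "measure ?M ?D \<le> 1 - (2 - h) / h" by simp
  also have "\<dots> = 2 * (h - 1) / h" using h1 by (simp add: field_simps)
  also have "\<dots> \<le> 2 * (h - 1)" using h1 by (simp add: divide_le_eq) (simp add: mult_le_cancel_left1)
  finally show ?thesis unfolding d .
qed

section \<open>The ordered pivotal distribution\<close>

definition ubox :: "nat set \<Rightarrow> (nat \<Rightarrow> real) set" where
  "ubox V = {x. \<forall>i\<in>V. 0 \<le> x i \<and> x i \<le> 1}"

text \<open>Asking this of all subsets makes it hereditary: it passes to tree nodes, to buckets and
  to the prefixes of the pivotal order. The cells are closed so that each point is aligned with all
  sufficiently near ones even where partial sums are integers; the price is that the relation is not
  transitive.\<close>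

definition aligned :: "nat set \<Rightarrow> (nat \<Rightarrow> real) \<Rightarrow> (nat \<Rightarrow> real) \<Rightarrow> bool" where
  "aligned V x y \<longleftrightarrow> (\<forall>W\<subseteq>V. \<exists>k::int. of_int k \<le> sum x W \<and> sum x W \<le> of_int k + 1 \<and>
     of_int k \<le> sum y W \<and> sum y W \<le> of_int k + 1)"

definition dist1 :: "nat set \<Rightarrow> (nat \<Rightarrow> real) \<Rightarrow> (nat \<Rightarrow> real) \<Rightarrow> real" where
  "dist1 V x y = (\<Sum>i\<in>V. \<bar>x i - y i\<bar>)"

definition layer :: "nat set \<Rightarrow> int \<Rightarrow> nat set set" where
  "layer V j = {S. S \<subseteq> V \<and> int (card S) = j}"

text \<open>While the mass of \<open>V\<close> grows inside the cell \<open>[k, k + 1]\<close>, the conditional law of the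
  sets of size \<open>k\<close> stays the same and the unnormalised law of those of size \<open>k + 1\<close> grows by
  a linear term. With this choice of normalisations the gap increases only by the change of the new
  coordinate, except at the at most \<open>k\<close> coordinates whose addition crosses an integer.\<close>

definition law_gap :: "((nat \<Rightarrow> real) \<Rightarrow> nat set \<Rightarrow> real) \<Rightarrow> nat set \<Rightarrow> int \<Rightarrow> (nat \<Rightarrow> real) \<Rightarrow> (nat \<Rightarrow> real) \<Rightarrow> real" where
  "law_gap c V k x y =
     min (of_int k + 1 - sum x V) (of_int k + 1 - sum y V) * (\<Sum>S\<in>layer V k. \<bar>c x S - c y S\<bar>) +
     (\<Sum>S\<in>layer V (k + 1). \<bar>(sum x V - of_int k) * c x S - (sum y V - of_int k) * c y S\<bar>)"

text \<open>\<open>c x S\<close> is the conditional probability of \<open>S\<close> given its size.\<close>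

definition level_law :: "nat set \<Rightarrow> ((nat \<Rightarrow> real) \<Rightarrow> nat set \<Rightarrow> real) \<Rightarrow> bool" where
  "level_law V c \<longleftrightarrow>
    (\<forall>x\<in>ubox V. (\<forall>S. 0 \<le> c x S) \<and>
       (\<forall>j. \<bar>sum x V - of_int j\<bar> < 1 \<longrightarrow> sum (c x) (layer V j) = 1) \<and>
       (\<forall>i\<in>V. interp (\<lambda>j. \<Sum>S\<in>layer V j. c x S * of_bool (i \<in> S)) (sum x V) = x i)) \<and>
    (\<forall>x\<in>ubox V. \<forall>y\<in>ubox V. \<forall>k\<ge>0. aligned V x y \<longrightarrow>
       of_int k \<le> sum x V \<longrightarrow> sum x V \<le> of_int k + 1 \<longrightarrow>
       of_int k \<le> sum y V \<longrightarrow> sum y V \<le> of_int k + 1 \<longrightarrow>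
       law_gap c V k x y \<le> (1 + 4 * of_int k) * dist1 V x y)"

text \<open>One step of ordered pivotal sampling: the size is split between \<open>V\<close> and
  \<open>e\<close> by \<open>pair_prob\<close>, conditionally on the total, and the law
  \<open>c\<close> is kept on \<open>V\<close>. At a size of weight 0 the division gives 0.\<close>

definition extend :: "nat \<Rightarrow> nat set \<Rightarrow> ((nat \<Rightarrow> real) \<Rightarrow> nat set \<Rightarrow> real) \<Rightarrow> (nat \<Rightarrow> real) \<Rightarrow> nat set \<Rightarrow> real" where
  "extend e V c x S =
     (if e \<in> S then pair_prob (sum x V) (x e) (int (card S) - 1) 1 * c x (S - {e})
      else pair_prob (sum x V) (x e) (int (card S)) 0 * c x S) / tent (sum x V + x e) (int (card S))"

lemma finite_layer: "finite V \<Longrightarrow> finite (layer V j)"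
  unfolding layer_def by (rule finite_subset[of _ "Pow V"]) auto

lemma sum_layer_insert:
  assumes "finite V" "e \<notin> V"
  shows "sum G (layer (insert e V) j) = sum G (layer V j) + (\<Sum>T\<in>layer V (j - 1). G (insert e T))"
proof -
  have fin: "finite T" if "T \<subseteq> V" for T using that assms finite_subset by blast
  have eq: "layer (insert e V) j = layer V j \<union> insert e ` layer V (j - 1)"
  proof (intro equalityI subsetI)
    fix S assume S: "S \<in> layer (insert e V) j"
    show "S \<in> layer V j \<union> insert e ` layer V (j - 1)"
    proof (cases "e \<in> S")
      case True
      then have "S = insert e (S - {e})" by auto
      moreover have "S - {e} \<subseteq> V" using S by (auto simp: layer_def)
      moreover have "finite S" using S assms by (auto simp: layer_def intro: finite_subset)
      then have "int (card (S - {e})) = j - 1"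
        using S True card_Suc_Diff1[of S e] by (auto simp: layer_def)
      ultimately have "S - {e} \<in> layer V (j - 1)" "S = insert e (S - {e})" by (auto simp: layer_def)
      then show ?thesis by blast
    qed (use S in \<open>auto simp: layer_def\<close>)
  next
    fix S assume "S \<in> layer V j \<union> insert e ` layer V (j - 1)"
    then show "S \<in> layer (insert e V) j"
    proof
      assume "S \<in> insert e ` layer V (j - 1)"
      then obtain T where T: "S = insert e T" "T \<subseteq> V" "int (card T) = j - 1" by (auto simp: layer_def)
      then have "e \<notin> T" using assms by auto
      then show ?thesis using T fin[OF T(2)] by (auto simp: layer_def)
    qed (auto simp: layer_def)
  qed
  have inj: "inj_on (insert e) (layer V (j - 1))"
    using assms by (intro inj_onI) (metis (mono_tags, lifting) layer_def insert_ident mem_Collect_eq subsetD)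
  have "layer V j \<inter> insert e ` layer V (j - 1) = {}" using assms by (auto simp: layer_def)
  then show ?thesis unfolding eq using finite_layer[OF assms(1)]
    by (subst sum.union_disjoint) (auto simp: sum.reindex[OF inj])
qed

lemma pair_prob_step_tent:
  assumes "0 \<le> r" "r \<le> 1"
  shows "pair_prob m r j 0 + pair_prob m r (j - 1) 1 = tent (m + r) j"
  using assms by (auto simp: pair_prob_def tent_def max_def min_def)

text \<open>\<open>A\<close> and \<open>B\<close> are the values without and with the new
  coordinate. Averaging over the new size returns the joint law of the old size and the choice of
  the coordinate; whether an integer is crossed determines which two new sizes occur.\<close>

lemma interp_step:
  assumes r: "0 \<le> r" "r \<le> 1" and k: "of_int k \<le> m" "m \<le> of_int k + 1"
    and Q: "\<And>j. tent (m + r) j * Q j = pair_prob m r j 0 * A j + pair_prob m r (j - 1) 1 * B (j - 1)"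
  shows "interp Q (m + r) = pair_prob m r k 0 * A k + pair_prob m r (k + 1) 0 * A (k + 1) +
    pair_prob m r k 1 * B k + pair_prob m r (k + 1) 1 * B (k + 1)"
proof (cases "m + r \<le> of_int k + 1")
  case True
  have c: "of_int k \<le> m + r" using k r by simp
  have "pair_prob m r (k - 1) 1 = 0" "pair_prob m r (k + 1) 1 = 0"
    using pair_prob_low[OF k, of 0 r] r True by auto
  then show ?thesis
    unfolding interp_cell[OF c True] tent_cell[OF c True, symmetric] Q by simp
next
  case False
  have c: "of_int (k + 1) \<le> m + r" "m + r \<le> of_int (k + 1) + 1" using False k r by auto
  have "pair_prob m r (k + 2) 0 = 0" "pair_prob m r k 0 = 0"
    using pair_prob_high[OF k, of 0 r] r False by auto
  then show ?thesis
    unfolding interp_cell[OF c] tent_cell[OF c, symmetric] Q by (simp add: add.assoc) (simp add: add.commute)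
qed

text \<open>Both bounds come from
  \<open>a * f S - b * g S = b * (f S - g S) + (a - b) * f S\<close>, where \<open>a - b\<close> is
  nonnegative and \<open>f\<close> has mass 1; at \<open>a = 0\<close> the factor
  \<open>a - b\<close> vanishes.\<close>

lemma weighted_L1_aux:
  fixes f g :: "'a \<Rightarrow> real"
  assumes f: "\<And>S. S \<in> A \<Longrightarrow> 0 \<le> f S" and a: "0 < a \<Longrightarrow> sum f A = 1" and ab: "0 \<le> b" "b \<le> a"
  shows "(\<Sum>S\<in>A. \<bar>a * f S - b * g S\<bar>) \<le> b * (\<Sum>S\<in>A. \<bar>f S - g S\<bar>) + (a - b)"
    and "b * (\<Sum>S\<in>A. \<bar>f S - g S\<bar>) \<le> (\<Sum>S\<in>A. \<bar>a * f S - b * g S\<bar>) + (a - b)"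
proof -
  have s: "(a - b) * sum f A = a - b"
    using a ab by (cases "a = 0") simp_all
  have "\<bar>a * f S - b * g S\<bar> \<le> b * \<bar>f S - g S\<bar> + (a - b) * f S \<and>
    b * \<bar>f S - g S\<bar> \<le> \<bar>a * f S - b * g S\<bar> + (a - b) * f S" if "S \<in> A" for S
  proof -
    have e: "a * f S - b * g S = b * (f S - g S) + (a - b) * f S" by (simp add: algebra_simps)
    have b: "b * \<bar>f S - g S\<bar> = \<bar>b * (f S - g S)\<bar>" using ab by (simp add: abs_mult)
    have "0 \<le> (a - b) * f S" using ab f[OF that] by simp
    then show ?thesis unfolding e b by linarith
  qed
  then have "(\<Sum>S\<in>A. \<bar>a * f S - b * g S\<bar>) \<le> (\<Sum>S\<in>A. b * \<bar>f S - g S\<bar> + (a - b) * f S)"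
    "(\<Sum>S\<in>A. b * \<bar>f S - g S\<bar>) \<le> (\<Sum>S\<in>A. \<bar>a * f S - b * g S\<bar> + (a - b) * f S)"
    by (auto intro!: sum_mono)
  then show "(\<Sum>S\<in>A. \<bar>a * f S - b * g S\<bar>) \<le> b * (\<Sum>S\<in>A. \<bar>f S - g S\<bar>) + (a - b)"
    "b * (\<Sum>S\<in>A. \<bar>f S - g S\<bar>) \<le> (\<Sum>S\<in>A. \<bar>a * f S - b * g S\<bar>) + (a - b)"
    unfolding sum.distrib sum_distrib_left[symmetric] s by blast+
qed

text \<open>Passes between unnormalised laws and conditional laws at the price of the change in
  weight. Normalisation is assumed only at positive weight because \<open>level_law\<close> fixes
  the mass only for admissible sizes.\<close>

lemma weighted_L1:
  fixes f g :: "'a \<Rightarrow> real"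
  assumes f: "\<And>S. S \<in> A \<Longrightarrow> 0 \<le> f S" and g: "\<And>S. S \<in> A \<Longrightarrow> 0 \<le> g S"
    and a: "0 < a \<Longrightarrow> sum f A = 1" and b: "0 < b \<Longrightarrow> sum g A = 1" and ab: "0 \<le> a" "0 \<le> b"
  shows "(\<Sum>S\<in>A. \<bar>a * f S - b * g S\<bar>) \<le> min a b * (\<Sum>S\<in>A. \<bar>f S - g S\<bar>) + \<bar>a - b\<bar>" (is ?P)
    and "min a b * (\<Sum>S\<in>A. \<bar>f S - g S\<bar>) \<le> (\<Sum>S\<in>A. \<bar>a * f S - b * g S\<bar>) + \<bar>a - b\<bar>" (is ?Q)
proof -
  have c: "(\<Sum>S\<in>A. \<bar>b * g S - a * f S\<bar>) = (\<Sum>S\<in>A. \<bar>a * f S - b * g S\<bar>)"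
    "(\<Sum>S\<in>A. \<bar>g S - f S\<bar>) = (\<Sum>S\<in>A. \<bar>f S - g S\<bar>)"
    by (rule sum.cong[OF refl], rule abs_minus_commute)+
  have "?P \<and> ?Q"
  proof (cases "b \<le> a")
    case True
    then show ?thesis using weighted_L1_aux[OF f a ab(2) True, of g] True by (simp add: min_absorb2)
  next
    case False
    then have "a \<le> b" by simp
    then show ?thesis using weighted_L1_aux[OF g b ab(1) \<open>a \<le> b\<close>, of f, unfolded c] False by (simp add: min_def)
  qed
  then show ?P ?Q by blast+
qed

lemma abs_sum_diff_le_dist1: "\<bar>sum x V - sum y V\<bar> \<le> dist1 V x y"
  unfolding dist1_def sum_subtractf[symmetric] by (rule sum_abs)

section \<open>Adding one coordinate to a level law\<close>

context
  fixes V :: "nat set" and e :: nat and c :: "(nat \<Rightarrow> real) \<Rightarrow> nat set \<Rightarrow> real"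
  assumes V: "finite V" "e \<notin> V" and law: "level_law V c"
begin

lemma ubox_insertD: "x \<in> ubox (insert e V) \<Longrightarrow> x \<in> ubox V \<and> 0 \<le> x e \<and> x e \<le> 1"
  by (auto simp: ubox_def)

lemma sum_insert_V: "sum (x :: nat \<Rightarrow> real) (insert e V) = sum x V + x e"
  using V by (simp add: add.commute)

text \<open>In multiplied form the identity also covers weight 0, where \<open>extend\<close>
  divides by 0: the pair weight is then 0 as well.\<close>

lemma extend_out:
  assumes "x \<in> ubox (insert e V)" "S \<in> layer V j"
  shows "tent (sum x V + x e) j * extend e V c x S = pair_prob (sum x V) (x e) j 0 * c x S"
proof -
  have S: "e \<notin> S" "int (card S) = j" using assms V by (auto simp: layer_def)
  show ?thesis
  proof (cases "tent (sum x V + x e) j = 0")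
    case True
    then have "pair_prob (sum x V) (x e) j 0 = 0"
      using pair_prob_step_tent[of "x e" "sum x V" j] ubox_insertD[OF assms(1)]
        pair_prob_nonneg[of "sum x V" "x e" j 0] pair_prob_nonneg[of "sum x V" "x e" "j - 1" 1] by linarith
    then show ?thesis using True by simp
  qed (simp add: extend_def S)
qed

lemma extend_in:
  assumes "x \<in> ubox (insert e V)" "T \<in> layer V (j - 1)"
  shows "tent (sum x V + x e) j * extend e V c x (insert e T) = pair_prob (sum x V) (x e) (j - 1) 1 * c x T"
proof -
  have T: "e \<notin> T" "finite T" "int (card T) = j - 1"
    using assms V by (auto simp: layer_def intro: finite_subset)
  then have S: "int (card (insert e T)) = j" "insert e T - {e} = T" by auto
  show ?thesis
  proof (cases "tent (sum x V + x e) j = 0")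
    case True
    then have "pair_prob (sum x V) (x e) (j - 1) 1 = 0"
      using pair_prob_step_tent[of "x e" "sum x V" j] ubox_insertD[OF assms(1)]
        pair_prob_nonneg[of "sum x V" "x e" j 0] pair_prob_nonneg[of "sum x V" "x e" "j - 1" 1] by linarith
    then show ?thesis using True by simp
  qed (simp add: extend_def S)
qed

lemma tent_sum_extend:
  assumes "x \<in> ubox (insert e V)"
  shows "tent (sum x V + x e) j * (\<Sum>S\<in>layer (insert e V) j. extend e V c x S * g S) =
    pair_prob (sum x V) (x e) j 0 * (\<Sum>S\<in>layer V j. c x S * g S) +
    pair_prob (sum x V) (x e) (j - 1) 1 * (\<Sum>T\<in>layer V (j - 1). c x T * g (insert e T))"
  unfolding sum_layer_insert[OF V] distrib_left sum_distrib_left mult.assoc[symmetric]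
  by (intro arg_cong2[where f="(+)"] sum.cong refl) (simp_all add: extend_out[OF assms] extend_in[OF assms])

lemma pair_prob_times_sum_left:
  assumes "x \<in> ubox (insert e V)"
  shows "pair_prob (sum x V) r j b * sum (c x) (layer V j) = pair_prob (sum x V) r j b"
proof (cases "pair_prob (sum x V) r j b = 0")
  case False
  then have "\<bar>sum x V - of_int j\<bar> < 1"
    using pair_prob_pos_valid(1)[of "sum x V" r j b] pair_prob_nonneg[of "sum x V" r j b] by linarith
  then show ?thesis using law ubox_insertD[OF assms] by (simp add: level_law_def)
qed simp

lemma extend_nonneg: "x \<in> ubox (insert e V) \<Longrightarrow> 0 \<le> extend e V c x S"
  using law ubox_insertD[of x] by (auto simp: extend_def level_law_def tent_def pair_prob_nonneg)

lemma extend_total: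
  assumes "x \<in> ubox (insert e V)" "\<bar>sum x (insert e V) - of_int j\<bar> < 1"
  shows "sum (extend e V c x) (layer (insert e V) j) = 1"
proof -
  have w: "0 < tent (sum x V + x e) j" using assms(2) unfolding tent_pos_iff sum_insert_V .
  have "tent (sum x V + x e) j * sum (extend e V c x) (layer (insert e V) j) = tent (sum x V + x e) j"
    using tent_sum_extend[OF assms(1), of j "\<lambda>_. 1"] pair_prob_times_sum_left[OF assms(1)]
      pair_prob_step_tent[of "x e" "sum x V" j] ubox_insertD[OF assms(1)] by simp
  then show ?thesis using w by simp
qed

text \<open>Summing over the choice of \<open>e\<close> turns the pair weights into the weights of
  the old size, so old marginals are inherited; for \<open>e\<close> itself the pair weights of its
  inclusion add up to \<open>x e\<close>.\<close>

lemma extend_marginal: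
  assumes x: "x \<in> ubox (insert e V)" and i: "i \<in> insert e V"
  shows "interp (\<lambda>j. \<Sum>S\<in>layer (insert e V) j. extend e V c x S * of_bool (i \<in> S)) (sum x (insert e V)) = x i"
proof -
  obtain k where k: "of_int k \<le> sum x V" "sum x V \<le> of_int k + 1" using ex_cell by blast
  have r: "0 \<le> x e" "x e \<le> 1" using ubox_insertD[OF x] by auto
  note M = pair_prob_marginal[OF k, of 0 "x e", simplified, OF r]
  show ?thesis
  proof (cases "i = e")
    case True
    have 0: "(\<Sum>S\<in>layer V j. c x S * of_bool (e \<in> S)) = 0" for j
      using V by (intro sum.neutral) (auto simp: layer_def)
    have "interp (\<lambda>j. \<Sum>S\<in>layer (insert e V) j. extend e V c x S * of_bool (e \<in> S)) (sum x V + x e) =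
      pair_prob (sum x V) (x e) k 0 * 0 + pair_prob (sum x V) (x e) (k + 1) 0 * 0 + pair_prob (sum x V) (x e) k 1 * 1 + pair_prob (sum x V) (x e) (k + 1) 1 * 1"
      by (rule interp_step[OF r k, where A="\<lambda>_. 0" and B="\<lambda>_. 1"])
        (simp only: tent_sum_extend[OF x] 0, simp add: pair_prob_times_sum_left[OF x])
    then show ?thesis unfolding sum_insert_V True using M(4) by simp
  next
    case False
    then have iV: "i \<in> V" using i by simp
    let ?p = "\<lambda>j. \<Sum>S\<in>layer V j. c x S * of_bool (i \<in> S)"
    have "interp (\<lambda>j. \<Sum>S\<in>layer (insert e V) j. extend e V c x S * of_bool (i \<in> S)) (sum x V + x e) =
      pair_prob (sum x V) (x e) k 0 * ?p k + pair_prob (sum x V) (x e) (k + 1) 0 * ?p (k + 1) +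
      pair_prob (sum x V) (x e) k 1 * ?p k + pair_prob (sum x V) (x e) (k + 1) 1 * ?p (k + 1)"
      by (rule interp_step[OF r k]) (simp only: tent_sum_extend[OF x], simp add: False)
    also have "\<dots> = (pair_prob (sum x V) (x e) k 0 + pair_prob (sum x V) (x e) k 1) * ?p k +
      (pair_prob (sum x V) (x e) (k + 1) 0 + pair_prob (sum x V) (x e) (k + 1) 1) * ?p (k + 1)"
      by (simp add: algebra_simps)
    also have "\<dots> = interp ?p (sum x V)"
      unfolding M(1,2) interp_cell[OF k] by simp
    also have "\<dots> = x i" using law ubox_insertD[OF x] iV by (simp add: level_law_def)
    finally show ?thesis unfolding sum_insert_V .
  qed
qed

lemma aligned_insertD: "aligned (insert e V) x y \<Longrightarrow> aligned V x y"
  by (auto simp: aligned_def)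

lemma sum_layer_one:
  assumes "x \<in> ubox V" "\<bar>sum x V - of_int j\<bar> < 1"
  shows "sum (c x) (layer V j) = 1"
  using law assms by (auto simp: level_law_def)

lemma c_nonneg: "x \<in> ubox V \<Longrightarrow> 0 \<le> c x S"
  using law by (auto simp: level_law_def)

lemma sum_extend_diff:
  assumes "x \<in> ubox (insert e V)" "y \<in> ubox (insert e V)"
  shows "(\<Sum>S\<in>layer (insert e V) j. \<bar>tent (sum x V + x e) j * extend e V c x S - tent (sum y V + y e) j * extend e V c y S\<bar>) =
    (\<Sum>S\<in>layer V j. \<bar>pair_prob (sum x V) (x e) j 0 * c x S - pair_prob (sum y V) (y e) j 0 * c y S\<bar>) +
    (\<Sum>S\<in>layer V (j - 1). \<bar>pair_prob (sum x V) (x e) (j - 1) 1 * c x S - pair_prob (sum y V) (y e) (j - 1) 1 * c y S\<bar>)"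
  unfolding sum_layer_insert[OF V]
  by (intro arg_cong2[where f="(+)"] sum.cong refl)
    (simp_all add: extend_out[OF assms(1)] extend_out[OF assms(2)] extend_in[OF assms(1)] extend_in[OF assms(2)])

text \<open>Let \<open>m\<close>, \<open>m'\<close> be the old masses and \<open>a\<close>,
  \<open>b\<close> the new coordinates. If no integer is crossed, the gap grows by at most
  \<open>\<bar>a - b\<bar>\<close>. A crossing makes the old upper layer the new lower one, and five
  uses of \<open>weighted_L1\<close> are needed to change normalisations; their errors add up to at
  most \<open>4 * (\<bar>m - m'\<bar> + \<bar>a - b\<bar>)\<close>. The summand
  \<open>4 * of_int k\<close> pays for this, since \<open>k\<close> increases by 1 at that
  moment.\<close>

lemma law_gap_extend:
  assumes x: "x \<in> ubox (insert e V)" and y: "y \<in> ubox (insert e V)" and al: "aligned (insert e V) x y"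
    and k0: "0 \<le> k"
    and kx: "of_int k \<le> sum x (insert e V)" "sum x (insert e V) \<le> of_int k + 1"
    and ky: "of_int k \<le> sum y (insert e V)" "sum y (insert e V) \<le> of_int k + 1"
  shows "law_gap (extend e V c) (insert e V) k x y \<le> (1 + 4 * of_int k) * dist1 (insert e V) x y"
proof -
  define m m' a b where d: "m = sum x V" "m' = sum y V" "a = x e" "b = y e"
  have xV: "x \<in> ubox V" "0 \<le> a" "a \<le> 1" and yV: "y \<in> ubox V" "0 \<le> b" "b \<le> 1"
    using ubox_insertD[OF x] ubox_insertD[OF y] by (auto simp: d)
  have alV: "aligned V x y" by (rule aligned_insertD[OF al])
  have m0: "0 \<le> m" "0 \<le> m'" unfolding d using xV(1) yV(1) by (auto simp: ubox_def intro: sum_nonneg)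
  have dm: "\<bar>m - m'\<bar> \<le> dist1 V x y" unfolding d by (rule abs_sum_diff_le_dist1)
  have dn: "dist1 (insert e V) x y = dist1 V x y + \<bar>a - b\<bar>"
    using V by (simp add: dist1_def d)
  have K: "of_int k \<le> m + a" "m + a \<le> of_int k + 1" "of_int k \<le> m' + b" "m' + b \<le> of_int k + 1"
    using kx ky unfolding sum_insert_V d by auto
  have s1: "sum (c x) (layer V j) = 1" if "\<bar>m - of_int j\<bar> < 1" for j using sum_layer_one[OF xV(1)] that d by simp
  have s2: "sum (c y) (layer V j) = 1" if "\<bar>m' - of_int j\<bar> < 1" for j using sum_layer_one[OF yV(1)] that d by simp
  have PsiI: "law_gap c V k x y \<le> (1 + 4 * of_int k) * dist1 V x y"
    if "0 \<le> k" "of_int k \<le> m" "m \<le> of_int k + 1" "of_int k \<le> m'" "m' \<le> of_int k + 1" for k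
    using law xV(1) yV(1) alV that unfolding level_law_def d by blast
  note wL1 = weighted_L1[where f="c x" and g="c y", OF c_nonneg[OF xV(1)] c_nonneg[OF yV(1)]]
  define D where "D = (\<lambda>j. \<Sum>S\<in>layer V j. \<bar>c x S - c y S\<bar>)"
  have Df: "(\<Sum>S\<in>layer V j. \<bar>c x S - c y S\<bar>) = D j" for j by (simp add: D_def)
  have D0: "0 \<le> D j" for j by (simp add: D_def sum_nonneg)
  have new2: "(\<Sum>S\<in>layer (insert e V) (k + 1). \<bar>(sum x (insert e V) - of_int k) * extend e V c x S - (sum y (insert e V) - of_int k) * extend e V c y S\<bar>) =
     (\<Sum>S\<in>layer V (k + 1). \<bar>pair_prob m a (k + 1) 0 * c x S - pair_prob m' b (k + 1) 0 * c y S\<bar>) +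
     (\<Sum>S\<in>layer V k. \<bar>pair_prob m a k 1 * c x S - pair_prob m' b k 1 * c y S\<bar>)"
    using sum_extend_diff[OF x y, of "k + 1"] tent_cell(2)[OF K(1,2)] tent_cell(2)[OF K(3,4)]
    unfolding sum_insert_V d by simp
  have new1: "(\<Sum>S\<in>layer (insert e V) k. \<bar>(of_int k + 1 - sum x (insert e V)) * extend e V c x S - (of_int k + 1 - sum y (insert e V)) * extend e V c y S\<bar>) =
     (\<Sum>S\<in>layer V k. \<bar>pair_prob m a k 0 * c x S - pair_prob m' b k 0 * c y S\<bar>) +
     (\<Sum>S\<in>layer V (k - 1). \<bar>pair_prob m a (k - 1) 1 * c x S - pair_prob m' b (k - 1) 1 * c y S\<bar>)"
    using sum_extend_diff[OF x y, of k] tent_cell(1)[OF K(1,2)] tent_cell(1)[OF K(3,4)]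
    unfolding sum_insert_V d by simp
  show ?thesis
  proof (cases "of_int k \<le> m \<and> of_int k \<le> m'")
    case True
    then have k: "of_int k \<le> m" "m \<le> of_int k + 1" "of_int k \<le> m'" "m' \<le> of_int k + 1"
      using K xV yV by auto
    have R: "pair_prob m a k 0 = of_int k + 1 - (m + a)" "pair_prob m a k 1 = a" "pair_prob m a (k + 1) 0 = m - of_int k" "pair_prob m a (k - 1) 1 = 0"
      using pair_prob_low[OF k(1,2), of 0 a] xV K by auto
    have R': "pair_prob m' b k 0 = of_int k + 1 - (m' + b)" "pair_prob m' b k 1 = b" "pair_prob m' b (k + 1) 0 = m' - of_int k" "pair_prob m' b (k - 1) 1 = 0"
      using pair_prob_low[OF k(3,4), of 0 b] yV K by auto
    have A: "min (of_int k + 1 - (m + a)) (of_int k + 1 - (m' + b)) *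
        (\<Sum>S\<in>layer (insert e V) k. \<bar>extend e V c x S - extend e V c y S\<bar>)
      = min (of_int k + 1 - (m + a)) (of_int k + 1 - (m' + b)) * D k"
    proof (cases "m + a < of_int k + 1 \<and> m' + b < of_int k + 1")
      case True
      have o: "extend e V c x S = c x S \<and> extend e V c y S = c y S" if "S \<in> layer V k" for S
        using extend_out[OF x that] extend_out[OF y that] tent_cell(1)[OF K(1,2)] tent_cell(1)[OF K(3,4)] R(1) R'(1) True
        unfolding d[symmetric] by auto
      have i: "extend e V c x (insert e S) = 0 \<and> extend e V c y (insert e S) = 0" if "S \<in> layer V (k - 1)" for S
        using extend_in[OF x that] extend_in[OF y that] tent_cell(1)[OF K(1,2)] tent_cell(1)[OF K(3,4)] R(4) R'(4) True
        unfolding d[symmetric] by auto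
      show ?thesis unfolding sum_layer_insert[OF V] D_def using o i by simp
    next
      case False
      then have "min (of_int k + 1 - (m + a)) (of_int k + 1 - (m' + b)) = 0" using K by auto
      then show ?thesis by simp
    qed
    have B: "(\<Sum>S\<in>layer V k. \<bar>a * c x S - b * c y S\<bar>) \<le> min a b * D k + \<bar>a - b\<bar>"
      unfolding D_def by (intro wL1(1) s1 s2) (use K k xV yV in auto)
    \<comment> \<open>Superadditivity of \<open>min\<close>: the weight kept by the
      \<open>k\<close>-sets without \<open>e\<close>, together with the weight moved to their
      extensions by \<open>e\<close>, is at most the old weight.\<close>
    have "(min (of_int k + 1 - (m + a)) (of_int k + 1 - (m' + b)) + min a b) * D k \<le>
        min (of_int k + 1 - m) (of_int k + 1 - m') * D k"
      using D0 by (intro mult_right_mono) auto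
    then have "law_gap (extend e V c) (insert e V) k x y \<le> law_gap c V k x y + \<bar>a - b\<bar>"
      using A B unfolding law_gap_def new2 unfolding R R' sum_insert_V d[symmetric] Df distrib_right by linarith
    also have "\<dots> \<le> (1 + 4 * of_int k) * dist1 V x y + (1 + 4 * of_int k) * \<bar>a - b\<bar>"
      using PsiI[OF k0 k] mult_right_mono[of 1 "1 + 4 * of_int k :: real" "\<bar>a - b\<bar>"] k0 by simp
    also have "\<dots> = (1 + 4 * of_int k) * dist1 (insert e V) x y" unfolding dn by (simp add: algebra_simps)
    finally show ?thesis .
  next
    case False
    define p where "p = k - 1"
    then have kp: "k = p + 1" and e2: "k + 1 = p + 2" by simp_all
    \<comment> \<open>At least one old mass is below \<open>k\<close>; alignment on \<open>V\<close>
      forces both into the cell from \<open>k - 1\<close> to \<open>k\<close>.\<close>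
    obtain q :: int where q: "of_int q \<le> m" "m \<le> of_int q + 1" "of_int q \<le> m'" "m' \<le> of_int q + 1"
      using alV unfolding aligned_def d by blast
    have "(of_int q :: real) < of_int k" using False q by linarith
    then have "q + 1 \<le> k" by simp
    then have "of_int q + 1 \<le> (of_int k :: real)" by linarith
    then have k: "of_int p \<le> m" "m \<le> of_int p + 1" "of_int p \<le> m'" "m' \<le> of_int p + 1"
      using K xV yV q unfolding kp by auto
    have "0 < (of_int k :: real)" using False m0 by linarith
    then have p0: "0 \<le> p" unfolding p_def by simp
    have K': "of_int (p + 0) + 1 \<le> m + a" "of_int (p + 0) + 1 \<le> m' + b" using K kp by auto
    have R: "pair_prob m a k 0 = 1 - a" "pair_prob m a k 1 = m + a - of_int p - 1" "pair_prob m a (k + 1) 0 = 0" "pair_prob m a (k - 1) 1 = of_int p + 1 - m"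
      using pair_prob_high[OF k(1,2), of 0 a] xV K' unfolding e2 unfolding kp by auto
    have R': "pair_prob m' b k 0 = 1 - b" "pair_prob m' b k 1 = m' + b - of_int p - 1" "pair_prob m' b (k + 1) 0 = 0" "pair_prob m' b (k - 1) 1 = of_int p + 1 - m'"
      using pair_prob_high[OF k(3,4), of 0 b] yV K' unfolding e2 unfolding kp by auto
    have e: "k - 1 = p" by (simp add: kp)
    have "min (of_int k + 1 - (m + a)) (of_int k + 1 - (m' + b)) *
        (\<Sum>S\<in>layer (insert e V) k. \<bar>extend e V c x S - extend e V c y S\<bar>) \<le>
      (\<Sum>S\<in>layer (insert e V) k. \<bar>(of_int k + 1 - (m + a)) * extend e V c x S - (of_int k + 1 - (m' + b)) * extend e V c y S\<bar>)
        + \<bar>(of_int k + 1 - (m + a)) - (of_int k + 1 - (m' + b))\<bar>"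
      by (intro weighted_L1(2) extend_nonneg x y extend_total) (use K d sum_insert_V in auto)
    also have "\<dots> = (\<Sum>S\<in>layer V k. \<bar>(1 - a) * c x S - (1 - b) * c y S\<bar>) +
      (\<Sum>S\<in>layer V p. \<bar>(of_int p + 1 - m) * c x S - (of_int p + 1 - m') * c y S\<bar>) +
      \<bar>(of_int k + 1 - (m + a)) - (of_int k + 1 - (m' + b))\<bar>"
      using new1 unfolding R R' sum_insert_V d[symmetric] unfolding e by simp
    also have "(\<Sum>S\<in>layer V k. \<bar>(1 - a) * c x S - (1 - b) * c y S\<bar>) \<le> min (1 - a) (1 - b) * D k + \<bar>(1 - a) - (1 - b)\<bar>"
      unfolding D_def by (intro wL1(1) s1 s2) (use K k xV yV kp in auto)
    also have "(\<Sum>S\<in>layer V p. \<bar>(of_int p + 1 - m) * c x S - (of_int p + 1 - m') * c y S\<bar>) \<le>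
      min (of_int p + 1 - m) (of_int p + 1 - m') * D p + \<bar>(of_int p + 1 - m) - (of_int p + 1 - m')\<bar>"
      unfolding D_def by (intro wL1(1) s1 s2) (use K k xV yV kp in auto)
    finally have A0: "min (of_int k + 1 - (m + a)) (of_int k + 1 - (m' + b)) *
        (\<Sum>S\<in>layer (insert e V) k. \<bar>extend e V c x S - extend e V c y S\<bar>) \<le>
      min (1 - a) (1 - b) * D k + \<bar>(1 - a) - (1 - b)\<bar> +
      (min (of_int p + 1 - m) (of_int p + 1 - m') * D p + \<bar>(of_int p + 1 - m) - (of_int p + 1 - m')\<bar>) +
      \<bar>(of_int k + 1 - (m + a)) - (of_int k + 1 - (m' + b))\<bar>" by simp
    have A: "min (of_int k + 1 - (m + a)) (of_int k + 1 - (m' + b)) *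
        (\<Sum>S\<in>layer (insert e V) k. \<bar>extend e V c x S - extend e V c y S\<bar>) \<le>
      min (1 - a) (1 - b) * D k + min (of_int p + 1 - m) (of_int p + 1 - m') * D p +
      \<bar>a - b\<bar> + \<bar>m - m'\<bar> + \<bar>m + a - (m' + b)\<bar>"
    proof -
      have "\<bar>(1 - a) - (1 - b)\<bar> = \<bar>a - b\<bar>" "\<bar>(of_int p + 1 - m) - (of_int p + 1 - m')\<bar> = \<bar>m - m'\<bar>"
        "\<bar>(of_int k + 1 - (m + a)) - (of_int k + 1 - (m' + b))\<bar> = \<bar>m + a - (m' + b)\<bar>" by auto
      then show ?thesis using A0 by linarith
    qed
    have B: "(\<Sum>S\<in>layer V k. \<bar>(m + a - of_int p - 1) * c x S - (m' + b - of_int p - 1) * c y S\<bar>) \<le>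
      min (m + a - of_int p - 1) (m' + b - of_int p - 1) * D k +
        \<bar>(m + a - of_int p - 1) - (m' + b - of_int p - 1)\<bar>"
      unfolding D_def by (intro wL1(1) s1 s2) (use K k xV yV kp in auto)
    have C: "min (m - of_int p) (m' - of_int p) * D k \<le>
       (\<Sum>S\<in>layer V k. \<bar>(m - of_int p) * c x S - (m' - of_int p) * c y S\<bar>) +
        \<bar>(m - of_int p) - (m' - of_int p)\<bar>"
      unfolding D_def by (intro wL1(2) s1 s2) (use K k xV yV kp in auto)
    have z: "(m + a - of_int p - 1) - (m' + b - of_int p - 1) = m + a - (m' + b)"
      "(m - of_int p) - (m' - of_int p) = m - m'" by simp_all
    \<comment> \<open>The old upper layer, of weight \<open>m - of_int p\<close>, is divided into
      the sets left without \<open>e\<close>, with factor \<open>1 - a\<close>, and those that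
      receive it, with factor \<open>m + a - of_int p - 1\<close>.\<close>
    have E: "(min (1 - a) (1 - b) + min (m + a - of_int p - 1) (m' + b - of_int p - 1)) * D k \<le>
        min (m - of_int p) (m' - of_int p) * D k"
      using D0 by (intro mult_right_mono) auto
    have "\<bar>m + a - (m' + b)\<bar> \<le> \<bar>m - m'\<bar> + \<bar>a - b\<bar>" by linarith
    then have "law_gap (extend e V c) (insert e V) k x y \<le> law_gap c V p x y + 4 * (\<bar>m - m'\<bar> + \<bar>a - b\<bar>)"
      using A B[unfolded z] C[unfolded z] E unfolding law_gap_def new2 unfolding R R' sum_insert_V d[symmetric] Df kp[symmetric]
      by (simp add: distrib_right) (use abs_ge_zero[of "a - b"] in linarith)
    also have "\<dots> \<le> (1 + 4 * of_int p) * dist1 V x y + 4 * dist1 (insert e V) x y"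
      using PsiI[OF p0 k] dm dn by simp
    also have "\<dots> \<le> (1 + 4 * of_int p) * dist1 (insert e V) x y + 4 * dist1 (insert e V) x y"
      using p0 dn by (intro add_right_mono mult_left_mono) auto
    also have "\<dots> = (1 + 4 * of_int k) * dist1 (insert e V) x y" unfolding kp by (simp add: algebra_simps)
    finally show ?thesis .
  qed
qed

lemma level_law_extend: "level_law (insert e V) (extend e V c)"
  unfolding level_law_def using extend_nonneg extend_total extend_marginal law_gap_extend by blast

end

lemma layer_empty: "layer {} j = (if j = 0 then {{}} else {})"
  by (auto simp: layer_def)

lemma level_law_empty: "level_law {} (\<lambda>x S. 1)"
  by (auto simp: level_law_def law_gap_def layer_empty dist1_def)

theorem ex_level_law: "finite V \<Longrightarrow> \<exists>c. level_law V c"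
proof (induction V rule: finite_induct)
  case empty
  show ?case using level_law_empty by blast
next
  case (insert e V)
  then show ?case using level_law_extend by blast
qed

text \<open>\<open>a \<omega> x j\<close> is the random subset of \<open>V\<close> for the input \<open>x\<close> when its size is prescribed to be \<open>j\<close>.\<close>

definition scheme :: "'w measure \<Rightarrow> ('w \<Rightarrow> (nat \<Rightarrow> real) \<Rightarrow> int \<Rightarrow> nat set) \<Rightarrow> nat set \<Rightarrow> bool" where
  "scheme M a V \<longleftrightarrow> prob_space M \<and>
     (\<forall>x j. (\<lambda>\<omega>. a \<omega> x j) \<in> M \<rightarrow>\<^sub>M count_space (Collect finite)) \<and>
     (\<forall>\<omega>\<in>space M. \<forall>x j. a \<omega> x j \<subseteq> V) \<and>
     (\<forall>\<omega>\<in>space M. \<forall>x\<in>ubox V. \<forall>j. \<bar>sum x V - of_int j\<bar> < 1 \<longrightarrow> a \<omega> x j \<in> layer V j) \<and>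
     (\<forall>x\<in>ubox V. \<forall>i\<in>V. interp (\<lambda>j. measure M {\<omega> \<in> space M. i \<in> a \<omega> x j}) (sum x V) = x i)"

definition sdiff :: "nat set \<Rightarrow> nat set \<Rightarrow> real" where
  "sdiff A B = real (card (sym_diff A B))"

text \<open>The counts \<open>j\<close> and \<open>j'\<close> handed down to \<open>V\<close> for \<open>x\<close> and \<open>y\<close> may be coupled in any way, so the cost
  at equal counts is charged to \<open>\<phi>\<close>, a function of \<open>j\<close> alone, of which only the average over the
  law of \<open>j\<close> is controlled.\<close>

definition stable :: "'w measure \<Rightarrow> ('w \<Rightarrow> (nat \<Rightarrow> real) \<Rightarrow> int \<Rightarrow> nat set) \<Rightarrow> nat set \<Rightarrow> real \<Rightarrow> real \<Rightarrow>
    (nat \<Rightarrow> real) \<Rightarrow> (nat \<Rightarrow> real) \<Rightarrow> bool" where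
  "stable M a V K g x y \<longleftrightarrow> (\<exists>\<phi>. (\<forall>j. 0 \<le> \<phi> j) \<and> interp \<phi> (sum x V) \<le> K * dist1 V x y \<and>
     (\<forall>j j'. \<bar>sum x V - of_int j\<bar> < 1 \<longrightarrow> \<bar>sum y V - of_int j'\<bar> < 1 \<longrightarrow>
        (\<integral>\<omega>. sdiff (a \<omega> x j) (a \<omega> y j') \<partial>M) \<le> g * of_bool (j \<noteq> j') + \<phi> j))"

section \<open>Symmetric differences and random finite sets\<close>

lemma sdiff_nonneg [simp]: "0 \<le> sdiff A B"
  by (simp add: sdiff_def)

lemma sdiff_same [simp]: "sdiff A A = 0"
  by (simp add: sdiff_def)

lemma sdiff_le_card: "finite A \<Longrightarrow> finite B \<Longrightarrow> sdiff A B \<le> real (card A) + real (card B)"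
proof -
  assume "finite A" "finite B"
  then have "card (sym_diff A B) \<le> card A + card B"
    using card_Un_le[of "A - B" "B - A"] card_mono[of A "A - B"] card_mono[of B "B - A"] by auto
  then show ?thesis by (simp add: sdiff_def)
qed

lemma sdiff_Un_le:
  assumes "finite A" "finite A'" "finite B" "finite B'"
  shows "sdiff (A \<union> B) (A' \<union> B') \<le> sdiff A A' + sdiff B B'"
proof -
  have "card (sym_diff (A \<union> B) (A' \<union> B')) \<le> card (sym_diff A A' \<union> sym_diff B B')"
    using assms by (intro card_mono) auto
  also have "\<dots> \<le> card (sym_diff A A') + card (sym_diff B B')" by (rule card_Un_le)
  finally show ?thesis by (simp add: sdiff_def)
qed

lemma sets_Collect_set_fun:
  assumes "X \<in> M \<rightarrow>\<^sub>M count_space (Collect finite)"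
  shows "{\<omega> \<in> space M. P (X \<omega>)} \<in> sets M"
proof -
  have "{\<omega> \<in> space M. P (X \<omega>)} = X -` {S. finite S \<and> P S} \<inter> space M"
    using measurable_space[OF assms] by auto
  also have "\<dots> \<in> sets M" by (rule measurable_sets[OF assms]) auto
  finally show ?thesis .
qed

text \<open>There are only countably many finite sets of naturals, so an arbitrary function of two
  random ones is measurable.\<close>

lemma measurable_set_fun2:
  fixes f :: "nat set \<Rightarrow> nat set \<Rightarrow> 'b"
  assumes "X \<in> M \<rightarrow>\<^sub>M count_space (Collect finite)" "Y \<in> M \<rightarrow>\<^sub>M count_space (Collect finite)"
    and f: "\<And>A B. finite A \<Longrightarrow> finite B \<Longrightarrow> f A B \<in> space N"
  shows "(\<lambda>\<omega>. f (X \<omega>) (Y \<omega>)) \<in> M \<rightarrow>\<^sub>M N"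
proof (rule measurable_compose_countable'[where I = "Collect finite" and g = X])
  fix A :: "nat set" assume A: "A \<in> Collect finite"
  show "(\<lambda>\<omega>. f A (Y \<omega>)) \<in> M \<rightarrow>\<^sub>M N"
    by (rule measurable_compose[OF assms(2)]) (use f A in \<open>auto simp: measurable_count_space_eq1\<close>)
qed (use assms countable_Collect_finite in auto)

section \<open>Schemes: one bucket and the union of two disjoint sets\<close>

text \<open>A cell with negative \<open>k\<close> forces both masses to be 0, where the cell from 0
  to 1 serves. The gap bound in \<open>level_law\<close> is stated for \<open>k \<ge> 0\<close>
  only.\<close>

lemma aligned_cell:
  assumes "aligned V x y" "x \<in> ubox V" "y \<in> ubox V"
  obtains k :: int where "0 \<le> k" "of_int k \<le> sum x V" "sum x V \<le> of_int k + 1"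
    "of_int k \<le> sum y V" "sum y V \<le> of_int k + 1"
proof -
  obtain k :: int where k: "of_int k \<le> sum x V" "sum x V \<le> of_int k + 1"
    "of_int k \<le> sum y V" "sum y V \<le> of_int k + 1"
    using assms(1) unfolding aligned_def by blast
  have pos: "0 \<le> sum x V" "0 \<le> sum y V" using assms by (auto simp: ubox_def intro: sum_nonneg)
  show thesis
  proof (cases "0 \<le> k")
    case True
    then show thesis using k that by blast
  next
    case False
    then have "k + 1 \<le> 0" by simp
    then have "of_int k + 1 \<le> (0::real)" by linarith
    then show thesis using k pos that[of 0] by simp
  qed
qed

lemma sum_Pow_layer:
  assumes "finite V"
  shows "(\<Sum>S\<in>Pow V. of_bool (int (card S) = j) * f S) = (\<Sum>S\<in>layer V j. (f S :: real))"
proof -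
  have "(\<Sum>S\<in>layer V j. f S) = (\<Sum>S\<in>layer V j. of_bool (int (card S) = j) * f S)"
    by (rule sum.cong) (auto simp: layer_def)
  also have "\<dots> = (\<Sum>S\<in>Pow V. of_bool (int (card S) = j) * f S)"
    using assms by (intro sum.mono_neutral_left) (auto simp: layer_def)
  finally show ?thesis by simp
qed

section \<open>One bucket: a race for the pivotal law of a given size\<close>

context
  fixes V :: "nat set" and c :: "(nat \<Rightarrow> real) \<Rightarrow> nat set \<Rightarrow> real"
  assumes V: "finite V" and law: "level_law V c"
begin

text \<open>The law is spread over all of \<open>Pow V\<close>, so that one family of clocks,
  indexed by the subsets, serves every input and every size.\<close>

definition leaf_p :: "(nat \<Rightarrow> real) \<Rightarrow> int \<Rightarrow> nat set \<Rightarrow> real" where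
  "leaf_p x j S = of_bool (int (card S) = j) * c x S"

text \<open>Repairs the null event that the race ends in a set of the wrong size.\<close>

definition leaf_fix :: "int \<Rightarrow> nat set \<Rightarrow> nat set" where
  "leaf_fix j S = (if S \<in> layer V j \<or> layer V j = {} then S else SOME S. S \<in> layer V j)"

abbreviation (input) "leaf_M \<equiv> PiM (Pow V) (\<lambda>_. expo)"

definition leaf_a :: "(nat set \<Rightarrow> real) \<Rightarrow> (nat \<Rightarrow> real) \<Rightarrow> int \<Rightarrow> nat set" where
  "leaf_a \<omega> x j = leaf_fix j (pick (Pow V) \<omega> (leaf_p x j))"

lemma leaf_p_prob:
  assumes "x \<in> ubox V" "\<bar>sum x V - of_int j\<bar> < 1"
  shows "0 \<le> leaf_p x j S" "sum (leaf_p x j) (Pow V) = 1"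
  using law assms sum_Pow_layer[OF V, of j "c x"] by (auto simp: level_law_def leaf_p_def)

lemma layer_nonempty:
  assumes "x \<in> ubox V" "\<bar>sum x V - of_int j\<bar> < 1"
  shows "layer V j \<noteq> {}"
proof
  assume "layer V j = {}"
  moreover have "sum (c x) (layer V j) = 1" using law assms by (auto simp: level_law_def)
  ultimately show False by simp
qed

lemma leaf_fix_layer: "layer V j \<noteq> {} \<Longrightarrow> leaf_fix j S \<in> layer V j"
  by (auto simp: leaf_fix_def some_in_eq)

lemma pick_Pow: "pick (Pow V) \<omega> p \<in> Pow V"
  by (rule pick_in) auto

lemma leaf_fix_sub: "S \<in> Pow V \<Longrightarrow> leaf_fix j S \<in> Pow V"
  using leaf_fix_layer[of j S] by (cases "layer V j = {}") (auto simp: leaf_fix_def layer_def)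

lemma measurable_leaf_pick: "(\<lambda>\<omega>. pick (Pow V) \<omega> p) \<in> leaf_M \<rightarrow>\<^sub>M count_space (Pow V)"
  by (rule measurable_pick) (use V in auto)

lemma measurable_leaf: "(\<lambda>\<omega>. leaf_a \<omega> x j) \<in> leaf_M \<rightarrow>\<^sub>M count_space (Collect finite)"
  unfolding leaf_a_def
proof (rule measurable_compose[OF measurable_leaf_pick])
  show "leaf_fix j \<in> count_space (Pow V) \<rightarrow>\<^sub>M count_space (Collect finite)"
    using leaf_fix_sub V by (auto simp: measurable_count_space_eq1 intro: finite_subset)
qed

lemma prob_space_leaf: "prob_space leaf_M"
  by (intro prob_space_PiM prob_space_expo)

lemma leaf_marginal:
  assumes x: "x \<in> ubox V" "\<bar>sum x V - of_int j\<bar> < 1"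
  shows "measure leaf_M {\<omega> \<in> space leaf_M. i \<in> leaf_a \<omega> x j} = (\<Sum>S\<in>layer V j. c x S * of_bool (i \<in> S))"
proof -
  interpret prob_space leaf_M by (rule prob_space_leaf)
  let ?E = "\<lambda>S. {\<omega> \<in> space leaf_M. pick (Pow V) \<omega> (leaf_p x j) = S}"
  have E: "?E S \<in> sets leaf_M" if "S \<in> Pow V" for S
    using measurable_sets[OF measurable_leaf_pick, of "{S}" "leaf_p x j"] that
    by (auto simp: vimage_def Int_def conj_commute)
  have PE: "measure leaf_M (?E S) = leaf_p x j S" if "S \<in> Pow V" for S
    by (rule prob_pick) (use V that leaf_p_prob[OF x] in auto)
  have "AE \<omega> in leaf_M. \<omega> \<notin> ?E S" if "S \<in> Pow V - layer V j" for S
  proof (rule AE_not_in)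
    have "leaf_p x j S = 0" using that by (auto simp: leaf_p_def layer_def)
    then show "?E S \<in> null_sets leaf_M"
      using E[of S] PE[of S] that by (auto simp: null_sets_def emeasure_eq_measure)
  qed
  then have "AE \<omega> in leaf_M. \<forall>S\<in>Pow V - layer V j. \<omega> \<notin> ?E S"
    using V by (subst AE_finite_all) auto
  then have ae: "AE \<omega> in leaf_M. leaf_a \<omega> x j = pick (Pow V) \<omega> (leaf_p x j)"
  proof (rule AE_mp, intro AE_I2 impI)
    fix \<omega> assume w: "\<omega> \<in> space leaf_M" "\<forall>S\<in>Pow V - layer V j. \<omega> \<notin> ?E S"
    then have "pick (Pow V) \<omega> (leaf_p x j) \<in> layer V j" using pick_Pow[of \<omega> "leaf_p x j"] by blast
    then show "leaf_a \<omega> x j = pick (Pow V) \<omega> (leaf_p x j)" by (simp add: leaf_a_def leaf_fix_def)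
  qed
  have m1: "{\<omega> \<in> space leaf_M. i \<in> leaf_a \<omega> x j} \<in> sets leaf_M"
    by (rule sets_Collect_set_fun[OF measurable_leaf])
  have U: "{\<omega> \<in> space leaf_M. i \<in> pick (Pow V) \<omega> (leaf_p x j)} = (\<Union>S\<in>{S \<in> Pow V. i \<in> S}. ?E S)"
    using pick_Pow by blast
  have m2: "(\<Union>S\<in>{S \<in> Pow V. i \<in> S}. ?E S) \<in> sets leaf_M"
    by (intro sets.finite_UN E) (use V in auto)
  have "measure leaf_M {\<omega> \<in> space leaf_M. i \<in> leaf_a \<omega> x j} =
    measure leaf_M {\<omega> \<in> space leaf_M. i \<in> pick (Pow V) \<omega> (leaf_p x j)}"
    by (rule finite_measure_eq_AE) (use ae m1 m2 U in auto)
  also have "\<dots> = (\<Sum>S\<in>{S \<in> Pow V. i \<in> S}. measure leaf_M (?E S))"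
    unfolding U by (rule finite_measure_finite_Union) (use V E in \<open>auto simp: disjoint_family_on_def\<close>)
  also have "\<dots> = (\<Sum>S\<in>{S \<in> Pow V. i \<in> S}. leaf_p x j S)"
    by (rule sum.cong) (auto simp: PE)
  also have "\<dots> = (\<Sum>S\<in>Pow V. of_bool (int (card S) = j) * (c x S * of_bool (i \<in> S)))"
    by (rule sum.mono_neutral_cong_left) (use V in \<open>auto simp: leaf_p_def\<close>)
  also have "\<dots> = (\<Sum>S\<in>layer V j. c x S * of_bool (i \<in> S))" by (rule sum_Pow_layer[OF V])
  finally show ?thesis .
qed

lemma scheme_leaf: "scheme leaf_M leaf_a V"
  unfolding scheme_def
proof (intro conjI ballI allI impI)
  fix x i assume x: "x \<in> ubox V" and i: "i \<in> V"
  have "interp (\<lambda>j. measure leaf_M {\<omega> \<in> space leaf_M. i \<in> leaf_a \<omega> x j}) (sum x V) =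
     interp (\<lambda>j. \<Sum>S\<in>layer V j. c x S * of_bool (i \<in> S)) (sum x V)"
    by (rule interp_cong) (rule leaf_marginal[OF x])
  then show "interp (\<lambda>j. measure leaf_M {\<omega> \<in> space leaf_M. i \<in> leaf_a \<omega> x j}) (sum x V) = x i"
    using law x i by (simp add: level_law_def)
next
  fix \<omega> x and j :: int assume "x \<in> ubox V" "\<bar>sum x V - of_int j\<bar> < 1"
  then show "leaf_a \<omega> x j \<in> layer V j"
    unfolding leaf_a_def by (intro leaf_fix_layer layer_nonempty)
qed (use prob_space_leaf measurable_leaf leaf_fix_sub[OF pick_Pow] in \<open>auto simp: leaf_a_def\<close>)

text \<open>Admissible sizes are at most \<open>B + 1\<close>, so a change of the set costs at most
  \<open>2 * (B + 1)\<close>. At equal sizes it happens with probability at most \<open>D j\<close>,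
  the L1 distance of the conditional laws, and \<open>\<phi>\<close> is the product. The average of
  \<open>D\<close> is at most \<open>(6 + 4 * of_int k) * \<epsilon>\<close>:
  \<open>1 + 4 * of_int k\<close> from the gap, 1 from \<open>weighted_L1\<close> and 4 from
  replacing the weights at two sizes. With \<open>of_int k \<le> B\<close> this gives the constant
  12.\<close>

lemma stable_leaf:
  assumes x: "x \<in> ubox V" and y: "y \<in> ubox V" and al: "aligned V x y"
    and B: "sum x V \<le> B" "sum y V \<le> B"
  shows "stable leaf_M leaf_a V (12 * (B + 1)\<^sup>2) (2 * (B + 1)) x y"
proof -
  interpret prob_space leaf_M by (rule prob_space_leaf)
  obtain k :: int where k: "0 \<le> k" "of_int k \<le> sum x V" "sum x V \<le> of_int k + 1"
    "of_int k \<le> sum y V" "sum y V \<le> of_int k + 1" using aligned_cell[OF al x y] by blast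
  define m m' \<epsilon> where d: "m = sum x V" "m' = sum y V" "\<epsilon> = dist1 V x y"
  have B0: "0 \<le> B" using k(1,2) B(1) by (metis of_int_0_le_iff order_trans)
  have dm: "\<bar>m - m'\<bar> \<le> \<epsilon>" unfolding d by (rule abs_sum_diff_le_dist1)
  define D where "D j = (\<Sum>S\<in>layer V j. \<bar>c x S - c y S\<bar>)" for j
  have D0: "0 \<le> D j" for j by (simp add: D_def sum_nonneg)
  define \<phi> where "\<phi> j = (if \<bar>m' - of_int j\<bar> < 1 then 2 * (B + 1) * D j else 0)" for j
  have cx: "0 \<le> c x S" "0 \<le> c y S" for S using law x y by (auto simp: level_law_def)
  have sx: "sum (c x) (layer V j) = 1" if "\<bar>m - of_int j\<bar> < 1" for j
    using law x that unfolding level_law_def d by blast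
  have sy: "sum (c y) (layer V j) = 1" if "\<bar>m' - of_int j\<bar> < 1" for j
    using law y that unfolding level_law_def d by blast
  have D2: "D j \<le> 2" if "\<bar>m - of_int j\<bar> < 1" "\<bar>m' - of_int j\<bar> < 1" for j
  proof -
    have "D j \<le> (\<Sum>S\<in>layer V j. c x S + c y S)" unfolding D_def
      by (rule sum_mono) (use cx in \<open>smt (verit)\<close>)
    also have "\<dots> = 2" using sx[OF that(1)] sy[OF that(2)] by (simp add: sum.distrib)
    finally show ?thesis .
  qed
  have phi: "(\<integral>\<omega>. sdiff (leaf_a \<omega> x j) (leaf_a \<omega> y j') \<partial>leaf_M) \<le> 2 * (B + 1) * of_bool (j \<noteq> j') + \<phi> j"
    if j: "\<bar>m - of_int j\<bar> < 1" "\<bar>m' - of_int j'\<bar> < 1" for j j'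
  proof -
    have int: "integrable leaf_M (\<lambda>\<omega>. sdiff (leaf_a \<omega> x j) (leaf_a \<omega> y j'))"
      and bd: "sdiff (leaf_a \<omega> x j) (leaf_a \<omega> y j') \<le> 2 * (B + 1)" for \<omega>
    proof -
      show bd: "sdiff (leaf_a \<omega> x j) (leaf_a \<omega> y j') \<le> 2 * (B + 1)" for \<omega>
      proof -
        have L: "leaf_a \<omega> x j \<in> layer V j" "leaf_a \<omega> y j' \<in> layer V j'"
          using leaf_fix_layer[OF layer_nonempty[OF x]] leaf_fix_layer[OF layer_nonempty[OF y]] j
          unfolding leaf_a_def d by blast+
        then have fin: "finite (leaf_a \<omega> x j)" "finite (leaf_a \<omega> y j')"
          using V by (auto simp: layer_def intro: finite_subset)
        have "sdiff (leaf_a \<omega> x j) (leaf_a \<omega> y j') \<le> of_int (int (card (leaf_a \<omega> x j))) + of_int (int (card (leaf_a \<omega> y j')))"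
          using sdiff_le_card[OF fin] by simp
        also have "\<dots> = of_int j + of_int j'" using L by (simp add: layer_def)
        also have "\<dots> \<le> (B + 1) + (B + 1)"
        proof (rule add_mono)
          show "of_int j \<le> B + 1" using j(1) B(1) unfolding d abs_less_iff by simp
          show "of_int j' \<le> B + 1" using j(2) B(2) unfolding d abs_less_iff by simp
        qed
        also have "\<dots> = 2 * (B + 1)" by simp
        finally show ?thesis .
      qed
      show "integrable leaf_M (\<lambda>\<omega>. sdiff (leaf_a \<omega> x j) (leaf_a \<omega> y j'))"
        by (rule integrable_const_bound[where B="2 * (B + 1)"])
          (use bd in \<open>auto intro!: measurable_set_fun2 measurable_leaf\<close>)
    qed
    show ?thesis
    proof (cases "j = j'")
      case False
      have "(\<integral>\<omega>. sdiff (leaf_a \<omega> x j) (leaf_a \<omega> y j') \<partial>leaf_M) \<le> (\<integral>\<omega>. 2 * (B + 1) \<partial>leaf_M)"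
        by (rule integral_mono[OF int]) (use bd in auto)
      also have "\<dots> = 2 * (B + 1)" by (simp add: prob_space)
      finally have "(\<integral>\<omega>. sdiff (leaf_a \<omega> x j) (leaf_a \<omega> y j') \<partial>leaf_M) \<le> 2 * (B + 1)" .
      moreover have "0 \<le> \<phi> j" using B0 D0 by (simp add: \<phi>_def)
      ultimately show ?thesis using False by simp
    next
      case True
      let ?N = "{\<omega> \<in> space leaf_M. pick (Pow V) \<omega> (leaf_p x j) \<noteq> pick (Pow V) \<omega> (leaf_p y j)}"
      have N: "?N \<in> sets leaf_M"
      proof -
        have pm: "(\<lambda>\<omega>. pick (Pow V) \<omega> p) \<in> leaf_M \<rightarrow>\<^sub>M count_space (Collect finite)" for p
          by (rule measurable_compose[OF measurable_leaf_pick])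
            (use V in \<open>auto simp: measurable_count_space_eq1 intro: finite_subset\<close>)
        have "(\<lambda>\<omega>. pick (Pow V) \<omega> (leaf_p x j) \<noteq> pick (Pow V) \<omega> (leaf_p y j)) \<in> leaf_M \<rightarrow>\<^sub>M count_space UNIV"
          by (rule measurable_set_fun2[OF pm pm, where f="\<lambda>A B. A \<noteq> B"]) simp
        from measurable_sets[OF this, of "{True}"] show ?thesis
          by (simp add: vimage_def Int_def conj_commute)
      qed
      have "(\<integral>\<omega>. sdiff (leaf_a \<omega> x j) (leaf_a \<omega> y j') \<partial>leaf_M) \<le> (\<integral>\<omega>. 2 * (B + 1) * indicator ?N \<omega> \<partial>leaf_M)"
      proof (rule integral_mono[OF int])
        show "integrable leaf_M (\<lambda>\<omega>. 2 * (B + 1) * indicator ?N \<omega>)"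
          using N by (intro integrable_mult_right integrable_real_indicator) (auto simp: emeasure_eq_measure)
        fix \<omega> assume "\<omega> \<in> space leaf_M"
        then show "sdiff (leaf_a \<omega> x j) (leaf_a \<omega> y j') \<le> 2 * (B + 1) * indicator ?N \<omega>"
          using bd[of \<omega>] True by (cases "\<omega> \<in> ?N") (auto simp: leaf_a_def)
      qed
      also have "\<dots> = 2 * (B + 1) * measure leaf_M ?N" using N by simp
      finally have I: "(\<integral>\<omega>. sdiff (leaf_a \<omega> x j) (leaf_a \<omega> y j') \<partial>leaf_M) \<le> 2 * (B + 1) * measure leaf_M ?N" .
      have "measure leaf_M ?N \<le> (\<Sum>S\<in>Pow V. \<bar>leaf_p x j S - leaf_p y j S\<bar>)"
        by (rule prob_pick_neq) (use V x y j True leaf_p_prob d in auto)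
      also have "\<dots> = (\<Sum>S\<in>Pow V. of_bool (int (card S) = j) * \<bar>c x S - c y S\<bar>)"
        by (rule sum.cong) (auto simp: leaf_p_def)
      also have "\<dots> = D j" unfolding D_def by (rule sum_Pow_layer[OF V])
      finally have "2 * (B + 1) * measure leaf_M ?N \<le> 2 * (B + 1) * D j"
        using B0 by (intro mult_left_mono) auto
      then have "(\<integral>\<omega>. sdiff (leaf_a \<omega> x j) (leaf_a \<omega> y j') \<partial>leaf_M) \<le> 2 * (B + 1) * D j"
        using I by (rule order_trans[rotated])
      then show ?thesis using True j(2) by (simp add: \<phi>_def)
    qed
  qed
  have law_gap: "min (of_int k + 1 - m) (of_int k + 1 - m') * D k +
     (\<Sum>S\<in>layer V (k + 1). \<bar>(m - of_int k) * c x S - (m' - of_int k) * c y S\<bar>) \<le> (1 + 4 * of_int k) * \<epsilon>"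
    using law x y al k unfolding level_law_def law_gap_def d D_def by blast
  \<comment> \<open>The weight for \<open>x\<close> is replaced by the smaller of the two weights.
    The error is at most \<open>2 * \<epsilon>\<close> because \<open>D j\<close> is the distance of
    two probability laws if \<open>j\<close> is admissible for both inputs, and
    \<open>\<phi> j\<close> is 0 if it is not so for \<open>y\<close>.\<close>
  have lift: "w * \<phi> j \<le> 2 * (B + 1) * (min w w' * D j + 2 * \<epsilon>)"
    if "0 \<le> w" "0 \<le> w'" "\<bar>w - w'\<bar> \<le> \<epsilon>" "0 < w \<Longrightarrow> \<bar>m - of_int j\<bar> < 1" for w w' j
  proof (cases "0 < w \<and> \<bar>m' - of_int j\<bar> < 1")
    case True
    then have "D j \<le> 2" using D2 that by blast
    have "w * D j \<le> (min w w' + \<epsilon>) * D j" using that D0 by (intro mult_right_mono) auto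
    also have "\<dots> \<le> min w w' * D j + \<epsilon> * 2"
      unfolding distrib_right using \<open>D j \<le> 2\<close> that by (intro add_left_mono mult_left_mono) auto
    finally have "w * D j \<le> min w w' * D j + 2 * \<epsilon>" by simp
    then have "2 * (B + 1) * (w * D j) \<le> 2 * (B + 1) * (min w w' * D j + 2 * \<epsilon>)"
      using B0 by (intro mult_left_mono) auto
    then show ?thesis using True by (simp add: \<phi>_def mult.left_commute)
  next
    case False
    then have "w * \<phi> j = 0" using that by (auto simp: \<phi>_def)
    also have "0 \<le> 2 * (B + 1) * (min w w' * D j + 2 * \<epsilon>)"
      using B0 D0 that by (intro mult_nonneg_nonneg add_nonneg_nonneg) auto
    finally show ?thesis .
  qed
  have "interp \<phi> m = (of_int k + 1 - m) * \<phi> k + (m - of_int k) * \<phi> (k + 1)"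
    by (rule interp_cell) (use k d in auto)
  also have "\<dots> \<le> 2 * (B + 1) * (min (of_int k + 1 - m) (of_int k + 1 - m') * D k + 2 * \<epsilon>) +
     2 * (B + 1) * (min (m - of_int k) (m' - of_int k) * D (k + 1) + 2 * \<epsilon>)"
    by (intro add_mono lift) (use k dm d in auto)
  finally have I: "interp \<phi> m \<le> 2 * (B + 1) * (min (of_int k + 1 - m) (of_int k + 1 - m') * D k + 2 * \<epsilon>) +
     2 * (B + 1) * (min (m - of_int k) (m' - of_int k) * D (k + 1) + 2 * \<epsilon>)" .
  have "min (m - of_int k) (m' - of_int k) * D (k + 1) \<le>
    (\<Sum>S\<in>layer V (k + 1). \<bar>(m - of_int k) * c x S - (m' - of_int k) * c y S\<bar>) + \<bar>(m - of_int k) - (m' - of_int k)\<bar>"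
    unfolding D_def by (rule weighted_L1(2)) (use cx sx sy k d in auto)
  then have "2 * (B + 1) * (min (m - of_int k) (m' - of_int k) * D (k + 1) + 2 * \<epsilon>) \<le>
     2 * (B + 1) * ((\<Sum>S\<in>layer V (k + 1). \<bar>(m - of_int k) * c x S - (m' - of_int k) * c y S\<bar>) + \<bar>m - m'\<bar> + 2 * \<epsilon>)"
    using B0 by (intro mult_left_mono add_right_mono) auto
  with I have "interp \<phi> m \<le> 2 * (B + 1) * (min (of_int k + 1 - m) (of_int k + 1 - m') * D k + 2 * \<epsilon>) +
     2 * (B + 1) * ((\<Sum>S\<in>layer V (k + 1). \<bar>(m - of_int k) * c x S - (m' - of_int k) * c y S\<bar>) + \<bar>m - m'\<bar> + 2 * \<epsilon>)"
    by linarith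
  also have "\<dots> = 2 * (B + 1) * (min (of_int k + 1 - m) (of_int k + 1 - m') * D k +
     (\<Sum>S\<in>layer V (k + 1). \<bar>(m - of_int k) * c x S - (m' - of_int k) * c y S\<bar>) + \<bar>m - m'\<bar> + 4 * \<epsilon>)"
    by (simp add: algebra_simps)
  also have "\<dots> \<le> 2 * (B + 1) * ((1 + 4 * of_int k) * \<epsilon> + \<epsilon> + 4 * \<epsilon>)"
    using B0 law_gap dm by (intro mult_left_mono) auto
  also have "\<dots> = 2 * (B + 1) * ((6 + 4 * of_int k) * \<epsilon>)" by (simp add: algebra_simps)
  also have "\<dots> \<le> 2 * (B + 1) * ((6 * (B + 1)) * \<epsilon>)"
    using B0 B k dm by (intro mult_left_mono mult_right_mono) auto
  also have "\<dots> = 12 * (B + 1)\<^sup>2 * \<epsilon>" by (simp add: power2_eq_square algebra_simps)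
  finally have "interp \<phi> m \<le> 12 * (B + 1)\<^sup>2 * \<epsilon>" .
  moreover have "\<forall>j. 0 \<le> \<phi> j" using B0 D0 by (simp add: \<phi>_def)
  ultimately show ?thesis using phi unfolding stable_def d by blast
qed

end

section \<open>Integrals over independent coins and samples\<close>

lemma distr_pair_snd:
  assumes "prob_space M" "sigma_finite_measure N"
  shows "distr (M \<Otimes>\<^sub>M N) N snd = N"
proof (rule measure_eqI)
  interpret M: prob_space M by fact
  interpret N: sigma_finite_measure N by fact
  fix A assume A: "A \<in> sets (distr (M \<Otimes>\<^sub>M N) N snd)"
  then have "emeasure (distr (M \<Otimes>\<^sub>M N) N snd) A = emeasure (M \<Otimes>\<^sub>M N) (space M \<times> A)"
    by (auto simp: emeasure_distr space_pair_measure dest: sets.sets_into_space intro!: arg_cong2[where f=emeasure])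
  with A show "emeasure (distr (M \<Otimes>\<^sub>M N) N snd) A = emeasure N A"
    by (simp add: N.emeasure_pair_measure_Times M.emeasure_space_1)
qed simp

text \<open>One form of Fubini for both children and for the root. Only a countable value
  \<open>g\<close> of the coin enters, so measurability of \<open>F\<close> is asked separately for
  each value; \<open>h\<close> will be a projection to one child, or the identity at the
  root.\<close>

lemma integral_coin_proj:
  fixes F :: "'k::countable \<Rightarrow> 'w \<Rightarrow> real"
  assumes U: "prob_space U" and W: "prob_space W" and M: "prob_space M"
    and h: "h \<in> W \<rightarrow>\<^sub>M M" "distr W M h = M"
    and g: "g \<in> U \<rightarrow>\<^sub>M count_space UNIV"
    and F: "\<And>k. F k \<in> borel_measurable M" and bd: "\<And>k w. w \<in> space M \<Longrightarrow> \<bar>F k w\<bar> \<le> B"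
  shows "integrable (U \<Otimes>\<^sub>M W) (\<lambda>z. F (g (fst z)) (h (snd z)))"
    and "(\<integral>z. F (g (fst z)) (h (snd z)) \<partial>(U \<Otimes>\<^sub>M W)) = (\<integral>u. \<integral>w. F (g u) w \<partial>M \<partial>U)"
proof -
  interpret U: prob_space U by fact
  interpret W: prob_space W by fact
  interpret P: pair_prob_space U W ..
  have m: "(\<lambda>z. F (g (fst z)) (h (snd z))) \<in> borel_measurable (U \<Otimes>\<^sub>M W)"
    by (rule measurable_compose_countable[where f="\<lambda>k z. F k (h (snd z))" and g="\<lambda>z. g (fst z)"])
      (use g h F in \<open>auto intro: measurable_compose[OF measurable_fst] measurable_compose[OF measurable_snd] measurable_compose\<close>)
  show i: "integrable (U \<Otimes>\<^sub>M W) (\<lambda>z. F (g (fst z)) (h (snd z)))"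
    by (rule P.integrable_const_bound[where B=B])
      (use m bd measurable_space[OF h(1)] in \<open>auto simp: space_pair_measure\<close>)
  have "(\<integral>z. F (g (fst z)) (h (snd z)) \<partial>(U \<Otimes>\<^sub>M W)) = (\<integral>u. \<integral>w. F (g u) (h w) \<partial>W \<partial>U)"
    using P.integral_fst'[OF i] by simp
  also have "\<dots> = (\<integral>u. \<integral>w. F (g u) w \<partial>M \<partial>U)"
  proof -
    have "(\<integral>w. F k (h w) \<partial>W) = (\<integral>w. F k w \<partial>M)" for k
      using integral_distr[OF h(1) F, of k] h(2) by simp
    then show ?thesis by simp
  qed
  finally show "(\<integral>z. F (g (fst z)) (h (snd z)) \<partial>(U \<Otimes>\<^sub>M W)) = (\<integral>u. \<integral>w. F (g u) w \<partial>M \<partial>U)" .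
qed

lemma measurable_split_level: "split_level l r j \<in> unif \<rightarrow>\<^sub>M count_space UNIV"
  unfolding split_level_def unif_def
  by (intro measurable_restrict_space1) measurable

lemma split_level_range: "split_level l r j u \<in> {\<lfloor>l\<rfloor>, \<lfloor>l\<rfloor> + 1}"
  by (simp add: split_level_def)

lemma integrable_finite_range:
  fixes F :: "'k \<Rightarrow> real"
  assumes "prob_space M" "g \<in> M \<rightarrow>\<^sub>M count_space UNIV" "finite R" "\<And>u. u \<in> space M \<Longrightarrow> g u \<in> R"
  shows "integrable M (\<lambda>u. F (g u))"
proof -
  interpret prob_space M by fact
  show ?thesis
  proof (rule integrable_const_bound[where B="\<Sum>k\<in>R. \<bar>F k\<bar>"])
    show "AE u in M. norm (F (g u)) \<le> (\<Sum>k\<in>R. \<bar>F k\<bar>)"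
      using assms by (intro AE_I2) (auto intro!: member_le_sum)
    show "(\<lambda>u. F (g u)) \<in> borel_measurable M"
      by (rule measurable_compose[OF assms(2)]) simp
  qed
qed

lemma measurable_split_level_pair:
  "(\<lambda>u. (split_level l r j u, split_level l' r' j' u)) \<in> unif \<rightarrow>\<^sub>M count_space UNIV"
proof -
  have "(\<lambda>u. (split_level l r j u, split_level l' r' j' u)) \<in> unif \<rightarrow>\<^sub>M count_space UNIV \<Otimes>\<^sub>M count_space UNIV"
    by (intro measurable_Pair measurable_split_level)
  then show ?thesis by (simp add: pair_measure_countable)
qed

lemma integrable_split_level_pair:
  "integrable unif (\<lambda>u. F (split_level l r j u) (split_level l' r' j' u) :: real)"
proof -
  have "integrable unif (\<lambda>u. (\<lambda>(a, b). F a b) (split_level l r j u, split_level l' r' j' u))"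
    by (rule integrable_finite_range[OF prob_space_unif measurable_split_level_pair,
          where R="{\<lfloor>l\<rfloor>, \<lfloor>l\<rfloor> + 1} \<times> {\<lfloor>l'\<rfloor>, \<lfloor>l'\<rfloor> + 1}"]) (use split_level_range in auto)
  then show ?thesis by simp
qed

lemma schemeD:
  assumes "scheme M a V"
  shows "prob_space M" "(\<lambda>\<omega>. a \<omega> x j) \<in> M \<rightarrow>\<^sub>M count_space (Collect finite)"
    "\<omega> \<in> space M \<Longrightarrow> a \<omega> x j \<subseteq> V"
    "\<omega> \<in> space M \<Longrightarrow> x \<in> ubox V \<Longrightarrow> \<bar>sum x V - of_int j\<bar> < 1 \<Longrightarrow> a \<omega> x j \<in> layer V j"
    "x \<in> ubox V \<Longrightarrow> i \<in> V \<Longrightarrow> interp (\<lambda>j. measure M {\<omega> \<in> space M. i \<in> a \<omega> x j}) (sum x V) = x i"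
  using assms unfolding scheme_def by blast+

lemma prob_integral:
  assumes "prob_space M" "X \<in> M \<rightarrow>\<^sub>M count_space (Collect finite)"
  shows "measure M {\<omega> \<in> space M. P (X \<omega>)} = (\<integral>\<omega>. of_bool (P (X \<omega>)) \<partial>M)"
proof -
  interpret prob_space M by fact
  have "(\<integral>\<omega>. of_bool (P (X \<omega>)) \<partial>M) = (\<integral>\<omega>. indicator {\<omega> \<in> space M. P (X \<omega>)} \<omega> \<partial>M)"
    by (rule Bochner_Integration.integral_cong) (auto simp: indicator_def)
  also have "\<dots> = measure M {\<omega> \<in> space M. P (X \<omega>)}"
    using sets_Collect_set_fun[OF assms(2), of P] by (simp add: Int_absorb2 sets.sets_into_space)
  finally show ?thesis by simp
qed

lemma borel_of_bool:
  assumes "X \<in> M \<rightarrow>\<^sub>M count_space (Collect finite)"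
  shows "(\<lambda>\<omega>. of_bool (P (X \<omega>)) :: real) \<in> borel_measurable M"
  by (rule measurable_compose[OF assms]) simp

lemma sdiff_bound:
  assumes "A \<subseteq> W" "B \<subseteq> W" "finite W"
  shows "sdiff A B \<le> real (card W)"
  unfolding sdiff_def using assms by (intro of_nat_mono card_mono) auto

lemma ubox_Un: "x \<in> ubox (V1 \<union> V2) \<longleftrightarrow> x \<in> ubox V1 \<and> x \<in> ubox V2"
  by (auto simp: ubox_def)

section \<open>Joining schemes on two disjoint sets\<close>

definition join :: "('w1 \<Rightarrow> (nat \<Rightarrow> real) \<Rightarrow> int \<Rightarrow> nat set) \<Rightarrow> nat set \<Rightarrow>
    ('w2 \<Rightarrow> (nat \<Rightarrow> real) \<Rightarrow> int \<Rightarrow> nat set) \<Rightarrow> nat set \<Rightarrow>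
    real \<times> 'w1 \<times> 'w2 \<Rightarrow> (nat \<Rightarrow> real) \<Rightarrow> int \<Rightarrow> nat set" where
  "join a1 V1 a2 V2 z x j = a1 (fst (snd z)) x (split_level (sum x V1) (sum x V2) j (fst z)) \<union>
     a2 (snd (snd z)) x (j - split_level (sum x V1) (sum x V2) j (fst z))"

context
  fixes M1 :: "'w1 measure" and a1 V1 and M2 :: "'w2 measure" and a2 V2
  assumes S1: "scheme M1 a1 V1" and S2: "scheme M2 a2 V2"
    and V: "finite V1" "finite V2" "V1 \<inter> V2 = {}"
begin

interpretation M1: prob_space M1 by (rule schemeD(1)[OF S1])
interpretation M2: prob_space M2 by (rule schemeD(1)[OF S2])
interpretation U: prob_space unif by (rule prob_space_unif)
interpretation M12: pair_prob_space M1 M2 ..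
interpretation J: pair_prob_space unif "M1 \<Otimes>\<^sub>M M2" ..

abbreviation (input) "join_M \<equiv> unif \<Otimes>\<^sub>M (M1 \<Otimes>\<^sub>M M2)"
abbreviation (input) "ja \<equiv> join a1 V1 a2 V2"

lemma measurable_part1: "(\<lambda>z. a1 (fst (snd z)) x (split_level l r j (fst z))) \<in> join_M \<rightarrow>\<^sub>M count_space (Collect finite)"
  by (rule measurable_compose_countable[where f="\<lambda>k z. a1 (fst (snd z)) x k" and g="\<lambda>z. split_level l r j (fst z)"])
    (rule measurable_compose[OF measurable_snd] measurable_compose[OF measurable_fst]
      schemeD(2)[OF S1] measurable_split_level)+

lemma measurable_part2: "(\<lambda>z. a2 (snd (snd z)) x (j - split_level l r j (fst z))) \<in> join_M \<rightarrow>\<^sub>M count_space (Collect finite)"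
  by (rule measurable_compose_countable[where f="\<lambda>k z. a2 (snd (snd z)) x (j - k)" and g="\<lambda>z. split_level l r j (fst z)"])
    (rule measurable_compose[OF measurable_snd] measurable_compose[OF measurable_fst]
      schemeD(2)[OF S2] measurable_split_level)+

lemma measurable_join: "(\<lambda>z. ja z x j) \<in> join_M \<rightarrow>\<^sub>M count_space (Collect finite)"
  unfolding join_def
  by (rule measurable_set_fun2[OF measurable_part1 measurable_part2, where f="(\<union>)"]) simp

lemma sum_V: "sum (x :: nat \<Rightarrow> real) (V1 \<union> V2) = sum x V1 + sum x V2"
  using V by (simp add: sum.union_disjoint)

abbreviation (input) "lev x j z \<equiv> split_level (sum x V1) (sum x V2) j (fst z)"

lemma join_parts:
  assumes z: "z \<in> space join_M" and x: "x \<in> ubox (V1 \<union> V2)" and j: "\<bar>sum x (V1 \<union> V2) - of_int j\<bar> < 1"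
  shows "a1 (fst (snd z)) x (lev x j z) \<in> layer V1 (lev x j z)"
    "a2 (snd (snd z)) x (j - lev x j z) \<in> layer V2 (j - lev x j z)"
proof -
  have u: "0 \<le> fst z" "fst z < 1" using z by (auto simp: space_pair_measure space_unif)
  have w: "fst (snd z) \<in> space M1" "snd (snd z) \<in> space M2" using z by (auto simp: space_pair_measure)
  note v = split_level_valid[OF j[unfolded sum_V] u]
  show "a1 (fst (snd z)) x (lev x j z) \<in> layer V1 (lev x j z)"
    by (rule schemeD(4)[OF S1 w(1) _ v(1)]) (use x ubox_Un in blast)
  show "a2 (snd (snd z)) x (j - lev x j z) \<in> layer V2 (j - lev x j z)"
    by (rule schemeD(4)[OF S2 w(2) _ v(2)]) (use x ubox_Un in blast)
qed

lemma join_layer: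
  assumes z: "z \<in> space join_M" and x: "x \<in> ubox (V1 \<union> V2)" and j: "\<bar>sum x (V1 \<union> V2) - of_int j\<bar> < 1"
  shows "ja z x j \<in> layer (V1 \<union> V2) j"
proof -
  note p = join_parts[OF assms]
  have "finite (a1 (fst (snd z)) x (lev x j z))"
    "finite (a2 (snd (snd z)) x (j - lev x j z))"
    using p V by (auto simp: layer_def intro: finite_subset)
  then have "card (ja z x j) = card (a1 (fst (snd z)) x (lev x j z)) +
     card (a2 (snd (snd z)) x (j - lev x j z))"
    unfolding join_def using p V by (intro card_Un_disjoint) (auto simp: layer_def)
  then show ?thesis using p by (auto simp: layer_def join_def)
qed

lemma proj_fst: "fst \<in> M1 \<Otimes>\<^sub>M M2 \<rightarrow>\<^sub>M M1" "distr (M1 \<Otimes>\<^sub>M M2) M1 fst = M1"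
  by (simp_all add: M2.distr_pair_fst)

lemma proj_snd: "snd \<in> M1 \<Otimes>\<^sub>M M2 \<rightarrow>\<^sub>M M2" "distr (M1 \<Otimes>\<^sub>M M2) M2 snd = M2"
  using distr_pair_snd[of M1 M2] M1.prob_space_axioms M2.sigma_finite_measure_axioms by simp_all

text \<open>A coordinate can only be selected by the child that contains it, and the count of that
  child has the law for which its own marginal condition is stated.\<close>

lemma join_marginal:
  assumes x: "x \<in> ubox (V1 \<union> V2)" and i: "i \<in> V1 \<union> V2"
  shows "interp (\<lambda>j. measure join_M {z \<in> space join_M. i \<in> ja z x j}) (sum x (V1 \<union> V2)) = x i"
proof (cases "i \<in> V1")
  case True
  let ?N = "split_level (sum x V1) (sum x V2)"
  let ?q = "\<lambda>k. measure M1 {\<omega> \<in> space M1. i \<in> a1 \<omega> x k}"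
  have "measure join_M {z \<in> space join_M. i \<in> ja z x j} = (\<integral>u. ?q (?N j u) \<partial>unif)"
    if j: "\<bar>sum x (V1 \<union> V2) - of_int j\<bar> < 1" for j
  proof -
    have "{z \<in> space join_M. i \<in> ja z x j} = {z \<in> space join_M. i \<in> a1 (fst (snd z)) x (?N j (fst z))}"
      using join_parts(2)[OF _ x j] True V by (fastforce simp: join_def layer_def)
    then have "measure join_M {z \<in> space join_M. i \<in> ja z x j} =
      (\<integral>z. of_bool (i \<in> a1 (fst (snd z)) x (?N j (fst z))) \<partial>join_M)"
      using prob_integral[OF J.prob_space_axioms measurable_part1, of "\<lambda>S. i \<in> S"] by simp
    also have "\<dots> = (\<integral>u. \<integral>w. of_bool (i \<in> a1 w x (?N j u)) \<partial>M1 \<partial>unif)"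
      by (rule integral_coin_proj(2)[OF prob_space_unif M12.prob_space_axioms M1.prob_space_axioms proj_fst measurable_split_level,
            where F="\<lambda>k w. of_bool (i \<in> a1 w x k)" and B=1])
        (auto intro: borel_of_bool[OF schemeD(2)[OF S1]])
    finally show ?thesis
      using prob_integral[OF M1.prob_space_axioms schemeD(2)[OF S1], of "\<lambda>S. i \<in> S"] by simp
  qed
  then have "interp (\<lambda>j. measure join_M {z \<in> space join_M. i \<in> ja z x j}) (sum x (V1 \<union> V2)) =
    interp (\<lambda>j. \<integral>u. ?q (?N j u) \<partial>unif) (sum x (V1 \<union> V2))" by (rule interp_cong)
  also have "\<dots> = interp ?q (sum x V1)" unfolding sum_V by (rule interp_split_level_left)
  also have "\<dots> = x i" by (rule schemeD(5)[OF S1]) (use x ubox_Un True in auto)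
  finally show ?thesis .
next
  case False
  then have i2: "i \<in> V2" using i by simp
  let ?N = "split_level (sum x V1) (sum x V2)"
  let ?q = "\<lambda>k. measure M2 {\<omega> \<in> space M2. i \<in> a2 \<omega> x k}"
  have "measure join_M {z \<in> space join_M. i \<in> ja z x j} = (\<integral>u. ?q (j - ?N j u) \<partial>unif)"
    if j: "\<bar>sum x (V1 \<union> V2) - of_int j\<bar> < 1" for j
  proof -
    have "{z \<in> space join_M. i \<in> ja z x j} = {z \<in> space join_M. i \<in> a2 (snd (snd z)) x (j - ?N j (fst z))}"
      using join_parts(1)[OF _ x j] False V by (fastforce simp: join_def layer_def)
    then have "measure join_M {z \<in> space join_M. i \<in> ja z x j} =
      (\<integral>z. of_bool (i \<in> a2 (snd (snd z)) x (j - ?N j (fst z))) \<partial>join_M)"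
      using prob_integral[OF J.prob_space_axioms measurable_part2, of "\<lambda>S. i \<in> S"] by simp
    also have "\<dots> = (\<integral>u. \<integral>w. of_bool (i \<in> a2 w x (j - ?N j u)) \<partial>M2 \<partial>unif)"
      by (rule integral_coin_proj(2)[OF prob_space_unif M12.prob_space_axioms M2.prob_space_axioms proj_snd measurable_split_level,
            where F="\<lambda>k w. of_bool (i \<in> a2 w x (j - k))" and B=1])
        (auto intro: borel_of_bool[OF schemeD(2)[OF S2]])
    finally show ?thesis
      using prob_integral[OF M2.prob_space_axioms schemeD(2)[OF S2], of "\<lambda>S. i \<in> S"] by simp
  qed
  then have "interp (\<lambda>j. measure join_M {z \<in> space join_M. i \<in> ja z x j}) (sum x (V1 \<union> V2)) =
    interp (\<lambda>j. \<integral>u. ?q (j - ?N j u) \<partial>unif) (sum x (V1 \<union> V2))" by (rule interp_cong)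
  also have "\<dots> = interp ?q (sum x V2)" unfolding sum_V by (rule interp_split_level_right)
  also have "\<dots> = x i" by (rule schemeD(5)[OF S2]) (use x ubox_Un i2 in auto)
  finally show ?thesis .
qed

lemma scheme_join: "scheme join_M ja (V1 \<union> V2)"
proof -
  have "ja z x j \<subseteq> V1 \<union> V2" if "z \<in> space join_M" for z x j
    using that schemeD(3)[OF S1] schemeD(3)[OF S2] unfolding join_def space_pair_measure by fastforce
  then show ?thesis
    unfolding scheme_def using J.prob_space_axioms measurable_join join_layer join_marginal by blast
qed

text \<open>The bound \<open>g\<close> for differing counts does not grow, because a difference is
  passed to a single child. A switch at equal counts makes both children differ and costs
  \<open>2 * g\<close>, with averaged probability at most twice the distance; this is the increment
  \<open>4 * g\<close>. The costs of the children are averaged over their own counts and their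
  distances add up to \<open>dist1\<close> of the union, so \<open>K\<close> is not doubled and
  grows linearly with the depth.\<close>

lemma stable_join:
  assumes L1: "stable M1 a1 V1 K g x y" and L2: "stable M2 a2 V2 K g x y" and g: "0 \<le> g"
    and x: "x \<in> ubox (V1 \<union> V2)" and y: "y \<in> ubox (V1 \<union> V2)" and al: "aligned (V1 \<union> V2) x y"
  shows "stable join_M ja (V1 \<union> V2) (K + 4 * g) g x y"
proof -
  let ?V = "V1 \<union> V2"
  obtain c :: int where c: "of_int c \<le> sum x V1" "sum x V1 \<le> of_int c + 1" "of_int c \<le> sum y V1" "sum y V1 \<le> of_int c + 1"
    using al unfolding aligned_def by (meson Un_upper1)
  obtain d :: int where d: "of_int d \<le> sum x V2" "sum x V2 \<le> of_int d + 1" "of_int d \<le> sum y V2" "sum y V2 \<le> of_int d + 1"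
    using al unfolding aligned_def by (meson Un_upper2)
  obtain e :: int where "of_int e \<le> sum x ?V" "sum x ?V \<le> of_int e + 1" "of_int e \<le> sum y ?V" "sum y ?V \<le> of_int e + 1"
    using al unfolding aligned_def by (meson subset_refl)
  note e = this[unfolded sum_V]
  obtain \<phi>1 where p1: "\<And>j. 0 \<le> \<phi>1 j" "interp \<phi>1 (sum x V1) \<le> K * dist1 V1 x y"
    "\<And>j j'. \<bar>sum x V1 - of_int j\<bar> < 1 \<Longrightarrow> \<bar>sum y V1 - of_int j'\<bar> < 1 \<Longrightarrow>
        (\<integral>\<omega>. sdiff (a1 \<omega> x j) (a1 \<omega> y j') \<partial>M1) \<le> g * of_bool (j \<noteq> j') + \<phi>1 j"
    using L1 unfolding stable_def by blast
  obtain \<phi>2 where p2: "\<And>j. 0 \<le> \<phi>2 j" "interp \<phi>2 (sum x V2) \<le> K * dist1 V2 x y"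
    "\<And>j j'. \<bar>sum x V2 - of_int j\<bar> < 1 \<Longrightarrow> \<bar>sum y V2 - of_int j'\<bar> < 1 \<Longrightarrow>
        (\<integral>\<omega>. sdiff (a2 \<omega> x j) (a2 \<omega> y j') \<partial>M2) \<le> g * of_bool (j \<noteq> j') + \<phi>2 j"
    using L2 unfolding stable_def by blast
  define N N' where "N = split_level (sum x V1) (sum x V2)" and "N' = split_level (sum y V1) (sum y V2)"
  define sw where "sw = swap_prob (sum x V1) (sum x V2) (sum y V1) (sum y V2)"
  define \<phi> where "\<phi> j = (\<integral>u. \<phi>1 (N j u) \<partial>unif) + (\<integral>u. \<phi>2 (j - N j u) \<partial>unif) + 2 * g * sw j" for j
  have sw0: "0 \<le> sw j" for j unfolding sw_def swap_prob_def by (auto intro!: integral_nonneg_AE)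
  have int: "integrable unif (\<lambda>u. F (N j u) (N' j' u) :: real)" for F j j'
    unfolding N_def N'_def by (rule integrable_split_level_pair)
  have dist: "dist1 ?V x y = dist1 V1 x y + dist1 V2 x y"
    unfolding dist1_def using V by (simp add: sum.union_disjoint)
  have "interp \<phi> (sum x ?V) = interp \<phi>1 (sum x V1) + interp \<phi>2 (sum x V2) + 2 * g * interp sw (sum x V1 + sum x V2)"
    unfolding \<phi>_def sum_V interp_add N_def interp_split_level_left interp_split_level_right interp_mult ..
  also have "\<dots> \<le> K * dist1 V1 x y + K * dist1 V2 x y + 2 * g * (2 * dist1 ?V x y)"
  proof (intro add_mono mult_left_mono p1 p2)
    have "interp sw (sum x V1 + sum x V2) \<le> 2 * (\<bar>sum x V1 - sum y V1\<bar> + \<bar>sum x V2 - sum y V2\<bar>)"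
      unfolding sw_def by (rule interp_swap_prob[OF c d e])
    also have "\<dots> \<le> 2 * dist1 ?V x y"
      unfolding dist by (intro mult_left_mono add_mono abs_sum_diff_le_dist1) auto
    finally show "interp sw (sum x V1 + sum x V2) \<le> 2 * dist1 ?V x y" .
  qed (use g in auto)
  also have "\<dots> = (K + 4 * g) * dist1 ?V x y" unfolding dist by (simp add: algebra_simps)
  finally have 1: "interp \<phi> (sum x ?V) \<le> (K + 4 * g) * dist1 ?V x y" .
  have 2: "0 \<le> \<phi> j" for j
    unfolding \<phi>_def using g sw0 p1(1) p2(1) by (intro add_nonneg_nonneg mult_nonneg_nonneg integral_nonneg_AE) auto
  have 3: "(\<integral>z. sdiff (ja z x j) (ja z y j') \<partial>join_M) \<le> g * of_bool (j \<noteq> j') + \<phi> j"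
    if j: "\<bar>sum x ?V - of_int j\<bar> < 1" "\<bar>sum y ?V - of_int j'\<bar> < 1" for j j'
  proof -
    let ?F1 = "\<lambda>k w. sdiff (a1 w x (fst k)) (a1 w y (snd k))"
    let ?F2 = "\<lambda>k w. sdiff (a2 w x (j - fst k)) (a2 w y (j' - snd k))"
    let ?G = "\<lambda>u. (N j u, N' j' u)"
    have G: "?G \<in> unif \<rightarrow>\<^sub>M count_space UNIV" unfolding N_def N'_def by (rule measurable_split_level_pair)
    have bF1: "\<bar>?F1 k w\<bar> \<le> real (card V1)" if "w \<in> space M1" for k w
      using sdiff_bound[of "a1 w x (fst k)" V1 "a1 w y (snd k)"] schemeD(3)[OF S1 that] V by simp
    have mF1: "?F1 k \<in> borel_measurable M1" for k
      by (rule measurable_set_fun2[OF schemeD(2)[OF S1] schemeD(2)[OF S1], where f=sdiff]) simp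
    have bF2: "\<bar>?F2 k w\<bar> \<le> real (card V2)" if "w \<in> space M2" for k w
      using sdiff_bound[of "a2 w x (j - fst k)" V2 "a2 w y (j' - snd k)"] schemeD(3)[OF S2 that] V by simp
    have mF2: "?F2 k \<in> borel_measurable M2" for k
      by (rule measurable_set_fun2[OF schemeD(2)[OF S2] schemeD(2)[OF S2], where f=sdiff]) simp
    note I1 = integral_coin_proj[OF prob_space_unif M12.prob_space_axioms M1.prob_space_axioms proj_fst G, of ?F1, OF mF1 bF1]
    note I2 = integral_coin_proj[OF prob_space_unif M12.prob_space_axioms M2.prob_space_axioms proj_snd G, of ?F2, OF mF2 bF2]
    have fin: "finite (ja z w k)" if "z \<in> space join_M" for z w k
      using measurable_space[OF measurable_join that] by auto
    have "(\<integral>z. sdiff (ja z x j) (ja z y j') \<partial>join_M) \<le>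
      (\<integral>z. ?F1 (?G (fst z)) (fst (snd z)) + ?F2 (?G (fst z)) (snd (snd z)) \<partial>join_M)"
    proof (rule integral_mono)
      show "integrable join_M (\<lambda>z. sdiff (ja z x j) (ja z y j'))"
      proof (rule J.integrable_const_bound[where B="real (card ?V)"])
        show "AE z in join_M. norm (sdiff (ja z x j) (ja z y j')) \<le> real (card ?V)"
          using sdiff_bound[of "ja _ x j" ?V "ja _ y j'"] schemeD(3)[OF scheme_join] V by (intro AE_I2) auto
        show "(\<lambda>z. sdiff (ja z x j) (ja z y j')) \<in> borel_measurable join_M"
          by (rule measurable_set_fun2[OF measurable_join measurable_join, where f=sdiff]) simp
      qed
      show "integrable join_M (\<lambda>z. ?F1 (?G (fst z)) (fst (snd z)) + ?F2 (?G (fst z)) (snd (snd z)))"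
        by (intro Bochner_Integration.integrable_add I1(1) I2(1))
      fix z assume z: "z \<in> space join_M"
      then show "sdiff (ja z x j) (ja z y j') \<le> ?F1 (?G (fst z)) (fst (snd z)) + ?F2 (?G (fst z)) (snd (snd z))"
        using fin[OF z, of x j] fin[OF z, of y j'] unfolding join_def N_def N'_def fst_conv snd_conv
        by (intro sdiff_Un_le) auto
    qed
    also have "\<dots> = (\<integral>z. ?F1 (?G (fst z)) (fst (snd z)) \<partial>join_M) + (\<integral>z. ?F2 (?G (fst z)) (snd (snd z)) \<partial>join_M)"
      by (rule Bochner_Integration.integral_add[OF I1(1) I2(1)])
    also have "\<dots> = (\<integral>u. \<integral>w. ?F1 (?G u) w \<partial>M1 \<partial>unif) + (\<integral>u. \<integral>w. ?F2 (?G u) w \<partial>M2 \<partial>unif)"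
      by (rule arg_cong2[where f="(+)", OF I1(2) I2(2)])
    also have "\<dots> \<le> (\<integral>u. g * of_bool (N j u \<noteq> N' j' u) + \<phi>1 (N j u) \<partial>unif) +
      (\<integral>u. g * of_bool (j - N j u \<noteq> j' - N' j' u) + \<phi>2 (j - N j u) \<partial>unif)"
    proof (rule add_mono; rule integral_mono)
      fix u assume "u \<in> space unif"
      then have u: "0 \<le> u" "u < 1" by (auto simp: space_unif)
      note vx = split_level_valid[OF j(1)[unfolded sum_V] u, folded N_def]
      note vy = split_level_valid[OF j(2)[unfolded sum_V] u, folded N'_def]
      show "(\<integral>w. ?F1 (?G u) w \<partial>M1) \<le> g * of_bool (N j u \<noteq> N' j' u) + \<phi>1 (N j u)"
        using p1(3)[OF vx(1) vy(1)] by simp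
      show "(\<integral>w. ?F2 (?G u) w \<partial>M2) \<le> g * of_bool (j - N j u \<noteq> j' - N' j' u) + \<phi>2 (j - N j u)"
        using p2(3)[OF vx(2) vy(2)] by simp
    next
      show "integrable unif (\<lambda>u. \<integral>w. ?F1 (?G u) w \<partial>M1)"
        using int[of "\<lambda>a b. \<integral>w. ?F1 (a, b) w \<partial>M1"] by simp
      show "integrable unif (\<lambda>u. \<integral>w. ?F2 (?G u) w \<partial>M2)"
        using int[of "\<lambda>a b. \<integral>w. ?F2 (a, b) w \<partial>M2"] by simp
      show "integrable unif (\<lambda>u. g * of_bool (N j u \<noteq> N' j' u) + \<phi>1 (N j u))"
        by (rule int)
      show "integrable unif (\<lambda>u. g * of_bool (j - N j u \<noteq> j' - N' j' u) + \<phi>2 (j - N j u))"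
        by (rule int)
    qed
    also have "\<dots> = (\<integral>u. \<phi>1 (N j u) \<partial>unif) + (\<integral>u. \<phi>2 (j - N j u) \<partial>unif) +
      g * (\<integral>u. of_bool (N j u \<noteq> N' j' u) + of_bool (j - N j u \<noteq> j' - N' j' u) \<partial>unif)"
    proof -
      have i: "integrable unif (\<lambda>u. of_bool (N j u \<noteq> N' j' u) :: real)"
        "integrable unif (\<lambda>u. of_bool (j - N j u \<noteq> j' - N' j' u) :: real)"
        "integrable unif (\<lambda>u. \<phi>1 (N j u))" "integrable unif (\<lambda>u. \<phi>2 (j - N j u))" by (rule int)+
      show ?thesis
        by (subst Bochner_Integration.integral_add, (use i in simp), (use i in simp))+ (simp add: algebra_simps)
    qed
    also have "\<dots> \<le> (\<integral>u. \<phi>1 (N j u) \<partial>unif) + (\<integral>u. \<phi>2 (j - N j u) \<partial>unif) +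
      g * (of_bool (j \<noteq> j') + 2 * sw j)"
    proof (intro add_left_mono mult_left_mono g)
      have "(\<integral>u. of_bool (N j u \<noteq> N' j' u) + of_bool (j - N j u \<noteq> j' - N' j' u) \<partial>unif) \<le>
        (\<integral>u. (of_bool (j \<noteq> j') :: real) + 2 * of_bool (j = j' \<and> N j u \<noteq> N' j u) \<partial>unif)"
      proof (rule integral_mono)
        show "integrable unif (\<lambda>u. of_bool (N j u \<noteq> N' j' u) + of_bool (j - N j u \<noteq> j' - N' j' u) :: real)" by (rule int)
        show "integrable unif (\<lambda>u. of_bool (j \<noteq> j') + 2 * of_bool (j = j' \<and> N j u \<noteq> N' j u) :: real)" by (rule int)
        fix u assume "u \<in> space unif"
        from split_level_diff[OF c d e j[unfolded sum_V] this]
        show "of_bool (N j u \<noteq> N' j' u) + of_bool (j - N j u \<noteq> j' - N' j' u) \<le>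
          (of_bool (j \<noteq> j') + 2 * of_bool (j = j' \<and> N j u \<noteq> N' j u) :: real)"
          unfolding N_def N'_def .
      qed
      also have "\<dots> \<le> of_bool (j \<noteq> j') + 2 * sw j"
      proof (cases "j = j'")
        case True
        then show ?thesis using j(2) unfolding sw_def swap_prob_def N_def N'_def sum_V by simp
      next
        case False
        then show ?thesis using sw0[of j] by (simp add: U.prob_space)
      qed
      finally show "(\<integral>u. of_bool (N j u \<noteq> N' j' u) + of_bool (j - N j u \<noteq> j' - N' j' u) \<partial>unif) \<le>
        of_bool (j \<noteq> j') + 2 * sw j" .
    qed
    also have "\<dots> = g * of_bool (j \<noteq> j') + \<phi> j" by (simp add: \<phi>_def algebra_simps)
    finally show ?thesis .
  qed
  show ?thesis unfolding stable_def using 1 2 3 by blast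
qed

end

text \<open>Joining changes the type of the sample space; replacing a sample by the map it induces returns to
  a fixed type, as the induction over the depth of the tree requires.\<close>

lemma transfer_scheme:
  fixes M :: "'w measure"
  assumes S: "scheme M a V"
  obtains D :: "((nat \<Rightarrow> real) \<Rightarrow> int \<Rightarrow> nat set) measure" where "scheme D (\<lambda>A. A) V"
    "\<And>K g x y. stable M a V K g x y \<Longrightarrow> stable D (\<lambda>A. A) V K g x y"
proof -
  interpret M: prob_space M by (rule schemeD(1)[OF S])
  let ?C = "count_space (Collect finite) :: nat set measure"
  let ?P = "PiM UNIV (\<lambda>_::nat \<Rightarrow> real. PiM UNIV (\<lambda>_::int. ?C))"
  \<comment> \<open>Restricted to the image of \<open>a\<close>, because the conditions in
    \<open>scheme\<close> on the sets are required at every point of the space, not just almost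
    everywhere.\<close>
  let ?R = "restrict_space ?P (a ` space M)"
  define D where "D = distr M ?R a"
  have "a \<in> M \<rightarrow>\<^sub>M ?P"
  proof (rule measurable_PiM_single')
    fix x :: "nat \<Rightarrow> real"
    show "(\<lambda>\<omega>. a \<omega> x) \<in> M \<rightarrow>\<^sub>M PiM UNIV (\<lambda>_::int. ?C)"
      by (rule measurable_PiM_single')
        (use schemeD(2)[OF S] measurable_space[OF schemeD(2)[OF S]] in auto)
  qed (use measurable_space[OF schemeD(2)[OF S]] in \<open>auto simp: space_PiM\<close>)
  then have am: "a \<in> M \<rightarrow>\<^sub>M ?R" by (intro measurable_restrict_space2) auto
  have em: "(\<lambda>A. A x j) \<in> ?R \<rightarrow>\<^sub>M ?C" for x j
  proof (rule measurable_restrict_space1)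
    have "(\<lambda>A. A x) \<in> ?P \<rightarrow>\<^sub>M PiM UNIV (\<lambda>_::int. ?C)" by (rule measurable_component_singleton) simp
    from measurable_compose[OF this measurable_component_singleton[of j UNIV "\<lambda>_. ?C"]]
    show "(\<lambda>A. A x j) \<in> ?P \<rightarrow>\<^sub>M ?C" by simp
  qed
  have sp: "space D = a ` space M"
    using measurable_space[OF \<open>a \<in> M \<rightarrow>\<^sub>M ?P\<close>] by (auto simp: D_def space_restrict_space)
  have emD: "(\<lambda>A. A x j) \<in> D \<rightarrow>\<^sub>M ?C" for x j using em by (simp add: D_def)
  have meas: "measure D {A \<in> space D. P (A x j)} = measure M {\<omega> \<in> space M. P (a \<omega> x j)}" for P x j
  proof -
    have "measure D {A \<in> space D. P (A x j)} = measure M (a -` {A \<in> space D. P (A x j)} \<inter> space M)"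
      unfolding D_def by (rule measure_distr[OF am]) (use sets_Collect_set_fun[OF em] in simp)
    also have "a -` {A \<in> space D. P (A x j)} \<inter> space M = {\<omega> \<in> space M. P (a \<omega> x j)}" by (auto simp: sp)
    finally show ?thesis .
  qed
  have intg: "(\<integral>A. sdiff (A x j) (A y j') \<partial>D) = (\<integral>\<omega>. sdiff (a \<omega> x j) (a \<omega> y j') \<partial>M)" for x y j j'
    unfolding D_def
    by (rule integral_distr[OF am]) (rule measurable_set_fun2[OF em em, where f=sdiff], simp)
  have "scheme D (\<lambda>A. A) V"
    unfolding scheme_def
  proof (intro conjI)
    show "prob_space D" unfolding D_def by (rule M.prob_space_distr[OF am])
    show "\<forall>x\<in>ubox V. \<forall>i\<in>V. interp (\<lambda>j. measure D {\<omega> \<in> space D. i \<in> \<omega> x j}) (sum x V) = x i"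
      unfolding meas using schemeD(5)[OF S] by blast
  qed (use emD schemeD(3,4)[OF S] sp in auto)
  moreover have "stable D (\<lambda>A. A) V K g x y" if "stable M a V K g x y" for K g x y
    using that unfolding stable_def intg .
  ultimately show thesis by (rule that)
qed

lemma aligned_subset: "aligned V x y \<Longrightarrow> W \<subseteq> V \<Longrightarrow> aligned W x y"
  by (auto simp: aligned_def)

section \<open>The tree, the final rounding and the random hash\<close>

text \<open>The top bit of the hash value separates the children of the root. The measure is chosen
  before \<open>x\<close>, \<open>y\<close> and \<open>B\<close>: the bound on the buckets depends
  on the inputs and enters only the analysis. Each of the \<open>L\<close> levels adds
  \<open>4 * g\<close> with \<open>g = 2 * (B + 1)\<close>, and the leaf gives the quadratic
  term.\<close>

theorem ex_tree_scheme:
  assumes "finite V" "h ` V \<subseteq> {..<2 ^ L}"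
  shows "\<exists>D :: ((nat \<Rightarrow> real) \<Rightarrow> int \<Rightarrow> nat set) measure. scheme D (\<lambda>A. A) V \<and>
    (\<forall>x\<in>ubox V. \<forall>y\<in>ubox V. \<forall>B\<ge>0. aligned V x y \<longrightarrow>
       (\<forall>b::nat. sum x {i\<in>V. h i = b} \<le> B \<and> sum y {i\<in>V. h i = b} \<le> B) \<longrightarrow>
       stable D (\<lambda>A. A) V (12 * (B + 1)\<^sup>2 + 8 * (B + 1) * real L) (2 * (B + 1)) x y)"
  using assms
proof (induction L arbitrary: V h)
  case 0
  then have h: "{i \<in> V. h i = 0} = V" by auto
  obtain c where c: "level_law V c" using ex_level_law[OF 0(1)] by blast
  obtain D :: "((nat \<Rightarrow> real) \<Rightarrow> int \<Rightarrow> nat set) measure" where D: "scheme D (\<lambda>A. A) V"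
    "\<And>K g x y. stable (PiM (Pow V) (\<lambda>_. expo)) (leaf_a V c) V K g x y \<Longrightarrow> stable D (\<lambda>A. A) V K g x y"
    using transfer_scheme[OF scheme_leaf[OF 0(1) c]] by metis
  have "stable D (\<lambda>A. A) V (12 * (B + 1)\<^sup>2 + 8 * (B + 1) * real 0) (2 * (B + 1)) x y"
    if "x \<in> ubox V" "y \<in> ubox V" "aligned V x y" "\<forall>b. sum x {i\<in>V. h i = b} \<le> B \<and> sum y {i\<in>V. h i = b} \<le> B" for x y B
    using D(2)[OF stable_leaf[OF 0(1) c that(1-3), of B]] that(4)[rule_format, of 0] h by simp
  then show ?case using D(1) by blast
next
  case (Suc L)
  define V1 V2 where "V1 = {i \<in> V. h i < 2 ^ L}" and "V2 = {i \<in> V. 2 ^ L \<le> h i}"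
  have V: "finite V1" "finite V2" "V1 \<inter> V2 = {}" "V = V1 \<union> V2"
    using Suc.prems(1) by (auto simp: V1_def V2_def)
  have h1: "h ` V1 \<subseteq> {..<2 ^ L}" by (auto simp: V1_def)
  \<comment> \<open>On \<open>V2\<close> the hash is at least \<open>2 ^ L\<close>, so the
    subtraction on naturals just removes the top bit.\<close>
  have h2: "(\<lambda>i. h i - 2 ^ L) ` V2 \<subseteq> {..<2 ^ L}" using Suc.prems(2) by (force simp: V2_def)
  obtain D1 :: "((nat \<Rightarrow> real) \<Rightarrow> int \<Rightarrow> nat set) measure" where D1: "scheme D1 (\<lambda>A. A) V1"
    "\<And>x y B. x \<in> ubox V1 \<Longrightarrow> y \<in> ubox V1 \<Longrightarrow> 0 \<le> B \<Longrightarrow> aligned V1 x y \<Longrightarrow>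
       (\<And>b. sum x {i\<in>V1. h i = b} \<le> B \<and> sum y {i\<in>V1. h i = b} \<le> B) \<Longrightarrow>
       stable D1 (\<lambda>A. A) V1 (12 * (B + 1)\<^sup>2 + 8 * (B + 1) * real L) (2 * (B + 1)) x y"
    using Suc.IH[OF V(1) h1] by blast
  obtain D2 :: "((nat \<Rightarrow> real) \<Rightarrow> int \<Rightarrow> nat set) measure" where D2: "scheme D2 (\<lambda>A. A) V2"
    "\<And>x y B. x \<in> ubox V2 \<Longrightarrow> y \<in> ubox V2 \<Longrightarrow> 0 \<le> B \<Longrightarrow> aligned V2 x y \<Longrightarrow>
       (\<And>b. sum x {i\<in>V2. h i - 2 ^ L = b} \<le> B \<and> sum y {i\<in>V2. h i - 2 ^ L = b} \<le> B) \<Longrightarrow>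
       stable D2 (\<lambda>A. A) V2 (12 * (B + 1)\<^sup>2 + 8 * (B + 1) * real L) (2 * (B + 1)) x y"
    using Suc.IH[OF V(2) h2] by blast
  note J = scheme_join[OF D1(1) D2(1) V(1-3)]
  obtain D :: "((nat \<Rightarrow> real) \<Rightarrow> int \<Rightarrow> nat set) measure" where D: "scheme D (\<lambda>A. A) (V1 \<union> V2)"
    "\<And>K g x y. stable (unif \<Otimes>\<^sub>M (D1 \<Otimes>\<^sub>M D2)) (join (\<lambda>A. A) V1 (\<lambda>A. A) V2) (V1 \<union> V2) K g x y \<Longrightarrow>
       stable D (\<lambda>A. A) (V1 \<union> V2) K g x y"
    using transfer_scheme[OF J] by metis
  have "stable D (\<lambda>A. A) V (12 * (B + 1)\<^sup>2 + 8 * (B + 1) * real (Suc L)) (2 * (B + 1)) x y"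
    if x: "x \<in> ubox V" and y: "y \<in> ubox V" and B: "0 \<le> B" and al: "aligned V x y"
      and b: "\<And>b. sum x {i\<in>V. h i = b} \<le> B \<and> sum y {i\<in>V. h i = b} \<le> B" for x y B
  proof -
    have e1: "{i\<in>V1. h i = b} = (if b < 2 ^ L then {i\<in>V. h i = b} else {})" for b
      by (auto simp: V1_def)
    have e2: "{i\<in>V2. h i - 2 ^ L = b} = {i\<in>V. h i = b + 2 ^ L}" for b
      by (auto simp: V2_def)
    have box: "x \<in> ubox V1" "x \<in> ubox V2" "y \<in> ubox V1" "y \<in> ubox V2"
      using x y V(4) by (auto simp: ubox_def)
    have al12: "aligned V1 x y" "aligned V2 x y" using aligned_subset[OF al] V(4) by auto
    have "stable D1 (\<lambda>A. A) V1 (12 * (B + 1)\<^sup>2 + 8 * (B + 1) * real L) (2 * (B + 1)) x y"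
      by (rule D1(2)[OF box(1,3) B al12(1)]) (use b B in \<open>simp add: e1\<close>)
    moreover have "stable D2 (\<lambda>A. A) V2 (12 * (B + 1)\<^sup>2 + 8 * (B + 1) * real L) (2 * (B + 1)) x y"
      by (rule D2(2)[OF box(2,4) B al12(2)]) (use b in \<open>simp add: e2\<close>)
    ultimately have "stable D (\<lambda>A. A) (V1 \<union> V2) (12 * (B + 1)\<^sup>2 + 8 * (B + 1) * real L + 4 * (2 * (B + 1))) (2 * (B + 1)) x y"
      by (intro D(2) stable_join[OF D1(1) D2(1) V(1-3)]) (use B x y al V(4) in auto)
    then show ?thesis unfolding V(4)[symmetric] by (simp add: algebra_simps)
  qed
  then show ?case using D(1) unfolding V(4)[symmetric] by blast
qed

text \<open>The required properties over an arbitrary sample space, so that explicit randomness can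
  still be combined before it is pushed forward to a measure on maps.\<close>

definition sampler :: "'w measure \<Rightarrow> ('w \<Rightarrow> (nat \<Rightarrow> real) \<Rightarrow> nat set) \<Rightarrow> nat set \<Rightarrow> bool" where
  "sampler M A V \<longleftrightarrow> prob_space M \<and>
     (\<forall>x. (\<lambda>\<omega>. A \<omega> x) \<in> M \<rightarrow>\<^sub>M count_space (Collect finite)) \<and>
     (\<forall>\<omega>\<in>space M. \<forall>x. A \<omega> x \<subseteq> V) \<and>
     (\<forall>\<omega>\<in>space M. \<forall>x\<in>ubox V. int (card (A \<omega> x)) \<in> {\<lfloor>sum x V\<rfloor>, \<lceil>sum x V\<rceil>}) \<and>
     (\<forall>x\<in>ubox V. \<forall>i\<in>V. measure M {\<omega> \<in> space M. i \<in> A \<omega> x} = x i)"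

section \<open>The count at the root\<close>

lemma floor_shift:
  assumes "of_int c \<le> m" "m \<le> of_int c + 1" "u \<in> space unif"
  shows "\<lfloor>m + u\<rfloor> = (if u < of_int c + 1 - m then c else c + 1)"
proof -
  have "0 \<le> u" "u < 1" using assms(3) by (auto simp: space_unif)
  then show ?thesis using assms by (auto simp: floor_eq_iff)
qed

lemma integral_floor_shift: "(\<integral>u. F \<lfloor>m + u\<rfloor> \<partial>unif) = interp F m"
proof -
  let ?c = "\<lfloor>m\<rfloor>"
  have c: "of_int ?c \<le> m" "m \<le> of_int ?c + 1" by linarith+
  have "(\<integral>u. F \<lfloor>m + u\<rfloor> \<partial>unif) = (\<integral>u. (if u < of_int ?c + 1 - m then F ?c else F (?c + 1)) \<partial>unif)"
    by (rule Bochner_Integration.integral_cong) (auto simp: floor_shift[OF c])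
  also have "\<dots> = interp F m"
    using c by (subst integral_unif_coin) (auto simp: interp_def)
  finally show ?thesis .
qed

lemma measurable_floor_shift: "(\<lambda>u. \<lfloor>m + u\<rfloor>) \<in> unif \<rightarrow>\<^sub>M count_space UNIV"
  unfolding unif_def by (intro measurable_restrict_space1) measurable

lemma measurable_floor_shift_pair:
  "(\<lambda>u. (\<lfloor>m + u\<rfloor>, \<lfloor>m' + u\<rfloor>)) \<in> unif \<rightarrow>\<^sub>M count_space UNIV"
proof -
  have "(\<lambda>u. (\<lfloor>m + u\<rfloor>, \<lfloor>m' + u\<rfloor>)) \<in> unif \<rightarrow>\<^sub>M count_space UNIV \<Otimes>\<^sub>M count_space UNIV"
    by (intro measurable_Pair measurable_floor_shift)
  then show ?thesis by (simp add: pair_measure_countable)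
qed

lemma integrable_floor_shift_pair:
  "integrable unif (\<lambda>u. F \<lfloor>m + u\<rfloor> \<lfloor>m' + u\<rfloor> :: real)"
proof -
  have r: "\<lfloor>m + u\<rfloor> \<in> {\<lfloor>m\<rfloor>, \<lfloor>m\<rfloor> + 1}" if "u \<in> space unif" for m :: real and u
    using floor_shift[of "\<lfloor>m\<rfloor>" m u] that by auto
  have "integrable unif (\<lambda>u. (\<lambda>(a, b). F a b) (\<lfloor>m + u\<rfloor>, \<lfloor>m' + u\<rfloor>))"
    by (rule integrable_finite_range[OF prob_space_unif measurable_floor_shift_pair,
          where R="{\<lfloor>m\<rfloor>, \<lfloor>m\<rfloor> + 1} \<times> {\<lfloor>m'\<rfloor>, \<lfloor>m'\<rfloor> + 1}"]) (use r in auto)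
  then show ?thesis by simp
qed

definition round_final :: "('w \<Rightarrow> (nat \<Rightarrow> real) \<Rightarrow> int \<Rightarrow> nat set) \<Rightarrow> nat set \<Rightarrow> real \<times> 'w \<Rightarrow> (nat \<Rightarrow> real) \<Rightarrow> nat set" where
  "round_final a V z x = a (snd z) x \<lfloor>sum x V + fst z\<rfloor>"

context
  fixes M :: "'w measure" and a V
  assumes S: "scheme M a V" and V: "finite V"
begin

interpretation M: prob_space M by (rule schemeD(1)[OF S])
interpretation U: prob_space unif by (rule prob_space_unif)
interpretation P: pair_prob_space unif M ..

lemma measurable_round_final: "(\<lambda>z. round_final a V z x) \<in> unif \<Otimes>\<^sub>M M \<rightarrow>\<^sub>M count_space (Collect finite)"
  unfolding round_final_def
proof (rule measurable_compose_countable[where f="\<lambda>k z. a (snd z) x k" and g="\<lambda>z. \<lfloor>sum x V + fst z\<rfloor>"])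
  show "(\<lambda>z. a (snd z) x k) \<in> unif \<Otimes>\<^sub>M M \<rightarrow>\<^sub>M count_space (Collect finite)" for k
    by (rule measurable_compose[OF measurable_snd schemeD(2)[OF S]])
  show "(\<lambda>z. \<lfloor>sum x V + fst z\<rfloor>) \<in> unif \<Otimes>\<^sub>M M \<rightarrow>\<^sub>M count_space UNIV"
    by (rule measurable_compose[OF measurable_fst measurable_floor_shift])
qed

lemma floor_shift_valid:
  assumes "u \<in> space unif"
  shows "\<bar>m - of_int \<lfloor>m + u\<rfloor>\<bar> < 1"
proof -
  have "0 \<le> u" "u < 1" using assms by (auto simp: space_unif)
  then show ?thesis by linarith
qed

lemma sampler_round_final: "sampler (unif \<Otimes>\<^sub>M M) (round_final a V) V"
  unfolding sampler_def
proof (intro conjI ballI allI)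
  show "prob_space (unif \<Otimes>\<^sub>M M)" by (rule P.prob_space_axioms)
next
  fix x show "(\<lambda>z. round_final a V z x) \<in> unif \<Otimes>\<^sub>M M \<rightarrow>\<^sub>M count_space (Collect finite)"
    by (rule measurable_round_final)
next
  fix z x assume z: "z \<in> space (unif \<Otimes>\<^sub>M M)"
  then show "round_final a V z x \<subseteq> V"
    unfolding round_final_def by (intro schemeD(3)[OF S]) (auto simp: space_pair_measure)
next
  fix z x assume z: "z \<in> space (unif \<Otimes>\<^sub>M M)" and x: "x \<in> ubox V"
  have u: "fst z \<in> space unif" "snd z \<in> space M" using z by (auto simp: space_pair_measure)
  note v = floor_shift_valid[OF u(1), of "sum x V"]
  have "int (card (round_final a V z x)) = \<lfloor>sum x V + fst z\<rfloor>"
    using schemeD(4)[OF S u(2) x v] by (simp add: round_final_def layer_def)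
  moreover have "\<lfloor>sum x V + fst z\<rfloor> \<in> {\<lfloor>sum x V\<rfloor>, \<lceil>sum x V\<rceil>}"
    using v by (auto simp: abs_less_iff) linarith
  ultimately show "int (card (round_final a V z x)) \<in> {\<lfloor>sum x V\<rfloor>, \<lceil>sum x V\<rceil>}" by simp
next
  fix x i assume x: "x \<in> ubox V" and i: "i \<in> V"
  let ?q = "\<lambda>k. measure M {\<omega> \<in> space M. i \<in> a \<omega> x k}"
  have "measure (unif \<Otimes>\<^sub>M M) {z \<in> space (unif \<Otimes>\<^sub>M M). i \<in> round_final a V z x} =
    (\<integral>z. of_bool (i \<in> a (snd z) x \<lfloor>sum x V + fst z\<rfloor>) \<partial>(unif \<Otimes>\<^sub>M M))"
    using prob_integral[OF P.prob_space_axioms measurable_round_final, of "\<lambda>S. i \<in> S" x]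
    by (simp add: round_final_def)
  also have "\<dots> = (\<integral>u. \<integral>w. of_bool (i \<in> a w x \<lfloor>sum x V + u\<rfloor>) \<partial>M \<partial>unif)"
    by (rule integral_coin_proj(2)[OF prob_space_unif M.prob_space_axioms M.prob_space_axioms measurable_ident_sets[OF refl] distr_id measurable_floor_shift,
          where F="\<lambda>k w. of_bool (i \<in> a w x k)" and B=1])
      (auto intro: borel_of_bool[OF schemeD(2)[OF S]])
  also have "\<dots> = (\<integral>u. ?q \<lfloor>sum x V + u\<rfloor> \<partial>unif)"
    using prob_integral[OF M.prob_space_axioms schemeD(2)[OF S], of "\<lambda>S. i \<in> S"] by simp
  also have "\<dots> = interp ?q (sum x V)" by (rule integral_floor_shift)
  also have "\<dots> = x i" by (rule schemeD(5)[OF S x i])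
  finally show "measure (unif \<Otimes>\<^sub>M M) {z \<in> space (unif \<Otimes>\<^sub>M M). i \<in> round_final a V z x} = x i" .
qed

text \<open>Both root counts use the same coin, so they differ with probability
  \<open>\<bar>sum x V - sum y V\<bar>\<close>, at cost \<open>g\<close> each time; the remaining
  cost is the average of \<open>\<phi>\<close> over the law of the root count.\<close>

lemma sdiff_round_final:
  assumes L: "stable M a V K g x y" and g: "0 \<le> g" and x: "x \<in> ubox V" and y: "y \<in> ubox V"
    and al: "aligned V x y"
  shows "(\<integral>z. sdiff (round_final a V z x) (round_final a V z y) \<partial>(unif \<Otimes>\<^sub>M M)) \<le> (K + g) * dist1 V x y"
proof -
  obtain c :: int where c: "of_int c \<le> sum x V" "sum x V \<le> of_int c + 1" "of_int c \<le> sum y V" "sum y V \<le> of_int c + 1"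
    using al unfolding aligned_def by blast
  obtain \<phi> where p: "\<And>j. 0 \<le> \<phi> j" "interp \<phi> (sum x V) \<le> K * dist1 V x y"
    "\<And>j j'. \<bar>sum x V - of_int j\<bar> < 1 \<Longrightarrow> \<bar>sum y V - of_int j'\<bar> < 1 \<Longrightarrow>
        (\<integral>\<omega>. sdiff (a \<omega> x j) (a \<omega> y j') \<partial>M) \<le> g * of_bool (j \<noteq> j') + \<phi> j"
    using L unfolding stable_def by blast
  let ?F = "\<lambda>k w. sdiff (a w x (fst k)) (a w y (snd k))"
  let ?G = "\<lambda>u. (\<lfloor>sum x V + u\<rfloor>, \<lfloor>sum y V + u\<rfloor>)"
  have bF: "\<bar>?F k w\<bar> \<le> real (card V)" if "w \<in> space M" for k w
    using sdiff_bound[of "a w x (fst k)" V "a w y (snd k)"] schemeD(3)[OF S that] V by simp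
  have mF: "?F k \<in> borel_measurable M" for k
    by (rule measurable_set_fun2[OF schemeD(2)[OF S] schemeD(2)[OF S], where f=sdiff]) simp
  have "(\<integral>z. sdiff (round_final a V z x) (round_final a V z y) \<partial>(unif \<Otimes>\<^sub>M M)) =
      (\<integral>z. ?F (?G (fst z)) (snd z) \<partial>(unif \<Otimes>\<^sub>M M))"
    by (simp add: round_final_def)
  also have "\<dots> = (\<integral>u. \<integral>w. ?F (?G u) w \<partial>M \<partial>unif)"
    using integral_coin_proj(2)[OF prob_space_unif M.prob_space_axioms M.prob_space_axioms measurable_ident_sets[OF refl] distr_id
        measurable_floor_shift_pair, of ?F, OF mF bF] by simp
  also have "\<dots> \<le> (\<integral>u. g * of_bool (\<lfloor>sum x V + u\<rfloor> \<noteq> \<lfloor>sum y V + u\<rfloor>) + \<phi> \<lfloor>sum x V + u\<rfloor> \<partial>unif)"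
  proof (rule integral_mono)
    show "integrable unif (\<lambda>u. \<integral>w. ?F (?G u) w \<partial>M)"
      using integrable_floor_shift_pair[of "\<lambda>a b. \<integral>w. ?F (a, b) w \<partial>M"] by simp
    show "integrable unif (\<lambda>u. g * of_bool (\<lfloor>sum x V + u\<rfloor> \<noteq> \<lfloor>sum y V + u\<rfloor>) + \<phi> \<lfloor>sum x V + u\<rfloor>)"
      by (rule integrable_floor_shift_pair)
    fix u assume u: "u \<in> space unif"
    show "(\<integral>w. ?F (?G u) w \<partial>M) \<le> g * of_bool (\<lfloor>sum x V + u\<rfloor> \<noteq> \<lfloor>sum y V + u\<rfloor>) + \<phi> \<lfloor>sum x V + u\<rfloor>"
      using p(3)[OF floor_shift_valid[OF u] floor_shift_valid[OF u]] by simp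
  qed
  also have "\<dots> = (\<integral>u. g * of_bool (\<lfloor>sum x V + u\<rfloor> \<noteq> \<lfloor>sum y V + u\<rfloor>) \<partial>unif) + (\<integral>u. \<phi> \<lfloor>sum x V + u\<rfloor> \<partial>unif)"
    by (rule Bochner_Integration.integral_add) (rule integrable_floor_shift_pair)+
  also have "(\<integral>u. g * of_bool (\<lfloor>sum x V + u\<rfloor> \<noteq> \<lfloor>sum y V + u\<rfloor>) \<partial>unif) =
      g * (\<integral>u. of_bool ((u < of_int c + 1 - sum x V) \<noteq> (u < of_int c + 1 - sum y V)) \<partial>unif)"
    by (subst integral_mult_right_zero[symmetric], rule Bochner_Integration.integral_cong)
      (auto simp: floor_shift[OF c(1,2)] floor_shift[OF c(3,4)])
  also have "\<dots> = g * \<bar>(of_int c + 1 - sum x V) - (of_int c + 1 - sum y V)\<bar>"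
    using c by (subst integral_unif_coin_neq) auto
  also have "\<dots> = g * \<bar>sum x V - sum y V\<bar>" by (simp add: abs_minus_commute)
  also have "(\<integral>u. \<phi> \<lfloor>sum x V + u\<rfloor> \<partial>unif) = interp \<phi> (sum x V)" by (rule integral_floor_shift)
  finally have "(\<integral>z. sdiff (round_final a V z x) (round_final a V z y) \<partial>(unif \<Otimes>\<^sub>M M)) \<le>
    g * \<bar>sum x V - sum y V\<bar> + interp \<phi> (sum x V)" .
  also have "\<dots> \<le> g * dist1 V x y + K * dist1 V x y"
    by (intro add_mono mult_left_mono abs_sum_diff_le_dist1 g p(2))
  finally show ?thesis by (simp add: algebra_simps)
qed

end

section \<open>A random choice among finitely many samplers\<close>

definition mixed :: "('h \<Rightarrow> 'w \<Rightarrow> (nat \<Rightarrow> real) \<Rightarrow> nat set) \<Rightarrow> 'h \<times> ('h \<Rightarrow> 'w) \<Rightarrow> (nat \<Rightarrow> real) \<Rightarrow> nat set" where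
  "mixed A z x = A (fst z) (snd z (fst z)) x"

context
  fixes H :: "'h set" and M :: "'h \<Rightarrow> 'w measure" and A :: "'h \<Rightarrow> 'w \<Rightarrow> (nat \<Rightarrow> real) \<Rightarrow> nat set" and V
  assumes H: "finite H" "H \<noteq> {}" and V: "finite V" and S: "\<And>h. h \<in> H \<Longrightarrow> sampler (M h) (A h) V"
begin

text \<open>The product holds an independent sample for every hash, and \<open>mixed\<close> reads
  only the one belonging to the drawn hash. Thus the hash and the samples are independent although
  the measures \<open>M h\<close> differ.\<close>

abbreviation (input) "mix_M \<equiv> uniform_count_measure H \<Otimes>\<^sub>M PiM H M"

lemma prob_M: "h \<in> H \<Longrightarrow> prob_space (M h)"
  using S by (simp add: sampler_def)

interpretation N: prob_space "uniform_count_measure H" by (rule prob_space_uniform_count_measure[OF H])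
interpretation Q: prob_space "PiM H M" by (intro prob_space_PiM prob_M)
interpretation P: pair_prob_space "uniform_count_measure H" "PiM H M" ..

lemma measurable_mixed: "(\<lambda>z. mixed A z x) \<in> mix_M \<rightarrow>\<^sub>M count_space (Collect finite)"
  unfolding mixed_def
proof (rule measurable_compose_countable'[where f="\<lambda>h z. A h (snd z h) x" and g=fst and I=H])
  fix h assume h: "h \<in> H"
  have "(\<lambda>z. snd z h) \<in> mix_M \<rightarrow>\<^sub>M M h"
    using measurable_compose[OF measurable_snd measurable_component_singleton[OF h]] .
  moreover have "(\<lambda>w. A h w x) \<in> M h \<rightarrow>\<^sub>M count_space (Collect finite)" using S[OF h] by (simp add: sampler_def)
  ultimately show "(\<lambda>z. A h (snd z h) x) \<in> mix_M \<rightarrow>\<^sub>M count_space (Collect finite)" by (rule measurable_compose)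
next
  show "fst \<in> mix_M \<rightarrow>\<^sub>M count_space H"
    using measurable_fst[of "uniform_count_measure H" "PiM H M"]
    by (simp add: measurable_cong_sets[OF refl sets_uniform_count_measure_count_space])
  show "countable H" using H by (simp add: countable_finite)
qed

lemma space_mixD: "z \<in> space mix_M \<Longrightarrow> fst z \<in> H \<and> snd z (fst z) \<in> space (M (fst z))"
  by (auto simp: space_pair_measure space_uniform_count_measure space_PiM)

lemma integral_mixed:
  fixes F :: "nat set \<Rightarrow> nat set \<Rightarrow> real"
  assumes bd: "\<And>S T. S \<subseteq> V \<Longrightarrow> T \<subseteq> V \<Longrightarrow> \<bar>F S T\<bar> \<le> B"
  shows "(\<integral>z. F (mixed A z x) (mixed A z y) \<partial>mix_M) = (\<Sum>h\<in>H. \<integral>w. F (A h w x) (A h w y) \<partial>M h) / real (card H)"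
proof -
  have i: "integrable mix_M (\<lambda>z. F (mixed A z x) (mixed A z y))"
  proof (rule P.integrable_const_bound[where B=B])
    show "AE z in mix_M. norm (F (mixed A z x) (mixed A z y)) \<le> B"
    proof (rule AE_I2)
      fix z assume z: "z \<in> space mix_M"
      then have "mixed A z x \<subseteq> V" "mixed A z y \<subseteq> V" unfolding mixed_def
        using space_mixD[OF z] S[of "fst z"] by (auto simp: sampler_def)
      then show "norm (F (mixed A z x) (mixed A z y)) \<le> B" using bd by simp
    qed
    show "(\<lambda>z. F (mixed A z x) (mixed A z y)) \<in> borel_measurable mix_M"
      by (rule measurable_set_fun2[OF measurable_mixed measurable_mixed, where f=F]) simp
  qed
  have "(\<integral>z. F (mixed A z x) (mixed A z y) \<partial>mix_M) =
      (\<integral>h. \<integral>\<omega>. F (mixed A (h, \<omega>) x) (mixed A (h, \<omega>) y) \<partial>PiM H M \<partial>uniform_count_measure H)"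
    using P.integral_fst'[OF i] by simp
  also have "\<dots> = (\<Sum>h\<in>H. \<integral>\<omega>. F (mixed A (h, \<omega>) x) (mixed A (h, \<omega>) y) \<partial>PiM H M) / real (card H)"
    by (rule integral_uniform_count_measure[OF H(1)])
  also have "(\<Sum>h\<in>H. \<integral>\<omega>. F (mixed A (h, \<omega>) x) (mixed A (h, \<omega>) y) \<partial>PiM H M) = (\<Sum>h\<in>H. \<integral>w. F (A h w x) (A h w y) \<partial>M h)"
  proof (rule sum.cong[OF refl])
    fix h assume h: "h \<in> H"
    have m: "(\<lambda>w. A h w x) \<in> M h \<rightarrow>\<^sub>M count_space (Collect finite)" for x using S[OF h] by (simp add: sampler_def)
    have "(\<integral>w. F (A h w x) (A h w y) \<partial>M h) = (\<integral>w. F (A h w x) (A h w y) \<partial>distr (PiM H M) (M h) (\<lambda>\<omega>. \<omega> h))"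
      by (subst distr_PiM_component[OF prob_M h]) simp_all
    also have "\<dots> = (\<integral>\<omega>. F (A h (\<omega> h) x) (A h (\<omega> h) y) \<partial>PiM H M)"
      by (rule integral_distr[OF measurable_component_singleton[OF h]])
        (rule measurable_set_fun2[OF m m, where f=F], simp)
    finally show "(\<integral>\<omega>. F (mixed A (h, \<omega>) x) (mixed A (h, \<omega>) y) \<partial>PiM H M) = (\<integral>w. F (A h w x) (A h w y) \<partial>M h)"
      by (simp add: mixed_def)
  qed
  finally show ?thesis .
qed

lemma sampler_mixed: "sampler mix_M (mixed A) V"
  unfolding sampler_def
proof (intro conjI ballI allI)
  show "prob_space mix_M" by (rule P.prob_space_axioms)
next
  fix x show "(\<lambda>z. mixed A z x) \<in> mix_M \<rightarrow>\<^sub>M count_space (Collect finite)" by (rule measurable_mixed)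
next
  fix z x assume z: "z \<in> space mix_M"
  show "mixed A z x \<subseteq> V" unfolding mixed_def using space_mixD[OF z] S[of "fst z"] by (simp add: sampler_def)
next
  fix z x assume z: "z \<in> space mix_M" and x: "x \<in> ubox V"
  then show "int (card (mixed A z x)) \<in> {\<lfloor>sum x V\<rfloor>, \<lceil>sum x V\<rceil>}"
    unfolding mixed_def using space_mixD[OF z] S[of "fst z"] unfolding sampler_def by blast
next
  fix x i assume x: "x \<in> ubox V" and i: "i \<in> V"
  have "measure mix_M {z \<in> space mix_M. i \<in> mixed A z x} = (\<integral>z. of_bool (i \<in> mixed A z x) \<partial>mix_M)"
    by (rule prob_integral[OF P.prob_space_axioms measurable_mixed])
  also have "\<dots> = (\<Sum>h\<in>H. \<integral>w. of_bool (i \<in> A h w x) \<partial>M h) / real (card H)"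
    by (rule integral_mixed[where F="\<lambda>S T. of_bool (i \<in> S)" and B=1]) simp
  also have "(\<Sum>h\<in>H. \<integral>w. of_bool (i \<in> A h w x) \<partial>M h) = (\<Sum>h\<in>H. x i)"
  proof (rule sum.cong[OF refl])
    fix h assume h: "h \<in> H"
    have "measure (M h) {w \<in> space (M h). i \<in> A h w x} = (\<integral>w. of_bool (i \<in> A h w x) \<partial>M h)"
      by (rule prob_integral[OF prob_M[OF h]]) (use S[OF h] in \<open>simp add: sampler_def\<close>)
    then show "(\<integral>w. of_bool (i \<in> A h w x) \<partial>M h) = x i" using S[OF h] x i by (simp add: sampler_def)
  qed
  also have "\<dots> / real (card H) = x i" using H by simp
  finally show "measure mix_M {z \<in> space mix_M. i \<in> mixed A z x} = x i" .
qed

end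

section \<open>Collisions of a random hash\<close>

definition collision :: "nat set \<Rightarrow> (nat \<Rightarrow> nat) \<Rightarrow> (nat \<Rightarrow> real) \<Rightarrow> real" where
  "collision V h x = (\<Sum>i\<in>V. \<Sum>j\<in>V - {i}. x i * x j * of_bool (h i = h j))"

lemma collision_nonneg: "x \<in> ubox V \<Longrightarrow> 0 \<le> collision V h x"
  unfolding collision_def ubox_def by (intro sum_nonneg mult_nonneg_nonneg) auto

text \<open>In the expanded square the diagonal is bounded by \<open>x i * x i \<le> x i\<close>,
  and the other pairs collide. The collision term is the same for all buckets, so it controls the
  largest one with no union bound.\<close>

lemma bucket_square_le:
  assumes V: "finite V" and x: "x \<in> ubox V"
  shows "(sum x {i\<in>V. h i = b})\<^sup>2 \<le> sum x {i\<in>V. h i = b} + collision V h x"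
proof -
  let ?W = "{i\<in>V. h i = b}"
  have x01: "0 \<le> x i" "x i \<le> 1" if "i \<in> V" for i using x that by (auto simp: ubox_def)
  have "(sum x ?W)\<^sup>2 = (\<Sum>i\<in>?W. \<Sum>j\<in>?W. x i * x j)"
    by (simp add: power2_eq_square sum_product)
  also have "\<dots> = (\<Sum>i\<in>?W. x i * x i + (\<Sum>j\<in>?W - {i}. x i * x j))"
    using V by (intro sum.cong refl sum.remove) auto
  also have "\<dots> \<le> (\<Sum>i\<in>?W. x i + (\<Sum>j\<in>V - {i}. x i * x j * of_bool (h i = h j)))"
  proof (intro sum_mono add_mono)
    fix i assume i: "i \<in> ?W"
    then show "x i * x i \<le> x i" using x01[of i] mult_left_le[of "x i" "x i"] by simp
    have "(\<Sum>j\<in>?W - {i}. x i * x j) = (\<Sum>j\<in>?W - {i}. x i * x j * of_bool (h i = h j))"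
      using i by (intro sum.cong) auto
    also have "\<dots> \<le> (\<Sum>j\<in>V - {i}. x i * x j * of_bool (h i = h j))"
      using V i x01 by (intro sum_mono2) auto
    finally show "(\<Sum>j\<in>?W - {i}. x i * x j) \<le> (\<Sum>j\<in>V - {i}. x i * x j * of_bool (h i = h j))" .
  qed
  also have "\<dots> = sum x ?W + (\<Sum>i\<in>?W. \<Sum>j\<in>V - {i}. x i * x j * of_bool (h i = h j))"
    by (rule sum.distrib)
  also have "(\<Sum>i\<in>?W. \<Sum>j\<in>V - {i}. x i * x j * of_bool (h i = h j)) \<le> collision V h x"
    unfolding collision_def using V x01 by (intro sum_mono2 sum_nonneg mult_nonneg_nonneg) auto
  finally show ?thesis by simp
qed

text \<open>Choosing the value at \<open>i\<close> afresh in a map with \<open>h i = h j\<close>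
  produces every map exactly once; the old value is recovered from \<open>h j\<close>.\<close>

lemma card_collide:
  assumes V: "finite V" "i \<in> V" "j \<in> V" "i \<noteq> j"
  shows "card {h \<in> V \<rightarrow>\<^sub>E {..<R::nat}. h i = h j} * R = card (V \<rightarrow>\<^sub>E {..<R})"
proof -
  let ?H = "V \<rightarrow>\<^sub>E {..<R}"
  have "bij_betw (\<lambda>(h, c). h(i := c)) ({h \<in> ?H. h i = h j} \<times> {..<R}) ?H"
  proof (rule bij_betw_byWitness[where f'="\<lambda>h. (h(i := h j), h i)"])
    show "\<forall>z\<in>{h \<in> ?H. h i = h j} \<times> {..<R}. (\<lambda>h. (h(i := h j), h i)) ((\<lambda>(h, c). h(i := c)) z) = z"
      using V by (auto simp: fun_eq_iff)
    show "\<forall>h\<in>?H. (\<lambda>(h, c). h(i := c)) ((\<lambda>h. (h(i := h j), h i)) h) = h" by auto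
    show "(\<lambda>(h, c). h(i := c)) ` ({h \<in> ?H. h i = h j} \<times> {..<R}) \<subseteq> ?H"
      using V by (auto simp: PiE_iff extensional_def)
    show "(\<lambda>h. (h(i := h j), h i)) ` ?H \<subseteq> {h \<in> ?H. h i = h j} \<times> {..<R}"
      using V by (auto simp: PiE_iff extensional_def)
  qed
  from bij_betw_same_card[OF this] show ?thesis by (simp add: card_cartesian_product)
qed

text \<open>Each pair collides for a fraction \<open>1 / R\<close> of the maps, so the average is at
  most \<open>(sum x V)\<^sup>2 / R\<close>. This is the reason for at least the square of the mass
  many buckets.\<close>

lemma sum_collision_le:
  assumes V: "finite V" and x: "x \<in> ubox V" and R: "0 < R" "(sum x V)\<^sup>2 \<le> real R"
  shows "(\<Sum>h\<in>V \<rightarrow>\<^sub>E {..<R}. collision V h x) \<le> real (card (V \<rightarrow>\<^sub>E {..<R}))"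
proof -
  let ?H = "V \<rightarrow>\<^sub>E {..<R}"
  have finH: "finite ?H" using V by (intro finite_PiE) auto
  have x0: "0 \<le> x i" if "i \<in> V" for i using x that by (auto simp: ubox_def)
  have col: "(\<Sum>h\<in>?H. of_bool (h i = h j)) = real (card ?H) / real R" if "i \<in> V" "j \<in> V" "i \<noteq> j" for i j
  proof -
    have "(\<Sum>h\<in>?H. of_bool (h i = h j)) = real (card {h \<in> ?H. h i = h j})"
      using finH by (simp add: sum_of_bool_eq Int_def)
    also have "\<dots> = real (card ?H) / real R"
      using R card_collide[OF V that, of R, symmetric] by simp
    finally show ?thesis .
  qed
  have "(\<Sum>h\<in>?H. collision V h x) = (\<Sum>i\<in>V. \<Sum>j\<in>V - {i}. \<Sum>h\<in>?H. x i * x j * of_bool (h i = h j))"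
    unfolding collision_def by (subst sum.swap, intro sum.cong refl, subst sum.swap) rule
  also have "\<dots> = (\<Sum>i\<in>V. \<Sum>j\<in>V - {i}. x i * x j * (real (card ?H) / real R))"
    by (intro sum.cong refl) (simp add: sum_distrib_left[symmetric] col)
  also have "\<dots> \<le> (\<Sum>i\<in>V. \<Sum>j\<in>V. x i * x j * (real (card ?H) / real R))"
    using V x0 by (intro sum_mono sum_mono2 mult_nonneg_nonneg) auto
  also have "\<dots> = (sum x V)\<^sup>2 * (real (card ?H) / real R)"
  proof -
    have "(sum x V)\<^sup>2 = (\<Sum>i\<in>V. \<Sum>j\<in>V. x i * x j)" by (simp add: power2_eq_square sum_product)
    then show ?thesis by (simp only: sum_distrib_right)
  qed
  also have "\<dots> \<le> real R * (real (card ?H) / real R)"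
    using R by (intro mult_right_mono) auto
  finally show ?thesis using R by simp
qed

text \<open>For a fixed hash the cost factor is at most
  \<open>14 * (real L + 1) * (B + 1)\<^sup>2\<close>, where 14 is 12 from the leaves plus 2 from the
  root. With \<open>C\<close> the collisions of both inputs, the square is at most
  \<open>4 + 4 * C\<close>; since \<open>C\<close> has average at most 2, this averages to at most
  12, and 14 times 12 is 168.\<close>

lemma ex_local_sampler:
  assumes V: "finite V" and k: "(real k)\<^sup>2 \<le> 2 ^ L"
  shows "\<exists>(M :: ((nat \<Rightarrow> nat) \<times> ((nat \<Rightarrow> nat) \<Rightarrow> real \<times> ((nat \<Rightarrow> real) \<Rightarrow> int \<Rightarrow> nat set))) measure) A.
    sampler M A V \<and>
    (\<forall>x\<in>ubox V. \<forall>y\<in>ubox V. sum x V \<le> real k \<longrightarrow> sum y V \<le> real k \<longrightarrow> aligned V x y \<longrightarrow>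
       (\<integral>\<omega>. sdiff (A \<omega> x) (A \<omega> y) \<partial>M) \<le> 168 * (real L + 1) * dist1 V x y)"
proof -
  let ?R = "2 ^ L :: nat"
  define H where "H = V \<rightarrow>\<^sub>E {..<?R}"
  have H: "finite H" "H \<noteq> {}" unfolding H_def using V by (auto intro!: finite_PiE simp: PiE_eq_empty_iff lessThan_empty_iff)
  have "\<forall>h\<in>H. \<exists>D :: ((nat \<Rightarrow> real) \<Rightarrow> int \<Rightarrow> nat set) measure. scheme D (\<lambda>A. A) V \<and>
    (\<forall>x\<in>ubox V. \<forall>y\<in>ubox V. \<forall>B\<ge>0. aligned V x y \<longrightarrow>
       (\<forall>b::nat. sum x {i\<in>V. h i = b} \<le> B \<and> sum y {i\<in>V. h i = b} \<le> B) \<longrightarrow>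
       stable D (\<lambda>A. A) V (12 * (B + 1)\<^sup>2 + 8 * (B + 1) * real L) (2 * (B + 1)) x y)"
    by (intro ballI ex_tree_scheme[OF V]) (auto simp: H_def)
  from bchoice[OF this]
  obtain D :: "(nat \<Rightarrow> nat) \<Rightarrow> ((nat \<Rightarrow> real) \<Rightarrow> int \<Rightarrow> nat set) measure"
    where D: "\<And>h. h \<in> H \<Longrightarrow> scheme (D h) (\<lambda>A. A) V"
      and DL: "\<And>h x y B. h \<in> H \<Longrightarrow> x \<in> ubox V \<Longrightarrow> y \<in> ubox V \<Longrightarrow> 0 \<le> B \<Longrightarrow> aligned V x y \<Longrightarrow>
       (\<And>b::nat. sum x {i\<in>V. h i = b} \<le> B \<and> sum y {i\<in>V. h i = b} \<le> B) \<Longrightarrow>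
       stable (D h) (\<lambda>A. A) V (12 * (B + 1)\<^sup>2 + 8 * (B + 1) * real L) (2 * (B + 1)) x y"
    by blast
  let ?M = "\<lambda>h. unif \<Otimes>\<^sub>M D h" and ?A = "\<lambda>h::nat \<Rightarrow> nat. round_final (\<lambda>A::(nat \<Rightarrow> real) \<Rightarrow> int \<Rightarrow> nat set. A) V"
  have S: "sampler (?M h) (?A h) V" if "h \<in> H" for h by (rule sampler_round_final[OF D[OF that] V])
  have "(\<integral>\<omega>. sdiff (mixed ?A \<omega> x) (mixed ?A \<omega> y) \<partial>(uniform_count_measure H \<Otimes>\<^sub>M PiM H ?M)) \<le> 168 * (real L + 1) * dist1 V x y"
    if x: "x \<in> ubox V" "sum x V \<le> real k" and y: "y \<in> ubox V" "sum y V \<le> real k" and al: "aligned V x y" for x y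
  proof -
    have d0: "0 \<le> dist1 V x y" by (simp add: dist1_def sum_nonneg)
    have h: "(\<integral>w. sdiff (?A h w x) (?A h w y) \<partial>?M h) \<le>
        14 * (real L + 1) * (4 + 4 * collision V h x + 4 * collision V h y) * dist1 V x y" if h: "h \<in> H" for h
    proof -
      define C where "C = collision V h x + collision V h y"
      have c0: "0 \<le> collision V h x" "0 \<le> collision V h y" by (intro collision_nonneg x y)+
      \<comment> \<open>For a bucket mass \<open>m\<close> the bounds
        \<open>m\<^sup>2 \<le> m + C\<close> and \<open>2 * m \<le> m\<^sup>2 + 1\<close> give
        \<open>m\<^sup>2 \<le> 1 + 2 * C\<close>.\<close>
      define B where "B = sqrt (1 + 2 * C)"
      have B: "0 \<le> B" "B\<^sup>2 = 1 + 2 * C" using c0 by (auto simp: B_def C_def)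
      have bucket: "sum z {i\<in>V. h i = b} \<le> B" if z: "z \<in> ubox V" "collision V h z \<le> C" for z b
      proof -
        let ?m = "sum z {i\<in>V. h i = b}"
        have "0 \<le> (?m - 1)\<^sup>2" by simp
        then have "2 * ?m \<le> ?m\<^sup>2 + 1" by (simp add: power2_diff)
        then have "?m\<^sup>2 \<le> 1 + 2 * C" using bucket_square_le[OF V z(1), of h b] z(2) by linarith
        then show ?thesis unfolding B_def by (rule real_le_rsqrt)
      qed
      have "stable (D h) (\<lambda>A. A) V (12 * (B + 1)\<^sup>2 + 8 * (B + 1) * real L) (2 * (B + 1)) x y"
        by (rule DL[OF h x(1) y(1) B(1) al]) (use bucket x y c0 in \<open>auto simp: C_def\<close>)
      from sdiff_round_final[OF D[OF h] V this _ x(1) y(1) al] B(1)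
      have "(\<integral>w. sdiff (?A h w x) (?A h w y) \<partial>?M h) \<le> (12 * (B + 1)\<^sup>2 + 8 * (B + 1) * real L + 2 * (B + 1)) * dist1 V x y"
        by simp
      also have "\<dots> \<le> (14 * (real L + 1) * (4 + 4 * C)) * dist1 V x y"
      proof (rule mult_right_mono[OF _ d0])
        have b: "B + 1 \<le> (B + 1)\<^sup>2" using B(1) by (simp add: power2_eq_square)
        have "0 \<le> (B - 1)\<^sup>2" by simp
        then have q: "(B + 1)\<^sup>2 \<le> 4 + 4 * C" using B(2) by (simp add: power2_sum power2_diff)
        have "12 * (B + 1)\<^sup>2 + 8 * (B + 1) * real L + 2 * (B + 1) \<le> 12 * (B + 1)\<^sup>2 + 8 * (B + 1)\<^sup>2 * real L + 2 * (B + 1)\<^sup>2"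
          using b by (intro add_mono mult_right_mono mult_left_mono) auto
        also have "\<dots> \<le> 14 * (real L + 1) * (B + 1)\<^sup>2" by (simp add: algebra_simps)
        also have "\<dots> \<le> 14 * (real L + 1) * (4 + 4 * C)" using q by (intro mult_left_mono) auto
        finally show "12 * (B + 1)\<^sup>2 + 8 * (B + 1) * real L + 2 * (B + 1) \<le> 14 * (real L + 1) * (4 + 4 * C)" .
      qed
      finally show ?thesis by (simp add: C_def algebra_simps)
    qed
    have sq: "(sum z V)\<^sup>2 \<le> real ?R" if "z \<in> ubox V" "sum z V \<le> real k" for z
    proof -
      have "0 \<le> sum z V" using that by (auto simp: ubox_def intro: sum_nonneg)
      then have "(sum z V)\<^sup>2 \<le> (real k)\<^sup>2" using that by (intro power_mono)
      then show ?thesis using k by simp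
    qed
    have "(\<integral>\<omega>. sdiff (mixed ?A \<omega> x) (mixed ?A \<omega> y) \<partial>(uniform_count_measure H \<Otimes>\<^sub>M PiM H ?M)) =
      (\<Sum>h\<in>H. \<integral>w. sdiff (?A h w x) (?A h w y) \<partial>?M h) / real (card H)"
      by (rule integral_mixed[OF H V S, where B="real (card V)"]) (use sdiff_bound V in auto)
    also have "\<dots> \<le> (\<Sum>h\<in>H. 14 * (real L + 1) * (4 + 4 * collision V h x + 4 * collision V h y) * dist1 V x y) / real (card H)"
      by (intro divide_right_mono sum_mono h) auto
    also have "\<dots> = 14 * (real L + 1) * (4 * real (card H) + 4 * (\<Sum>h\<in>H. collision V h x) + 4 * (\<Sum>h\<in>H. collision V h y)) * dist1 V x y / real (card H)"
      by (simp add: sum_distrib_left[symmetric] sum_distrib_right[symmetric] sum.distrib mult.commute)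
    also have "\<dots> \<le> 14 * (real L + 1) * (4 * real (card H) + 4 * real (card H) + 4 * real (card H)) * dist1 V x y / real (card H)"
      unfolding H_def using d0
      by (intro divide_right_mono mult_right_mono mult_left_mono add_mono sum_collision_le V x y sq) auto
    also have "\<dots> = 168 * (real L + 1) * dist1 V x y" using H by (simp add: card_gt_0_iff)
    finally show ?thesis .
  qed
  moreover have "sampler (uniform_count_measure H \<Otimes>\<^sub>M PiM H ?M) (mixed ?A) V"
    by (rule sampler_mixed[OF H V S])
  ultimately show ?thesis by blast
qed

section \<open>From nearby inputs to all inputs\<close>

text \<open>At an integer \<open>v0\<close> the cell depends on the side of \<open>v0\<close> on
  which \<open>v\<close> lies; closed cells make both choices contain \<open>v0\<close>.\<close>

lemma eventually_common_cell:
  "\<forall>\<^sub>F v in nhds (v0::real). \<exists>k::int. of_int k \<le> v0 \<and> v0 \<le> of_int k + 1 \<and> of_int k \<le> v \<and> v \<le> of_int k + 1"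
proof (cases "v0 = of_int \<lfloor>v0\<rfloor>")
  case True
  have "\<exists>k::int. of_int k \<le> v0 \<and> v0 \<le> of_int k + 1 \<and> of_int k \<le> v \<and> v \<le> of_int k + 1" if "dist v v0 < 1" for v
  proof (cases "v0 \<le> v")
    case t: True
    then show ?thesis using True that by (intro exI[of _ "\<lfloor>v0\<rfloor>"]) (auto simp: dist_real_def)
  next
    case False
    then show ?thesis using True that by (intro exI[of _ "\<lfloor>v0\<rfloor> - 1"]) (auto simp: dist_real_def)
  qed
  then show ?thesis unfolding eventually_nhds_metric by (intro exI[of _ 1]) auto
next
  case False
  then have l: "of_int \<lfloor>v0\<rfloor> < v0" "v0 < of_int \<lfloor>v0\<rfloor> + 1" by linarith+
  then have "\<forall>\<^sub>F v in nhds v0. v \<in> {of_int \<lfloor>v0\<rfloor><..<of_int \<lfloor>v0\<rfloor> + 1}"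
    by (intro eventually_nhds_in_open) auto
  then show ?thesis
    by (rule eventually_mono) (use l in \<open>auto intro!: exI[of _ "\<lfloor>v0\<rfloor>"]\<close>)
qed

definition line :: "(nat \<Rightarrow> real) \<Rightarrow> (nat \<Rightarrow> real) \<Rightarrow> real \<Rightarrow> nat \<Rightarrow> real" where
  "line x y t i = x i + t * (y i - x i)"

lemma eventually_aligned_line:
  assumes "finite V"
  shows "\<forall>\<^sub>F s in nhds t. aligned V (line x y t) (line x y s)"
proof -
  have "\<forall>\<^sub>F s in nhds t. \<forall>W\<in>Pow V. \<exists>k::int. of_int k \<le> sum (line x y t) W \<and> sum (line x y t) W \<le> of_int k + 1 \<and>
     of_int k \<le> sum (line x y s) W \<and> sum (line x y s) W \<le> of_int k + 1"
  proof (rule eventually_ball_finite)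
    show "finite (Pow V)" using assms by simp
    show "\<forall>W\<in>Pow V. \<forall>\<^sub>F s in nhds t. \<exists>k::int. of_int k \<le> sum (line x y t) W \<and> sum (line x y t) W \<le> of_int k + 1 \<and>
       of_int k \<le> sum (line x y s) W \<and> sum (line x y s) W \<le> of_int k + 1"
    proof
      fix W assume "W \<in> Pow V"
      have "isCont (\<lambda>s. sum (line x y s) W) t" unfolding line_def by (intro continuous_intros)
      then have "((\<lambda>s. sum (line x y s) W) \<longlongrightarrow> sum (line x y t) W) (nhds t)"
        by (simp add: isCont_def tendsto_nhds_iff)
      from this[unfolded filterlim_def, THEN filter_leD, OF eventually_common_cell]
      show "\<forall>\<^sub>F s in nhds t. \<exists>k::int. of_int k \<le> sum (line x y t) W \<and> sum (line x y t) W \<le> of_int k + 1 \<and>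
       of_int k \<le> sum (line x y s) W \<and> sum (line x y s) W \<le> of_int k + 1"
        by (simp add: eventually_filtermap)
    qed
  qed
  then show ?thesis by (simp add: aligned_def Pow_def)
qed

lemma sdiff_triangle:
  assumes "finite A" "finite B" "finite C"
  shows "sdiff A C \<le> sdiff A B + sdiff B C"
proof -
  have "card (sym_diff A C) \<le> card (sym_diff A B \<union> sym_diff B C)"
    using assms by (intro card_mono) auto
  also have "\<dots> \<le> card (sym_diff A B) + card (sym_diff B C)" by (rule card_Un_le)
  finally show ?thesis by (simp add: sdiff_def)
qed

lemma aligned_commute: "aligned V x y \<Longrightarrow> aligned V y x"
  unfolding aligned_def by blast

lemma dist1_line: "dist1 V (line x y s) (line x y t) = \<bar>t - s\<bar> * dist1 V x y"
proof -
  have "\<bar>line x y s i - line x y t i\<bar> = \<bar>t - s\<bar> * \<bar>x i - y i\<bar>" for i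
  proof -
    have "line x y s i - line x y t i = (t - s) * (x i - y i)" by (simp add: line_def algebra_simps)
    then show ?thesis by (simp add: abs_mult)
  qed
  then show ?thesis by (simp add: dist1_def sum_distrib_left)
qed

text \<open>\<open>dist1\<close> is additive along a segment, so the triangle inequality chains
  local estimates without loss in the constant. \<open>Bolzano\<close> supplies the compactness of
  the unit interval, in the form that an additive property valid on all small intervals around each
  point holds on the whole.\<close>

lemma local_to_global:
  assumes S: "sampler M A V" and V: "finite V"
    and conv: "\<And>t. 0 \<le> t \<Longrightarrow> t \<le> 1 \<Longrightarrow> line x y t \<in> X"
    and loc: "\<And>u v. u \<in> X \<Longrightarrow> v \<in> X \<Longrightarrow> aligned V u v \<Longrightarrow> (\<integral>\<omega>. sdiff (A \<omega> u) (A \<omega> v) \<partial>M) \<le> C * dist1 V u v"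
  shows "(\<integral>\<omega>. sdiff (A \<omega> x) (A \<omega> y) \<partial>M) \<le> C * dist1 V x y"
proof -
  interpret prob_space M using S by (simp add: sampler_def)
  have m: "(\<lambda>\<omega>. A \<omega> u) \<in> M \<rightarrow>\<^sub>M count_space (Collect finite)" for u using S by (simp add: sampler_def)
  have int: "integrable M (\<lambda>\<omega>. sdiff (A \<omega> u) (A \<omega> v))" for u v
  proof (rule integrable_const_bound[where B="real (card V)"])
    show "AE \<omega> in M. norm (sdiff (A \<omega> u) (A \<omega> v)) \<le> real (card V)"
      using S sdiff_bound[OF _ _ V] by (intro AE_I2) (auto simp: sampler_def)
    show "(\<lambda>\<omega>. sdiff (A \<omega> u) (A \<omega> v)) \<in> borel_measurable M"
      by (rule measurable_set_fun2[OF m m, where f=sdiff]) simp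
  qed
  have tri: "(\<integral>\<omega>. sdiff (A \<omega> u) (A \<omega> w) \<partial>M) \<le> (\<integral>\<omega>. sdiff (A \<omega> u) (A \<omega> v) \<partial>M) + (\<integral>\<omega>. sdiff (A \<omega> v) (A \<omega> w) \<partial>M)" for u v w
  proof -
    have "(\<integral>\<omega>. sdiff (A \<omega> u) (A \<omega> w) \<partial>M) \<le> (\<integral>\<omega>. sdiff (A \<omega> u) (A \<omega> v) + sdiff (A \<omega> v) (A \<omega> w) \<partial>M)"
    proof (rule integral_mono[OF int])
      fix \<omega> assume "\<omega> \<in> space M"
      then show "sdiff (A \<omega> u) (A \<omega> w) \<le> sdiff (A \<omega> u) (A \<omega> v) + sdiff (A \<omega> v) (A \<omega> w)"
        using measurable_space[OF m] by (intro sdiff_triangle) auto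
    qed (intro Bochner_Integration.integrable_add int)
    then show ?thesis by (simp add: int)
  qed
  define P where "P a b \<longleftrightarrow> 0 \<le> a \<longrightarrow> b \<le> 1 \<longrightarrow>
    (\<integral>\<omega>. sdiff (A \<omega> (line x y a)) (A \<omega> (line x y b)) \<partial>M) \<le> C * ((b - a) * dist1 V x y)" for a b
  have near: "(\<integral>\<omega>. sdiff (A \<omega> (line x y a)) (A \<omega> (line x y b)) \<partial>M) \<le> C * ((b - a) * dist1 V x y)"
    if "0 \<le> a" "a \<le> b" "b \<le> 1" "aligned V (line x y a) (line x y b)" for a b
    using loc[OF conv conv that(4)] that by (simp add: dist1_line)
  have "P 0 1"
  proof (rule Bolzano)
    fix a b c assume "P a b" "P b c" "a \<le> b" "b \<le> c"
    then show "P a c"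
      using tri[of "line x y a" "line x y c" "line x y b"] by (auto simp: P_def algebra_simps)
  next
    fix t :: real assume "0 \<le> t" "t \<le> 1"
    obtain d where d: "d > 0" "\<And>s. dist s t < d \<Longrightarrow> aligned V (line x y t) (line x y s)"
      using eventually_aligned_line[OF V, of x y t] unfolding eventually_nhds_metric by blast
    \<comment> \<open>The endpoints \<open>a\<close> and \<open>b\<close> need not be aligned with
      each other, only with the centre \<open>t\<close>; hence the detour through
      \<open>t\<close>.\<close>
    have "P a b" if ab: "a \<le> t" "t \<le> b" "b - a < d" for a b
      unfolding P_def
    proof (intro impI)
      assume "0 \<le> a" "b \<le> 1"
      have "aligned V (line x y a) (line x y t)" "aligned V (line x y t) (line x y b)"
        using d(2)[of a] d(2)[of b] ab by (auto intro: aligned_commute simp: dist_real_def)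
      then have "(\<integral>\<omega>. sdiff (A \<omega> (line x y a)) (A \<omega> (line x y t)) \<partial>M) \<le> C * ((t - a) * dist1 V x y)"
        "(\<integral>\<omega>. sdiff (A \<omega> (line x y t)) (A \<omega> (line x y b)) \<partial>M) \<le> C * ((b - t) * dist1 V x y)"
        using near ab \<open>0 \<le> a\<close> \<open>b \<le> 1\<close> by auto
      then show "(\<integral>\<omega>. sdiff (A \<omega> (line x y a)) (A \<omega> (line x y b)) \<partial>M) \<le> C * ((b - a) * dist1 V x y)"
        using tri[of "line x y a" "line x y b" "line x y t"] by (simp add: algebra_simps)
    qed
    then show "\<exists>d>0. \<forall>a b. a \<le> t \<and> t \<le> b \<and> b - a < d \<longrightarrow> P a b" using d(1) by blast
  qed simp
  moreover have "line x y 0 = x" "line x y 1 = y" by (auto simp: line_def fun_eq_iff)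
  ultimately show ?thesis by (simp add: P_def)
qed

section \<open>From a sampler to a measure on maps, and the final constant\<close>

lemma Delta_ubox: "x \<in> Delta n k \<Longrightarrow> x \<in> ubox {1..n} \<and> l1_norm n x = sum x {1..n} \<and> sum x {1..n} \<le> real k"
proof -
  assume x: "x \<in> Delta n k"
  then have b: "x \<in> ubox {1..n}" by (auto simp: Delta_def ubox_def PiE_iff)
  moreover have "l1_norm n x = sum x {1..n}"
    unfolding l1_norm_def by (rule sum.cong) (use b in \<open>auto simp: ubox_def\<close>)
  ultimately show ?thesis using x by (simp add: Delta_def)
qed

lemma sampler_to_stretch:
  fixes M :: "'w measure"
  assumes S: "sampler M A {1..n}"
    and stable: "\<And>x y. x \<in> Delta n k \<Longrightarrow> y \<in> Delta n k \<Longrightarrow>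
      (\<integral>\<omega>. sdiff (A \<omega> x) (A \<omega> y) \<partial>M) \<le> \<alpha> * dist1 {1..n} x y"
  shows "\<exists>D. stretch_correlated_sampling \<alpha> n k D"
proof -
  interpret M: prob_space M using S by (simp add: sampler_def)
  let ?C = "count_space (Pow {1..n}) :: nat set measure"
  let ?P = "PiM (Delta n k) (\<lambda>_. ?C)"
  define f where "f \<omega> = restrict (A \<omega>) (Delta n k)" for \<omega>
  \<comment> \<open>The space becomes the set of maps that actually arise from a sample, so the
    cardinality condition holds on all of it.\<close>
  let ?R = "restrict_space ?P (f ` space M)"
  define D where "D = distr M ?R f"
  have m: "(\<lambda>\<omega>. A \<omega> x) \<in> M \<rightarrow>\<^sub>M count_space (Collect finite)" for x using S by (simp add: sampler_def)
  have sub: "A \<omega> x \<subseteq> {1..n}" if "\<omega> \<in> space M" for \<omega> x using S that by (simp add: sampler_def)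
  have mP: "(\<lambda>\<omega>. A \<omega> x) \<in> M \<rightarrow>\<^sub>M ?C" for x
    using sub sets_Collect_set_fun[OF m, of "\<lambda>S. S = _" x]
    by (auto simp: measurable_count_space_eq2 vimage_def Int_def conj_commute)
  have fP: "f \<in> M \<rightarrow>\<^sub>M ?P" unfolding f_def
    by (rule measurable_restrict) (rule mP)
  then have fR: "f \<in> M \<rightarrow>\<^sub>M ?R" by (intro measurable_restrict_space2) auto
  have sp: "space D = f ` space M"
    using measurable_space[OF fP] by (auto simp: D_def space_restrict_space)
  have em: "(\<lambda>B. B x) \<in> ?R \<rightarrow>\<^sub>M ?C" if "x \<in> Delta n k" for x
    by (rule measurable_restrict_space1) (rule measurable_component_singleton[OF that])
  have emD: "(\<lambda>B. B x) \<in> D \<rightarrow>\<^sub>M ?C" if "x \<in> Delta n k" for x using em[OF that] by (simp add: D_def)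
  have em': "(\<lambda>B. B x) \<in> ?R \<rightarrow>\<^sub>M count_space (Collect finite)" if "x \<in> Delta n k" for x
    by (rule measurable_compose[OF em[OF that]]) (auto simp: measurable_count_space_eq1 intro: finite_subset)
  have corr: "correlated_sampling n k D"
    unfolding correlated_sampling_def
  proof (intro conjI ballI)
    show "prob_space D" unfolding D_def by (rule M.prob_space_distr[OF fR])
    show "space D \<subseteq> Delta n k \<rightarrow>\<^sub>E Pow {1..n}" unfolding sp f_def
      using sub by (auto simp del: atLeastAtMost_iff) (metis subsetD)
    fix x assume "x \<in> Delta n k" then show "(\<lambda>B. B x) \<in> D \<rightarrow>\<^sub>M ?C" by (rule emD)
  qed
  have "stretch_correlated_sampling \<alpha> n k D"
    unfolding stretch_correlated_sampling_def
  proof (intro conjI ballI corr)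
    fix x B assume x: "x \<in> Delta n k" and "B \<in> space D"
    then obtain \<omega> where w: "\<omega> \<in> space M" "B = f \<omega>" by (auto simp: sp)
    then show "int (card (B x)) \<in> {\<lfloor>l1_norm n x\<rfloor>, \<lceil>l1_norm n x\<rceil>}"
      using S x Delta_ubox[OF x] by (simp add: f_def sampler_def)
  next
    fix x i assume x: "x \<in> Delta n k" and i: "i \<in> {1..n}"
    have "measure D {B \<in> space D. i \<in> B x} = measure M (f -` {B \<in> space D. i \<in> B x} \<inter> space M)"
      unfolding D_def by (rule measure_distr[OF fR]) (use sets_Collect_set_fun[OF em'[OF x]] in simp)
    also have "f -` {B \<in> space D. i \<in> B x} \<inter> space M = {\<omega> \<in> space M. i \<in> A \<omega> x}"
      using x by (auto simp: sp f_def)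
    finally show "measure D {B \<in> space D. i \<in> B x} = x i"
      using S x i Delta_ubox[OF x] by (simp add: sampler_def)
  next
    fix x y assume x: "x \<in> Delta n k" and y: "y \<in> Delta n k"
    have "(\<integral>B. real (card (sym_diff (B x) (B y))) \<partial>D) = (\<integral>B. sdiff (B x) (B y) \<partial>D)"
      by (simp add: sdiff_def)
    also have "\<dots> = (\<integral>\<omega>. sdiff (f \<omega> x) (f \<omega> y) \<partial>M)"
      unfolding D_def by (rule integral_distr[OF fR]) (rule measurable_set_fun2[OF em'[OF x] em'[OF y], where f=sdiff], simp)
    also have "\<dots> \<le> \<alpha> * dist1 {1..n} x y" using stable[OF x y] x y by (simp add: f_def)
    finally show "(\<integral>B. real (card (sym_diff (B x) (B y))) \<partial>D) \<le> \<alpha> * l1_norm n (\<lambda>i. x i - y i)"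
      by (simp add: dist1_def l1_norm_def)
  qed
  then show ?thesis by blast
qed

theorem theorem1p2:
  "\<exists>c::real. c > 0 \<and>
     (\<forall>n k::nat. n \<ge> 1 \<longrightarrow> k \<ge> 1 \<longrightarrow>
        (\<exists>\<alpha>::real. \<alpha> \<le> c * log_rate k \<and>
           (\<exists>D. stretch_correlated_sampling \<alpha> n k D)))"
\<comment> \<open>\<open>real L + 1 \<le> 2 * log 2 (real k) + 2 \<le> 4 * log_rate k\<close>, and 4
  times 168 is 672.\<close>
proof (rule exI[of _ 672], intro conjI allI impI)
  fix n k :: nat assume "n \<ge> 1" and k: "k \<ge> 1"
  let ?V = "{1..n}"
  \<comment> \<open>The least depth with \<open>2 ^ L\<close> at least the square of
    \<open>k\<close>; for \<open>k = 1\<close> the tree is a single bucket.\<close>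
  define L where "L = nat \<lceil>2 * log 2 (real k)\<rceil>"
  have lg: "0 \<le> log 2 (real k)" using k by simp
  have L: "2 * log 2 (real k) \<le> real L" "real L \<le> 2 * log 2 (real k) + 1"
    unfolding L_def using lg by linarith+
  have "(real k)\<^sup>2 = 2 powr (2 * log 2 (real k))"
    using k by (simp add: powr_powr[symmetric] mult.commute[of 2] powr_numeral)
  also have "\<dots> \<le> 2 powr real L" using L by simp
  also have "\<dots> = 2 ^ L" by (simp add: powr_realpow)
  finally have kL: "(real k)\<^sup>2 \<le> 2 ^ L" .
  obtain M :: "((nat \<Rightarrow> nat) \<times> ((nat \<Rightarrow> nat) \<Rightarrow> real \<times> ((nat \<Rightarrow> real) \<Rightarrow> int \<Rightarrow> nat set))) measure" and A
    where S: "sampler M A ?V"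
      and stable: "\<And>x y. x \<in> ubox ?V \<Longrightarrow> y \<in> ubox ?V \<Longrightarrow> sum x ?V \<le> real k \<Longrightarrow> sum y ?V \<le> real k \<Longrightarrow> aligned ?V x y \<Longrightarrow>
       (\<integral>\<omega>. sdiff (A \<omega> x) (A \<omega> y) \<partial>M) \<le> 168 * (real L + 1) * dist1 ?V x y"
    using ex_local_sampler[OF _ kL, of ?V] by auto
  let ?X = "{x \<in> ubox ?V. sum x ?V \<le> real k}"
  have lipD: "(\<integral>\<omega>. sdiff (A \<omega> x) (A \<omega> y) \<partial>M) \<le> 168 * (real L + 1) * dist1 ?V x y"
    if x: "x \<in> Delta n k" and y: "y \<in> Delta n k" for x y
  proof (rule local_to_global[OF S, where X="?X"])
    fix t :: real assume t: "0 \<le> t" "t \<le> 1"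
    have e: "line x y t i = (1 - t) * x i + t * y i" for i by (simp add: line_def algebra_simps)
    have "line x y t \<in> ubox ?V"
      unfolding ubox_def
    proof (intro CollectI ballI conjI)
      fix i assume "i \<in> ?V"
      then have "0 \<le> x i" "x i \<le> 1" "0 \<le> y i" "y i \<le> 1" using Delta_ubox[OF x] Delta_ubox[OF y] by (auto simp: ubox_def)
      then show "0 \<le> line x y t i" "line x y t i \<le> 1"
        unfolding e using t convex_bound_le[of "x i" 1 "y i" "1 - t" t] by auto
    qed
    moreover have "sum (line x y t) ?V \<le> real k"
    proof -
      have "sum (line x y t) ?V = (1 - t) * sum x ?V + t * sum y ?V"
        unfolding e sum.distrib sum_distrib_left[symmetric] ..
      also have "\<dots> \<le> real k"
        using Delta_ubox[OF x] Delta_ubox[OF y] t by (intro convex_bound_le) auto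
      finally show ?thesis .
    qed
    ultimately show "line x y t \<in> ?X" by simp
  qed (use stable in auto)
  have "\<exists>D. stretch_correlated_sampling (168 * (real L + 1)) n k D"
    by (rule sampler_to_stretch[OF S lipD])
  moreover have "168 * (real L + 1) \<le> 672 * log_rate k"
    using L lg by (simp add: log_rate_def)
  ultimately show "\<exists>\<alpha>. \<alpha> \<le> 672 * log_rate k \<and> (\<exists>D. stretch_correlated_sampling \<alpha> n k D)" by blast
qed simp

end
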